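(* (i) Let $n \ge 3$. Up to isomorphism, the finite simple quotient groups of $\mathrm{SL}_n(\mathbb{Z})$ are exactly the groups $\mathrm{PSL}_n(\mathbb{Z}_p)$, where $p$ ranges over the prime numbers. (ii) Let $g \ge 3$. Up to isomorphism, the finite simple quotient groups of the symplectic group $\mathrm{Sp}_{2g}(\mathbb{Z})$ are exactly the groups $\mathrm{PSp}_{2g}(\mathbb{Z}_p)$, where $p$ ranges over the prime numbers.
   Context: "Simple group" always means nonabelian simple group. $\mathbb{Z}_p = \mathbb{Z}/p\mathbb{Z}$. A quotient of a group $\Gamma$ is a group $G$ for which there is a surjective homomorphism $\Gamma \to G$. $\mathrm{PSL}_n(\mathbb{Z}_p)$ and $\mathrm{PSp}_{2g}(\mathbb{Z}_p)$ denote the quotients of $\mathrm{SL}_n(\mathbb{Z}_p)$ and $\mathrm{Sp}_{2g}(\mathbb{Z}_p)$ by their centers; $\mathrm{Sp}_{2g}$ is the group of $2g\times 2g$ symplectic matrices. *)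

theory Defs
  imports
    "HOL-Algebra.SimpleGroups"
    "HOL-Number_Theory.Cong"
    "Jordan_Normal_Form.Determinant"
begin

definition center :: "('a, 'b) monoid_scheme \<Rightarrow> 'a set" where
  "center G = {z \<in> carrier G. \<forall>x \<in> carrier G. x \<otimes>\<^bsub>G\<^esub> z = z \<otimes>\<^bsub>G\<^esub> x}"

definition finite_nonabelian_simple :: "('a, 'b) monoid_scheme \<Rightarrow> bool" where
  "finite_nonabelian_simple G \<longleftrightarrow> finite (carrier G) \<and> simple_group G \<and> \<not> comm_group G"

definition is_quotient_of :: "('a, 'b) monoid_scheme \<Rightarrow> ('c, 'd) monoid_scheme \<Rightarrow> bool" where
  "is_quotient_of G \<Gamma> \<longleftrightarrow> epi \<Gamma> G \<noteq> {}"

text \<open>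
  The modulus has to vary inside the statement, so a matrix over \<open>\<int>/p\<int>\<close> is represented by the
  integer matrix of its least non-negative residues; the operations are those of integer
  matrices followed by reduction.  Only \<open>p \<ge> 2\<close> is intended: for \<open>p = 1\<close> the identity matrix is
  not reduced.
\<close>

definition reduce_mat :: "nat \<Rightarrow> int mat \<Rightarrow> int mat" where
  "reduce_mat p A = map_mat (\<lambda>x. x mod int p) A"

definition residue_mats :: "nat \<Rightarrow> nat \<Rightarrow> int mat set" where
  "residue_mats n p = {A \<in> carrier_mat n n. elements_mat A \<subseteq> {0..<int p}}"

definition SL_int :: "nat \<Rightarrow> int mat monoid" where
  "SL_int n = \<lparr>carrier = {A \<in> carrier_mat n n. det A = 1}, monoid.mult = (*), one = 1\<^sub>m n\<rparr>"

definition SL_mod :: "nat \<Rightarrow> nat \<Rightarrow> int mat monoid" where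
  "SL_mod n p = \<lparr>carrier = {A \<in> residue_mats n p. [det A = 1] (mod int p)},
     monoid.mult = (\<lambda>A B. reduce_mat p (A * B)), one = 1\<^sub>m n\<rparr>"

definition symplectic_form :: "nat \<Rightarrow> int mat" where
  "symplectic_form g = four_block_mat (0\<^sub>m g g) (1\<^sub>m g) (- 1\<^sub>m g) (0\<^sub>m g g)"

definition Sp_int :: "nat \<Rightarrow> int mat monoid" where
  "Sp_int g = \<lparr>carrier = {A \<in> carrier_mat (2 * g) (2 * g).
       transpose_mat A * symplectic_form g * A = symplectic_form g},
     monoid.mult = (*), one = 1\<^sub>m (2 * g)\<rparr>"

definition Sp_mod :: "nat \<Rightarrow> nat \<Rightarrow> int mat monoid" where
  "Sp_mod g p = \<lparr>carrier = {A \<in> residue_mats (2 * g) p.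
       reduce_mat p (transpose_mat A * symplectic_form g * A) = reduce_mat p (symplectic_form g)},
     monoid.mult = (\<lambda>A B. reduce_mat p (A * B)), one = 1\<^sub>m (2 * g)\<rparr>"

definition PSL_mod :: "nat \<Rightarrow> nat \<Rightarrow> int mat set monoid" where
  "PSL_mod n p = SL_mod n p Mod center (SL_mod n p)"

definition PSp_mod :: "nat \<Rightarrow> nat \<Rightarrow> int mat set monoid" where
  "PSp_mod g p = Sp_mod g p Mod center (Sp_mod g p)"

end

theory Submission
  imports Defs "HOL-Algebra.Multiplicative_Group" "HOL-Library.Function_Algebras"
begin

text \<open>
  Let \<open>\<Gamma>\<close> be \<open>SL\<^sub>n(\<int>)\<close> or \<open>Sp\<^sub>2\<^sub>g(\<int>)\<close>, let \<open>C m\<close> be its principal congruence subgroup of level \<open>m\<close>, and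
  let \<open>K\<close> be the kernel of an epimorphism onto a finite simple group \<open>Q\<close> of order \<open>N\<close>.  All
  \<open>N\<close>-th powers lie in \<open>K\<close>, in particular all elementary matrices with entries divisible by
  \<open>N\<close>.  Multiplying by such matrices and conjugating brings any element of \<open>C N\<close> into a
  block form which normalises two opposite unipotent subgroups generating \<open>\<Gamma>\<close> and acts trivially
  on them modulo \<open>K\<close>.  So \<open>C N\<close> is central modulo \<open>K\<close>, hence contained in \<open>K\<close>, because \<open>Q\<close> has
  trivial center.  This weak form replaces the congruence subgroup property.

  The least \<open>p > 0\<close> with \<open>C p \<subseteq> K\<close> is prime: if \<open>p = a b\<close> properly, then \<open>C a\<close> and \<open>C b\<close> both map
  onto \<open>Q\<close>, but \<open>[C a, C b] \<subseteq> C (a b) \<subseteq> K\<close> makes \<open>Q\<close> abelian.  Simplicity of the projective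
  groups over \<open>\<int>/p\<int>\<close>, in the form that a proper normal subgroup of \<open>\<Gamma>\<close> containing \<open>C p\<close> is central
  modulo \<open>C p\<close>, then identifies \<open>K\<close> with the preimage of the center.
\<close>

section \<open>Groups with a family of congruence subgroups\<close>

text \<open>The finite matrix groups are hardly computed with: the arguments run in the integral
  group, with vectors compared modulo \<open>m\<close>. One lifting lemma for each family carries
  the arithmetic: a matrix that satisfies the defining condition modulo \<open>m\<close> is
  congruent modulo \<open>m\<close> to an element of any subgroup that contains the elementary
  elements. At \<open>m = 0\<close> congruence is equality and this is generation; at
  \<open>m = p\<close> it gives surjectivity of reduction. The obstacle in the weak congruence
  property is the corner entry of a matrix in \<open>C N\<close>. It is only 1 modulo
  \<open>N\<close>, while elements of \<open>K\<close> can clear multiples of \<open>N\<close>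
  exactly only against an entry that equals 1. Making the corner equal to 1 costs one spare
  coordinate in the linear case and one spare hyperbolic plane in the symplectic case; this is where
  \<open>n\<close> and \<open>g\<close> at least 3 enter. The same bound gives perfectness, which
  fails for Sp_4(Z) because it maps onto Sp_4(F_2), the symmetric group S_6. Simplicity modulo
  \<open>p\<close> needs no exception for small primes, because Iwasawa's criterion is fed with
  perfectness of the integral group.\<close>

lemma (in group) inv_comm_iff:
  assumes "a \<in> carrier G" "b \<in> carrier G"
  shows "a \<otimes> b \<otimes> inv a \<otimes> inv b = \<one> \<longleftrightarrow> a \<otimes> b = b \<otimes> a"
proof
  assume "a \<otimes> b \<otimes> inv a \<otimes> inv b = \<one>"
  then have "a \<otimes> b \<otimes> inv a \<otimes> inv b \<otimes> b \<otimes> a = b \<otimes> a"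
    using assms by (simp add: m_assoc)
  then show "a \<otimes> b = b \<otimes> a"
    using assms by (simp add: m_assoc inv_solve_right')
next
  assume "a \<otimes> b = b \<otimes> a"
  then show "a \<otimes> b \<otimes> inv a \<otimes> inv b = \<one>"
    using assms by (simp add: m_assoc)
qed

lemma (in group_hom) hom_commutator:
  assumes "a \<in> carrier G" "b \<in> carrier G"
  shows "h (a \<otimes> b \<otimes> inv a \<otimes> inv b) = \<one>\<^bsub>H\<^esub> \<longleftrightarrow> h a \<otimes>\<^bsub>H\<^esub> h b = h b \<otimes>\<^bsub>H\<^esub> h a"
  using assms by (simp add: H.inv_comm_iff)

lemma (in group_hom) subgroup_commuting:
  assumes a: "a \<in> carrier G"
  shows "subgroup {b \<in> carrier G. h a \<otimes>\<^bsub>H\<^esub> h b = h b \<otimes>\<^bsub>H\<^esub> h a} G"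
proof
  fix x y
  assume "x \<in> {b \<in> carrier G. h a \<otimes>\<^bsub>H\<^esub> h b = h b \<otimes>\<^bsub>H\<^esub> h a}"
    and "y \<in> {b \<in> carrier G. h a \<otimes>\<^bsub>H\<^esub> h b = h b \<otimes>\<^bsub>H\<^esub> h a}"
  then have x: "x \<in> carrier G" "h a \<otimes>\<^bsub>H\<^esub> h x = h x \<otimes>\<^bsub>H\<^esub> h a"
    and y: "y \<in> carrier G" "h a \<otimes>\<^bsub>H\<^esub> h y = h y \<otimes>\<^bsub>H\<^esub> h a" by auto
  have "h a \<otimes>\<^bsub>H\<^esub> (h x \<otimes>\<^bsub>H\<^esub> h y) = h x \<otimes>\<^bsub>H\<^esub> (h a \<otimes>\<^bsub>H\<^esub> h y)"
    using a x y by (metis H.m_assoc hom_closed)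
  also have "\<dots> = h x \<otimes>\<^bsub>H\<^esub> h y \<otimes>\<^bsub>H\<^esub> h a"
    using a x y by (metis H.m_assoc hom_closed)
  finally show "x \<otimes> y \<in> {b \<in> carrier G. h a \<otimes>\<^bsub>H\<^esub> h b = h b \<otimes>\<^bsub>H\<^esub> h a}"
    using x y by simp
next
  fix x
  assume "x \<in> {b \<in> carrier G. h a \<otimes>\<^bsub>H\<^esub> h b = h b \<otimes>\<^bsub>H\<^esub> h a}"
  then have x: "x \<in> carrier G" "h a \<otimes>\<^bsub>H\<^esub> h x = h x \<otimes>\<^bsub>H\<^esub> h a" by auto
  have "h a \<otimes>\<^bsub>H\<^esub> inv\<^bsub>H\<^esub> h x = inv\<^bsub>H\<^esub> h x \<otimes>\<^bsub>H\<^esub> (h x \<otimes>\<^bsub>H\<^esub> h a) \<otimes>\<^bsub>H\<^esub> inv\<^bsub>H\<^esub> h x"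
    using a x(1) by (simp flip: H.m_assoc)
  also have "\<dots> = inv\<^bsub>H\<^esub> h x \<otimes>\<^bsub>H\<^esub> h a"
    unfolding x(2)[symmetric] using a x(1) by (simp add: H.m_assoc)
  finally have "h a \<otimes>\<^bsub>H\<^esub> inv\<^bsub>H\<^esub> h x = inv\<^bsub>H\<^esub> h x \<otimes>\<^bsub>H\<^esub> h a" .
  then show "inv x \<in> {b \<in> carrier G. h a \<otimes>\<^bsub>H\<^esub> h b = h b \<otimes>\<^bsub>H\<^esub> h a}"
    using x by simp
qed (use a in auto)

lemma (in group_hom) normal_central_preimage:
  "{a \<in> carrier G. \<forall>b\<in>carrier G. h a \<otimes>\<^bsub>H\<^esub> h b = h b \<otimes>\<^bsub>H\<^esub> h a} \<lhd> G" (is "?Z \<lhd> G")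
proof (rule G.normal_invI)
  have "?Z = (\<Inter>b\<in>carrier G. {a \<in> carrier G. h b \<otimes>\<^bsub>H\<^esub> h a = h a \<otimes>\<^bsub>H\<^esub> h b})" (is "_ = ?I")
    using G.one_closed by (auto dest: sym)
  moreover have "subgroup ?I G"
    using G.subgroups_Inter[of "(\<lambda>b. {a \<in> carrier G. h b \<otimes>\<^bsub>H\<^esub> h a = h a \<otimes>\<^bsub>H\<^esub> h b}) ` carrier G"]
      subgroup_commuting G.one_closed by blast
  ultimately show "subgroup ?Z G" by simp
next
  fix x a
  assume x: "x \<in> carrier G" and "a \<in> ?Z"
  then have a: "a \<in> carrier G" and c: "\<And>b. b \<in> carrier G \<Longrightarrow> h a \<otimes>\<^bsub>H\<^esub> h b = h b \<otimes>\<^bsub>H\<^esub> h a" by auto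
  have "h (x \<otimes> a \<otimes> inv x) = h a"
    using c[OF x] x a by (simp flip: c add: H.m_assoc)
  then show "x \<otimes> a \<otimes> inv x \<in> ?Z" using x a c by simp
qed

text \<open>The preimage of the center of the quotient by \<open>K\<close>. The form with
  commutators keeps the discussion inside \<open>G\<close>, where the matrices act on
  vectors.\<close>

definition (in group) central_mod :: "'a set \<Rightarrow> 'a set" where
  "central_mod K = {a \<in> carrier G. \<forall>b\<in>carrier G. a \<otimes> b \<otimes> inv a \<otimes> inv b \<in> K}"

lemma (in group_hom) central_mod_kernel:
  "G.central_mod (kernel G H h) = {a \<in> carrier G. \<forall>b\<in>carrier G. h a \<otimes>\<^bsub>H\<^esub> h b = h b \<otimes>\<^bsub>H\<^esub> h a}"
  unfolding G.central_mod_def kernel_def using hom_commutator by auto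

lemma (in normal) group_hom_Mod: "group_hom G (G Mod H) (\<lambda>a. H #> a)"
  by (simp add: group_hom_def group_hom_axioms_def factorgroup_is_group r_coset_hom_Mod is_group)

lemma (in normal) r_coset_eq_iff: "a \<in> carrier G \<Longrightarrow> H #> a = H \<longleftrightarrow> a \<in> H"
  using coset_join1[OF _ _ subgroup_axioms] coset_join2[OF _ subgroup_axioms] by blast

lemma (in normal) kernel_Mod: "kernel G (G Mod H) (\<lambda>a. H #> a) = H"
  using r_coset_eq_iff subset by (auto simp: kernel_def)

lemma (in normal) central_mod_normal: "central_mod H \<lhd> G"
  using group_hom.central_mod_kernel[OF group_hom_Mod] group_hom.normal_central_preimage[OF group_hom_Mod]
  by (simp add: kernel_Mod)

lemma (in normal) subset_central_mod: "H \<subseteq> central_mod H"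
proof
  fix a assume a: "a \<in> H"
  have "a \<otimes> b \<otimes> inv a \<otimes> inv b \<in> H" if b: "b \<in> carrier G" for b
    using inv_op_closed2[OF b, of "inv a"] a b by (simp add: m_assoc)
  then show "a \<in> central_mod H" using a by (auto simp: central_mod_def)
qed

lemma (in normal) commutator_mem_iff:
  assumes "a \<in> carrier G" "b \<in> carrier G"
  shows "a \<otimes> b \<otimes> inv a \<otimes> inv b \<in> H \<longleftrightarrow>
    (H #> a) \<otimes>\<^bsub>G Mod H\<^esub> (H #> b) = (H #> b) \<otimes>\<^bsub>G Mod H\<^esub> (H #> a)"
proof -
  interpret h: group_hom G "G Mod H" "\<lambda>a. H #> a" by (rule group_hom_Mod)
  show ?thesis
    using h.hom_commutator[OF assms] r_coset_eq_iff[of "a \<otimes> b \<otimes> inv a \<otimes> inv b"] assms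
    by (simp del: h.hom_mult)
qed

lemma (in normal) commutator_mem_sym:
  assumes "a \<in> carrier G" "b \<in> carrier G"
  shows "a \<otimes> b \<otimes> inv a \<otimes> inv b \<in> H \<longleftrightarrow> b \<otimes> a \<otimes> inv b \<otimes> inv a \<in> H"
  using commutator_mem_iff assms by metis

text \<open>Centralizers modulo \<open>H\<close> are subgroups, so commutation modulo
  \<open>H\<close> need only be checked on generators. This is how generation by elementary elements
  is exploited later.\<close>

lemma (in normal) subgroup_commuting_mod:
  assumes a: "a \<in> carrier G"
  shows "subgroup {b \<in> carrier G. a \<otimes> b \<otimes> inv a \<otimes> inv b \<in> H} G"
  using group_hom.subgroup_commuting[OF group_hom_Mod a] commutator_mem_iff[OF a]
  by (simp cong: conj_cong)

text \<open>The center is normal, hence trivial or everything, and in the second case the group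
  would be commutative.\<close>

lemma (in simple_group) central_trivial:
  assumes "\<not> comm_group G" "a \<in> carrier G" "\<And>b. b \<in> carrier G \<Longrightarrow> a \<otimes> b = b \<otimes> a"
  shows "a = \<one>"
proof -
  interpret h: group_hom G G id by unfold_locales (simp add: hom_def)
  let ?Z = "{a \<in> carrier G. \<forall>b\<in>carrier G. a \<otimes> b = b \<otimes> a}"
  have "?Z \<lhd> G" using h.normal_central_preimage by simp
  moreover have "?Z \<noteq> carrier G" 
  proof
    assume "?Z = carrier G"
    then have "a \<otimes> b = b \<otimes> a" if "a \<in> carrier G" "b \<in> carrier G" for a b using that by blast
    then show False using assms(1) group_comm_groupI by blast
  qed
  ultimately have "?Z = {\<one>}" using no_real_normal_subgroup by blast
  then show ?thesis using assms by blast
qed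

text \<open>What the classification uses about the matrix groups, collected so that it is carried
  out once for both families. \<open>csp\<close> is the weak congruence property.
  \<open>perfect\<close> speaks of subgroups so that it applies directly to a kernel. The
  \<open>R p\<close> are mere monoid records: that they are groups follows because they are images
  of \<open>G\<close>, and \<open>\<rho>_one\<close> is required because preserving products alone
  does not determine the unit of the record.\<close>

locale congruence_family = group G for G (structure) +
  fixes C :: "nat \<Rightarrow> 'a set" and R :: "nat \<Rightarrow> 'c monoid" and \<rho> :: "nat \<Rightarrow> 'a \<Rightarrow> 'c"
  assumes perfect: "subgroup D G \<Longrightarrow>
      (\<And>a b. a \<in> carrier G \<Longrightarrow> b \<in> carrier G \<Longrightarrow> a \<otimes> b \<otimes> inv a \<otimes> inv b \<in> D) \<Longrightarrow> D = carrier G"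
    and C_normal: "C m \<lhd> G"
    and C_1: "C 1 = carrier G"
    and C_commutator: "a \<in> C m \<Longrightarrow> b \<in> C k \<Longrightarrow> a \<otimes> b \<otimes> inv a \<otimes> inv b \<in> C (m * k)"
    and csp: "K \<lhd> G \<Longrightarrow> N > 0 \<Longrightarrow> (\<And>x. x \<in> carrier G \<Longrightarrow> x [^] N \<in> K) \<Longrightarrow> C N \<subseteq> central_mod K"
    and almost_simple: "prime p \<Longrightarrow> H \<lhd> G \<Longrightarrow> C p \<subseteq> H \<Longrightarrow> H \<noteq> carrier G \<Longrightarrow> H \<subseteq> central_mod (C p)"
    and nonabelian: "prime p \<Longrightarrow> central_mod (C p) \<noteq> carrier G"
    and \<rho>_epi: "prime p \<Longrightarrow> \<rho> p \<in> epi G (R p)"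
    and \<rho>_one: "prime p \<Longrightarrow> \<rho> p \<one> = \<one>\<^bsub>R p\<^esub>"
    and \<rho>_kernel: "prime p \<Longrightarrow> x \<in> carrier G \<Longrightarrow> \<rho> p x = \<one>\<^bsub>R p\<^esub> \<longleftrightarrow> x \<in> C p"
    and R_finite: "prime p \<Longrightarrow> finite (carrier (R p))"
begin

definition \<psi> :: "nat \<Rightarrow> 'a \<Rightarrow> 'c set" where
  "\<psi> p x = center (R p) #>\<^bsub>R p\<^esub> \<rho> p x"

context
  fixes p :: nat
  assumes p: "prime p"
begin

lemma group_R: "group (R p)"
proof -
  have h: "\<rho> p \<in> hom G (R p)" and im: "\<rho> p ` carrier G = carrier (R p)"
    using \<rho>_epi[OF p] by (auto simp: epi_def)
  have "group (R p \<lparr>carrier := \<rho> p ` carrier G, one := \<rho> p \<one>\<rparr>)"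
    by (rule hom_imp_img_group[OF h])
  then show ?thesis by (simp add: im \<rho>_one[OF p])
qed

interpretation h: group_hom G "R p" "\<rho> p"
  using group_R \<rho>_epi[OF p] by (simp add: group_hom_def group_hom_axioms_def is_group epi_def)

lemma \<rho>_surj: "\<rho> p ` carrier G = carrier (R p)"
  using \<rho>_epi[OF p] by (simp add: epi_def)

lemma center_normal: "center (R p) \<lhd> R p"
proof -
  interpret i: group_hom "R p" "R p" id by unfold_locales (simp add: hom_def)
  have "center (R p) = {a \<in> carrier (R p). \<forall>b\<in>carrier (R p). a \<otimes>\<^bsub>R p\<^esub> b = b \<otimes>\<^bsub>R p\<^esub> a}"
    by (auto simp: center_def)
  then show ?thesis using i.normal_central_preimage by simp
qed

interpretation z: normal "center (R p)" "R p" by (rule center_normal)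

interpretation m: group_hom G "R p Mod center (R p)" "\<psi> p"
proof -
  have "(\<lambda>a. center (R p) #>\<^bsub>R p\<^esub> a) \<circ> \<rho> p \<in> hom G (R p Mod center (R p))"
    by (rule Group.hom_compose[OF h.homh z.r_coset_hom_Mod])
  moreover have "(\<lambda>a. center (R p) #>\<^bsub>R p\<^esub> a) \<circ> \<rho> p = \<psi> p" by (simp add: \<psi>_def fun_eq_iff)
  ultimately show "group_hom G (R p Mod center (R p)) (\<psi> p)"
    by (simp add: group_hom_def group_hom_axioms_def is_group z.factorgroup_is_group)
qed

lemma group_hom_\<psi>: "group_hom G (R p Mod center (R p)) (\<psi> p)" ..

lemma \<psi>_surj: "\<psi> p ` carrier G = carrier (R p Mod center (R p))"
  by (auto simp: carrier_FactGroup \<psi>_def simp flip: \<rho>_surj)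

lemma kernel_\<rho>: "kernel G (R p) (\<rho> p) = C p"
  using \<rho>_kernel[OF p] normal_imp_subgroup[OF C_normal] by (auto simp: kernel_def dest: subgroup.mem_carrier)

text \<open>Since \<open>\<rho> p\<close> is onto, centrality in \<open>R p\<close> is commutation
  with all images, and two images commute exactly when the commutator upstairs lies in the kernel
  \<open>C p\<close>.\<close>

lemma kernel_\<psi>: "kernel G (R p Mod center (R p)) (\<psi> p) = central_mod (C p)"
proof -
  have "\<psi> p x = center (R p) \<longleftrightarrow> \<rho> p x \<in> center (R p)" if "x \<in> carrier G" for x
    unfolding \<psi>_def
    using z.r_coset_eq_iff[OF h.hom_closed[OF that]] .
  then have "kernel G (R p Mod center (R p)) (\<psi> p) = {x \<in> carrier G. \<rho> p x \<in> center (R p)}"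
    by (auto simp: kernel_def)
  also have "\<dots> = {a \<in> carrier G. \<forall>b\<in>carrier G. \<rho> p a \<otimes>\<^bsub>R p\<^esub> \<rho> p b = \<rho> p b \<otimes>\<^bsub>R p\<^esub> \<rho> p a}"
    by (auto simp: center_def simp flip: \<rho>_surj)
  also have "\<dots> = central_mod (C p)"
    using h.central_mod_kernel kernel_\<rho> by simp
  finally show ?thesis .
qed

text \<open>A normal subgroup of the quotient pulls back to a normal subgroup of \<open>G\<close>
  above \<open>C p\<close>. By \<open>almost_simple\<close> the pullback is everything or lies in
  the kernel of \<open>\<psi> p\<close>. Commutativity of the quotient would make that kernel
  everything, by perfectness.\<close>

lemma simple_mod_center: "finite_nonabelian_simple (R p Mod center (R p))"
  unfolding finite_nonabelian_simple_def
proof (intro conjI)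
  let ?P = "R p Mod center (R p)"
  show fin: "finite (carrier ?P)" using R_finite[OF p] by (simp add: carrier_FactGroup)
  have nt: "central_mod (C p) \<noteq> carrier G" by (rule nonabelian[OF p])
  show "simple_group ?P"
  proof (intro simple_group.intro simple_group_axioms.intro m.H.is_group)
    have "carrier ?P \<noteq> {\<one>\<^bsub>?P\<^esub>}"
    proof
      assume "carrier ?P = {\<one>\<^bsub>?P\<^esub>}"
      then have "kernel G ?P (\<psi> p) = carrier G"
        using m.hom_closed by (auto simp: kernel_def simp del: one_FactGroup)
      then show False using nt kernel_\<psi> by simp
    qed
    then show "1 < Coset.order ?P"
      using m.H.order_one_triv_iff fin m.H.order_gt_0_iff_finite by linarith
  next
    fix M assume M: "M \<lhd> ?P"
    then interpret M: normal M ?P .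
    let ?H = "{x \<in> carrier G. \<psi> p x \<in> M}"
    have "?H \<lhd> G"
    proof (rule normal_invI)
      show "subgroup ?H G" 
      proof
        show "\<one> \<in> ?H" using M.one_closed by (simp del: one_FactGroup)
      qed (auto simp del: mult_FactGroup)
      show "x \<otimes> y \<otimes> inv x \<in> ?H" if "x \<in> carrier G" "y \<in> ?H" for x y
        using that M.inv_op_closed2 by (auto simp del: mult_FactGroup)
    qed
    moreover have "C p \<subseteq> ?H"
    proof -
      have "C p \<subseteq> central_mod (C p)" by (rule normal.subset_central_mod[OF C_normal])
      moreover have "kernel G ?P (\<psi> p) \<subseteq> ?H" using M.one_closed by (auto simp: kernel_def)
      ultimately show ?thesis unfolding kernel_\<psi> by (rule subset_trans)
    qed
    ultimately consider "?H = carrier G" | "?H \<subseteq> central_mod (C p)"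
      using almost_simple[OF p] by blast
    then show "M = carrier ?P \<or> M = {\<one>\<^bsub>?P\<^esub>}"
    proof cases
      case 1
      then have "carrier ?P \<subseteq> M" unfolding \<psi>_surj[symmetric] by blast
      then show ?thesis using M.subset by blast
    next
      case 2
      have "y = \<one>\<^bsub>?P\<^esub>" if "y \<in> M" for y
      proof -
        have "y \<in> \<psi> p ` carrier G" using that M.subset \<psi>_surj by blast
        then show ?thesis using 2 that unfolding kernel_\<psi>[symmetric] kernel_def by blast
      qed
      then show ?thesis using M.one_closed by blast
    qed
  qed
  show "\<not> comm_group ?P"
  proof
    assume "comm_group ?P"
    then have "\<psi> p a \<otimes>\<^bsub>?P\<^esub> \<psi> p b = \<psi> p b \<otimes>\<^bsub>?P\<^esub> \<psi> p a" if "a \<in> carrier G" "b \<in> carrier G" for a b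
      using that by (metis comm_groupE(4) m.hom_closed)
    then have "kernel G ?P (\<psi> p) = carrier G"
      by (intro perfect m.subgroup_kernel) (simp add: kernel_def m.hom_commutator del: m.hom_mult one_FactGroup mult_FactGroup)
    then show False using nt kernel_\<psi> by simp
  qed
qed

lemma quotient_mod_center: "is_quotient_of (R p Mod center (R p)) G"
  unfolding is_quotient_of_def epi_def using \<psi>_surj m.homh by blast

end

lemma simple_quotient_iso:
  assumes Q: "finite_nonabelian_simple Q" and epi: "is_quotient_of Q G"
  shows "\<exists>p. prime p \<and> Q \<cong> R p Mod center (R p)"
proof -
  interpret Q: simple_group Q using Q by (simp add: finite_nonabelian_simple_def)
  obtain \<phi> where \<phi>: "\<phi> \<in> hom G Q" and surj: "\<phi> ` carrier G = carrier Q"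
    using epi by (auto simp: is_quotient_of_def epi_def)
  interpret q: group_hom G Q \<phi> using \<phi> by unfold_locales
  define K where "K = kernel G Q \<phi>"
  have K: "K \<lhd> G" unfolding K_def by (rule q.normal_kernel)
  have nc: "\<not> comm_group Q" and fin: "finite (carrier Q)"
    using Q by (auto simp: finite_nonabelian_simple_def)
  have Kc: "central_mod K \<subseteq> K"
  proof
    fix a assume "a \<in> central_mod K"
    then have a: "a \<in> carrier G" and "\<And>b. b \<in> carrier G \<Longrightarrow> \<phi> a \<otimes>\<^bsub>Q\<^esub> \<phi> b = \<phi> b \<otimes>\<^bsub>Q\<^esub> \<phi> a"
      unfolding K_def q.central_mod_kernel by auto
    then have "\<phi> a = \<one>\<^bsub>Q\<^esub>" by (intro Q.central_trivial[OF nc]) (auto simp flip: surj)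
    then show "a \<in> K" using a by (simp add: K_def kernel_def)
  qed
  have KG: "K \<noteq> carrier G"
  proof
    assume "K = carrier G"
    then have "\<phi> x = \<one>\<^bsub>Q\<^esub>" if "x \<in> carrier G" for x using that by (auto simp: K_def kernel_def)
    then have "carrier Q \<subseteq> {\<one>\<^bsub>Q\<^esub>}" by (auto simp flip: surj)
    then show False using Q.simple_not_triv Q.one_closed by blast
  qed
  have "C (Coset.order Q) \<subseteq> central_mod K"
    using Q.order_gt_one by (intro csp K) (auto simp: K_def kernel_def Q.pow_order_eq_1 q.hom_nat_pow fin)
  then have ex: "\<exists>N. N > 0 \<and> C N \<subseteq> K" using Kc Q.order_gt_one by (intro exI[of _ "Coset.order Q"]) auto
  define p where "p = (LEAST N. N > 0 \<and> C N \<subseteq> K)"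
  have p0: "p > 0" and Cp: "C p \<subseteq> K"
    using LeastI_ex[OF ex] by (auto simp: p_def)
  have min: "\<not> C N \<subseteq> K" if "0 < N" "N < p" for N
    using not_less_Least[of N "\<lambda>N. N > 0 \<and> C N \<subseteq> K"] that by (auto simp: p_def)
  \<comment> \<open>Minimality of \<open>p\<close> makes this normal subgroup of \<open>Q\<close>
    nontrivial, so simplicity makes it everything.\<close>
  have img: "\<phi> ` C N = carrier Q" if "0 < N" "N < p" for N
  proof -
    have "\<phi> ` C N \<lhd> Q" using normal.surj_hom_normal_subgroup[OF C_normal q.group_hom_axioms surj] .
    moreover have "\<phi> ` C N \<noteq> {\<one>\<^bsub>Q\<^esub>}"
      using min[OF that] normal_imp_subgroup[OF C_normal] by (auto simp: K_def kernel_def dest: subgroup.mem_carrier)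
    ultimately show ?thesis using Q.no_real_normal_subgroup by blast
  qed
  have "p \<noteq> 1" using Cp KG C_1 normal_imp_subgroup[OF K] by (auto dest: subgroup.mem_carrier)
  have prime: "prime p"
  proof (rule ccontr)
    assume "\<not> prime p"
    then obtain a where a: "a dvd p" "a \<noteq> 1" "a \<noteq> p"
      using p0 \<open>p \<noteq> 1\<close> by (auto simp: prime_nat_iff)
    then obtain b where b: "p = a * b" by (auto elim: dvdE)
    have pos: "0 < a" "0 < b" using b p0 by (auto intro: Nat.gr0I)
    have "b dvd p" "b \<noteq> p" using a(2) b pos by auto
    then have ab: "a < p" "b < p"
      using dvd_imp_le[OF a(1) p0] dvd_imp_le[OF \<open>b dvd p\<close> p0] a(3) by linarith+
    have "x \<otimes>\<^bsub>Q\<^esub> y = y \<otimes>\<^bsub>Q\<^esub> x" if "x \<in> carrier Q" "y \<in> carrier Q" for x y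
    proof -
      have "x \<in> \<phi> ` C a" "y \<in> \<phi> ` C b"
        using img[OF pos(1) ab(1)] img[OF pos(2) ab(2)] that by simp_all
      then obtain u v where u: "u \<in> C a" "x = \<phi> u" and v: "v \<in> C b" "y = \<phi> v"
        by (elim imageE)
      have "u \<in> carrier G" "v \<in> carrier G"
        using u v normal_imp_subgroup[OF C_normal] by (auto dest: subgroup.mem_carrier)
      then have "\<phi> u \<otimes>\<^bsub>Q\<^esub> \<phi> v = \<phi> v \<otimes>\<^bsub>Q\<^esub> \<phi> u"
        using C_commutator[OF u(1) v(1)] Cp q.hom_commutator[of u v] unfolding b[symmetric] K_def kernel_def
        by blast
      then show ?thesis using u v by simp
    qed
    then show False using nc Q.group_comm_groupI by blast
  qed
  have "K \<subseteq> central_mod (C p)" by (rule almost_simple[OF prime K Cp KG])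
  \<comment> \<open>Commutators in \<open>C p\<close> lie in \<open>K\<close>, so what is central
    modulo \<open>C p\<close> is central modulo \<open>K\<close>, and \<open>Kc\<close>
    applies.\<close>
  moreover have "central_mod (C p) \<subseteq> K"
    using Kc Cp by (auto simp: central_mod_def)
  ultimately have ker: "K = central_mod (C p)" by blast
  have "G Mod K \<cong> Q" unfolding K_def by (rule q.FactGroup_iso[OF surj])
  then have "Q \<cong> G Mod K" using normal.factorgroup_is_group[OF K] by (simp add: group.iso_sym)
  moreover have "G Mod K \<cong> R p Mod center (R p)"
    unfolding ker kernel_\<psi>[OF prime, symmetric]
    by (rule group_hom.FactGroup_iso[OF group_hom_\<psi>[OF prime] \<psi>_surj[OF prime]])
  ultimately show ?thesis using prime iso_trans by blast
qed

end

section \<open>Integer matrices acting on vectors\<close>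

definition scal :: "int \<Rightarrow> (nat \<Rightarrow> int) \<Rightarrow> nat \<Rightarrow> int" (infixr "\<cdot>" 75) where
  "c \<cdot> x = (\<lambda>i. c * x i)"

lemma scal_apply [simp]: "(c \<cdot> x) i = c * x i"
  by (simp add: scal_def)

lemma scal_simps [simp]: "1 \<cdot> x = x" "0 \<cdot> x = 0" "c \<cdot> 0 = 0"
  by (auto simp: scal_def)

text \<open>Level 0 is equality and level 1 is no condition, so statements modulo \<open>m\<close>
  contain the integral ones.\<close>

definition vcong :: "nat \<Rightarrow> (nat \<Rightarrow> int) \<Rightarrow> (nat \<Rightarrow> int) \<Rightarrow> bool" where
  "vcong m x y \<longleftrightarrow> (\<forall>i. int m dvd x i - y i)"

definition bas :: "nat \<Rightarrow> nat \<Rightarrow> int" where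
  "bas i = (\<lambda>j. if j = i then 1 else 0)"

definition V :: "nat \<Rightarrow> (nat \<Rightarrow> int) set" where
  "V n = {x. \<forall>i\<ge>n. x i = 0}"

text \<open>Vectors of every dimension are functions on all of \<open>\<nat>\<close>; a matrix acts as the identity on the
  coordinates beyond its size.\<close>

definition ap :: "int mat \<Rightarrow> (nat \<Rightarrow> int) \<Rightarrow> nat \<Rightarrow> int" where
  "ap A x = (\<lambda>i. if i < dim_row A then \<Sum>j<dim_col A. A $$ (i, j) * x j else x i)"

lemma bas_apply: "bas i j = (if j = i then 1 else 0)"
  by (simp add: bas_def)

lemma bas_in_V [simp]: "bas i \<in> V n \<longleftrightarrow> i < n"
  by (auto simp: V_def bas_def)

lemma V_closed [simp]:
  "x \<in> V n \<Longrightarrow> y \<in> V n \<Longrightarrow> x + y \<in> V n" "x \<in> V n \<Longrightarrow> y \<in> V n \<Longrightarrow> x - y \<in> V n"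
  "x \<in> V n \<Longrightarrow> - x \<in> V n" "x \<in> V n \<Longrightarrow> c \<cdot> x \<in> V n" "0 \<in> V n"
  by (auto simp: V_def)

lemma vcong_refl [simp]: "vcong m x x"
  by (simp add: vcong_def)

lemma vcong_sym: "vcong m x y \<Longrightarrow> vcong m y x"
  by (auto simp: vcong_def dvd_diff_commute)

lemma vcong_trans [trans]: "vcong m x y \<Longrightarrow> vcong m y z \<Longrightarrow> vcong m x z"
  unfolding vcong_def using dvd_add[of "int m" "x _ - y _" "y _ - z _"] by (metis (no_types) diff_add_cancel add_diff_eq)

lemma vcong_add: "vcong m x y \<Longrightarrow> vcong m x' y' \<Longrightarrow> vcong m (x + x') (y + y')"
  unfolding vcong_def by (simp add: add_diff_add)

lemma vcong_scal: "vcong m x y \<Longrightarrow> vcong m (c \<cdot> x) (c \<cdot> y)"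
  unfolding vcong_def by (simp flip: right_diff_distrib)

lemma vcong_scal_left: "int m dvd c - d \<Longrightarrow> vcong m (c \<cdot> x) (d \<cdot> x)"
  unfolding vcong_def by (simp flip: left_diff_distrib)

lemma vcong_0 [simp]: "vcong 0 x y \<longleftrightarrow> x = y"
  by (auto simp: vcong_def)

lemma vcong_1 [simp]: "vcong (Suc 0) x y"
  by (auto simp: vcong_def)

lemma vcong_obtain:
  assumes "vcong m x y"
  obtains z where "x = y + int m \<cdot> z"
proof
  have "x i = y i + int m * ((x i - y i) div int m)" for i
    using assms by (auto simp: vcong_def)
  then show "x = y + int m \<cdot> (\<lambda>i. (x i - y i) div int m)" by (auto simp: fun_eq_iff)
qed

lemma vcong_obtain_V:
  assumes "vcong m x y" "x \<in> V n" "y \<in> V n"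
  obtains z where "z \<in> V n" "x = y + int m \<cdot> z"
proof
  have "x i = y i + int m * ((x i - y i) div int m)" for i
    using assms by (auto simp: vcong_def)
  then show "x = y + int m \<cdot> (\<lambda>i. (x i - y i) div int m)" by (auto simp: fun_eq_iff)
  show "(\<lambda>i. (x i - y i) div int m) \<in> V n" using assms by (auto simp: V_def)
qed

lemma vcong_add_scal [simp]: "vcong m (x + int m \<cdot> y) x"
  by (auto simp: vcong_def)

lemma ap_add: "ap A (x + y) = ap A x + ap A y"
  by (auto simp: ap_def fun_eq_iff algebra_simps sum.distrib)

lemma ap_scal: "ap A (c \<cdot> x) = c \<cdot> ap A x"
  by (auto simp: ap_def fun_eq_iff sum_distrib_left mult_ac)

lemma ap_diff: "ap A (x - y) = ap A x - ap A y"
  by (auto simp: ap_def fun_eq_iff algebra_simps sum_subtractf)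

lemma ap_uminus: "ap A (- x) = - ap A x"
  by (auto simp: ap_def fun_eq_iff sum_negf)

lemma ap_zero [simp]: "ap A 0 = 0"
  by (auto simp: ap_def fun_eq_iff)

lemmas ap_linear = ap_add ap_scal ap_diff ap_uminus

lemma ap_one [simp]: "ap (1\<^sub>m n) x = x"
proof -
  have "(\<Sum>j<n. (if i = j then 1 else 0) * x j) = x i" if "i < n" for i
    using that by (simp add: if_distrib[of "\<lambda>c. c * _"] cong: if_cong)
  then show ?thesis by (auto simp: ap_def fun_eq_iff)
qed

lemma ap_mult:
  assumes "A \<in> carrier_mat n n" "B \<in> carrier_mat n n"
  shows "ap (A * B) x = ap A (ap B x)"
proof
  fix i
  show "ap (A * B) x i = ap A (ap B x) i"
  proof (cases "i < n")
    case True
    have "ap (A * B) x i = (\<Sum>j<n. \<Sum>k<n. A $$ (i, k) * B $$ (k, j) * x j)"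
      using assms True
      by (auto simp: ap_def scalar_prod_def sum_distrib_right lessThan_atLeast0 intro!: sum.cong)
    also have "\<dots> = (\<Sum>k<n. \<Sum>j<n. A $$ (i, k) * B $$ (k, j) * x j)" by (rule sum.swap)
    also have "\<dots> = ap A (ap B x) i"
      using assms True by (auto simp: ap_def sum_distrib_left mult.assoc intro!: sum.cong)
    finally show ?thesis .
  qed (use assms in \<open>auto simp: ap_def\<close>)
qed

lemma ap_vcong: "vcong m x y \<Longrightarrow> vcong m (ap A x) (ap A y)"
  by (erule vcong_obtain) (simp add: ap_linear)

lemma ap_bas:
  assumes "A \<in> carrier_mat n n" "i < n" "j < n"
  shows "ap A (bas j) i = A $$ (i, j)"
  using assms by (simp add: ap_def bas_def if_distrib[of "\<lambda>c. _ * c"] cong: if_cong)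

lemma ap_outside: "A \<in> carrier_mat n n \<Longrightarrow> i \<ge> n \<Longrightarrow> ap A x i = x i"
  by (auto simp: ap_def)

lemma ap_in_V [simp]: "A \<in> carrier_mat n n \<Longrightarrow> x \<in> V n \<Longrightarrow> ap A x \<in> V n"
  by (auto simp: V_def ap_def)

lemma ap_sum:
  assumes "A \<in> carrier_mat n n" "i < n"
  shows "ap A x i = (\<Sum>j<n. ap A (bas j) i * x j)"
  using assms by (subst ap_def) (auto simp: ap_bas intro!: sum.cong)

lemma ap_congI:
  assumes "A \<in> carrier_mat n n" "B \<in> carrier_mat n n"
    and "\<And>j. j < n \<Longrightarrow> vcong m (ap A (bas j)) (ap B (bas j))"
  shows "vcong m (ap A x) (ap B x)"
  unfolding vcong_def
proof
  fix i
  show "int m dvd ap A x i - ap B x i"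
  proof (cases "i < n")
    case True
    have "ap A x i - ap B x i = (\<Sum>j<n. (ap A (bas j) i - ap B (bas j) i) * x j)"
      unfolding ap_sum[OF assms(1) True, of x] ap_sum[OF assms(2) True, of x]
      by (simp add: sum_subtractf left_diff_distrib)
    then show ?thesis using assms(3) by (auto simp: vcong_def intro!: dvd_sum dvd_mult2)
  qed (use assms in \<open>auto simp: ap_outside\<close>)
qed

lemma ap_eqI:
  assumes "A \<in> carrier_mat n n" "B \<in> carrier_mat n n"
    and "\<And>j. j < n \<Longrightarrow> ap A (bas j) = ap B (bas j)"
  shows "A = B"
proof (rule eq_matI)
  fix i j assume ij: "i < dim_row B" "j < dim_col B"
  with assms have "i < n" "j < n" by auto
  then show "A $$ (i, j) = B $$ (i, j)"
    using assms(3)[of j] ap_bas[OF assms(1)] ap_bas[OF assms(2)] by metis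
qed (use assms in auto)

lemma ap_eqI': "A \<in> carrier_mat n n \<Longrightarrow> B \<in> carrier_mat n n \<Longrightarrow> (\<And>x. ap A x = ap B x) \<Longrightarrow> A = B"
  by (rule ap_eqI) auto

text \<open>The bridge between residue matrices and actions on vectors: congruences are proved with
  \<open>vcong\<close> and carried back to matrices here.\<close>

lemma reduce_mat_eq_iff:
  assumes "A \<in> carrier_mat n n" "B \<in> carrier_mat n n"
  shows "reduce_mat p A = reduce_mat p B \<longleftrightarrow> (\<forall>x. vcong p (ap A x) (ap B x))"
proof
  assume eq: "reduce_mat p A = reduce_mat p B"
  have e: "int p dvd A $$ (i, j) - B $$ (i, j)" if "i < n" "j < n" for i j
    using arg_cong[OF eq, of "\<lambda>M. M $$ (i, j)"] assms that
    by (simp add: reduce_mat_def mod_eq_dvd_iff)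
  have "vcong p (ap A (bas j)) (ap B (bas j))" if "j < n" for j
    unfolding vcong_def
  proof
    fix i
    show "int p dvd ap A (bas j) i - ap B (bas j) i"
      using e[OF _ that] that assms by (cases "i < n") (simp_all add: ap_bas ap_outside)
  qed
  then show "\<forall>x. vcong p (ap A x) (ap B x)" using ap_congI[OF assms] by blast
next
  assume c: "\<forall>x. vcong p (ap A x) (ap B x)"
  show "reduce_mat p A = reduce_mat p B"
  proof (rule eq_matI)
    fix i j assume "i < dim_row (reduce_mat p B)" "j < dim_col (reduce_mat p B)"
    then have ij: "i < n" "j < n" using assms by (auto simp: reduce_mat_def)
    then have "int p dvd A $$ (i, j) - B $$ (i, j)"
      using c[rule_format, of "bas j"] assms unfolding vcong_def by (metis ap_bas)
    then show "reduce_mat p A $$ (i, j) = reduce_mat p B $$ (i, j)"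
      using assms ij by (simp add: reduce_mat_def mod_eq_dvd_iff)
  qed (use assms in \<open>auto simp: reduce_mat_def\<close>)
qed

lemma reduce_mat_carrier [simp]: "A \<in> carrier_mat n n \<Longrightarrow> reduce_mat p A \<in> carrier_mat n n"
  by (simp add: reduce_mat_def)

lemma reduce_mat_idem [simp]: "reduce_mat p (reduce_mat p A) = reduce_mat p A"
  by (rule eq_matI) (auto simp: reduce_mat_def)

lemma ap_reduce_mat: "A \<in> carrier_mat n n \<Longrightarrow> vcong p (ap (reduce_mat p A) x) (ap A x)"
  using reduce_mat_eq_iff[of "reduce_mat p A" n A p] by simp

lemma reduce_mat_mult:
  assumes "A \<in> carrier_mat n n" "B \<in> carrier_mat n n"
  shows "reduce_mat p (reduce_mat p A * reduce_mat p B) = reduce_mat p (A * B)"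
proof (subst reduce_mat_eq_iff[of _ n])
  have "vcong p (ap (reduce_mat p A) (ap (reduce_mat p B) x)) (ap A (ap B x))" for x
    using assms by (meson ap_reduce_mat ap_vcong vcong_trans)
  then show "\<forall>x. vcong p (ap (reduce_mat p A * reduce_mat p B) x) (ap (A * B) x)"
    using assms by (simp add: ap_mult[of _ n])
qed (use assms in \<open>auto intro!: mult_carrier_mat[of _ n n]\<close>)

lemma reduce_mat_in_residue_mats:
  assumes "A \<in> carrier_mat n n" "p > 0"
  shows "reduce_mat p A \<in> residue_mats n p"
  using assms by (auto simp: residue_mats_def reduce_mat_def elements_mat_def)

lemma reduce_residue_mats:
  assumes "A \<in> residue_mats n p"
  shows "reduce_mat p A = A"
proof (rule eq_matI)
  fix i j assume ij: "i < dim_row A" "j < dim_col A"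
  then have "A $$ (i, j) \<in> elements_mat A" by auto
  then have "A $$ (i, j) \<in> {0..<int p}" using assms by (auto simp: residue_mats_def)
  then show "reduce_mat p A $$ (i, j) = A $$ (i, j)" using ij by (simp add: reduce_mat_def)
qed (auto simp: reduce_mat_def)

lemma reduce_mat_one: "p > 1 \<Longrightarrow> reduce_mat p (1\<^sub>m n) = 1\<^sub>m n"
  by (rule eq_matI) (auto simp: reduce_mat_def)

lemma finite_residue_mats: "finite (residue_mats n p)"
proof -
  have "residue_mats n p \<subseteq> mat n n ` (({..<n} \<times> {..<n}) \<rightarrow>\<^sub>E {0..<int p})"
  proof
    fix A assume A: "A \<in> residue_mats n p"
    then have c: "A \<in> carrier_mat n n" by (simp add: residue_mats_def)
    let ?f = "restrict (\<lambda>ij. A $$ ij) ({..<n} \<times> {..<n})"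
    have "A $$ (i, j) \<in> {0..<int p}" if "i < n" "j < n" for i j
    proof -
      have "A $$ (i, j) \<in> elements_mat A" using that c by auto
      then show ?thesis using A by (auto simp: residue_mats_def)
    qed
    then have "?f \<in> ({..<n} \<times> {..<n}) \<rightarrow>\<^sub>E {0..<int p}" by auto
    moreover have "A = mat n n ?f" using c by (intro eq_matI) auto
    ultimately show "A \<in> mat n n ` (({..<n} \<times> {..<n}) \<rightarrow>\<^sub>E {0..<int p})" by blast
  qed
  then show ?thesis by (rule finite_subset) (intro finite_imageI finite_PiE; simp)
qed

subsection \<open>Euclidean reduction of integer vectors\<close>

text \<open>An abstract orbit under elementary operations on the coordinates in \<open>I\<close>.
  Leaving the acting group out lets one reduction serve orbits of different subgroups: blocks of
  coordinates in the linear case, single hyperbolic planes or half of the coordinates in the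
  symplectic case.\<close>

definition euclid_closed :: "nat set \<Rightarrow> (nat \<Rightarrow> int) set \<Rightarrow> bool" where
  "euclid_closed I X \<longleftrightarrow> (\<forall>v\<in>X. \<forall>i\<in>I. \<forall>j\<in>I. i \<noteq> j \<longrightarrow> (\<forall>t. v(i := v i + t * v j) \<in> X))"

lemma euclid_closedD:
  "euclid_closed I X \<Longrightarrow> v \<in> X \<Longrightarrow> i \<in> I \<Longrightarrow> j \<in> I \<Longrightarrow> i \<noteq> j \<Longrightarrow> v(i := v i + t * v j) \<in> X"
  by (auto simp: euclid_closed_def)

lemma euclid_step_dvd:
  fixes v :: "nat \<Rightarrow> int"
  assumes "i \<in> I" "j \<in> I" "i \<noteq> j"
  shows "(\<forall>l\<in>I. d dvd (v(i := v i + t * v j)) l) \<longleftrightarrow> (\<forall>l\<in>I. d dvd v l)"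
proof
  assume *: "\<forall>l\<in>I. d dvd (v(i := v i + t * v j)) l"
  then have j: "d dvd v j" and i: "d dvd v i + t * v j" using assms by (auto dest: bspec)
  have "d dvd v i" using i j by (simp add: dvd_add_left_iff)
  then show "\<forall>l\<in>I. d dvd v l" using * by (metis fun_upd_other)
qed (use assms in auto)

text \<open>The Euclidean algorithm, by induction on the sum of absolute values. The invariant is
  the set of common divisors of the entries, so no gcd has to be named; the surviving entry divides
  all the original ones.\<close>

lemma euclid_vector:
  assumes I: "finite I" "k \<in> I" and cl: "euclid_closed I X" and "v \<in> X"
  shows "\<exists>w\<in>X. (\<forall>i\<in>I. i \<noteq> k \<longrightarrow> w i = 0) \<and> (\<forall>i. i \<notin> I \<longrightarrow> w i = v i) \<and>
    (\<forall>i\<in>I. w k dvd v i)"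
proof -
  have "\<exists>w\<in>X. (\<forall>i\<in>I. i \<noteq> k \<longrightarrow> w i = 0) \<and> (\<forall>i. i \<notin> I \<longrightarrow> w i = v i) \<and>
    (\<forall>d. (\<forall>i\<in>I. d dvd w i) \<longleftrightarrow> (\<forall>i\<in>I. d dvd v i))"
    using \<open>v \<in> X\<close>
  proof (induction "\<Sum>i\<in>I. nat \<bar>v i\<bar>" arbitrary: v rule: less_induct)
    case less
    show ?case
    proof (cases "\<exists>i\<in>I. \<exists>j\<in>I. i \<noteq> j \<and> v j \<noteq> 0 \<and> \<bar>v j\<bar> \<le> \<bar>v i\<bar>")
      case True
      then obtain i j where ij: "i \<in> I" "j \<in> I" "i \<noteq> j" "v j \<noteq> 0" "\<bar>v j\<bar> \<le> \<bar>v i\<bar>" by blast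
      \<comment> \<open>The sign makes \<open>t * v j\<close> point against \<open>v i\<close>; as
        \<open>v j\<close> is nonzero and not larger in absolute value, \<open>v i\<close>
        shrinks.\<close>
      define t where "t = - (sgn (v i) * sgn (v j))"
      let ?v = "v(i := v i + t * v j)"
      have "\<bar>v i + t * v j\<bar> < \<bar>v i\<bar>"
        using ij by (auto simp: t_def sgn_if abs_if split: if_splits)
      then have "(\<Sum>l\<in>I. nat \<bar>?v l\<bar>) < (\<Sum>l\<in>I. nat \<bar>v l\<bar>)"
        using I(1) ij(1) by (intro sum_strict_mono_ex1) auto
      from less.hyps[OF this euclid_closedD[OF cl less.prems ij(1-3)]]
      obtain w where "w \<in> X" "\<forall>i\<in>I. i \<noteq> k \<longrightarrow> w i = 0" "\<forall>l. l \<notin> I \<longrightarrow> w l = ?v l"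
        and "\<forall>d. (\<forall>i\<in>I. d dvd w i) \<longleftrightarrow> (\<forall>i\<in>I. d dvd ?v i)" by auto
      then show ?thesis
        using ij euclid_step_dvd[OF ij(1-3), of _ v t] by (intro bexI[of _ w]) auto
    next
      case False
      \<comment> \<open>No entry can be reduced by another. Read in both orders, this excludes two
        nonzero entries.\<close>
      then have F: "\<And>i j. i \<in> I \<Longrightarrow> j \<in> I \<Longrightarrow> i \<noteq> j \<Longrightarrow> v j \<noteq> 0 \<Longrightarrow> \<bar>v i\<bar> < \<bar>v j\<bar>" by force
      show ?thesis
      proof (cases "\<exists>i\<in>I. i \<noteq> k \<and> v i \<noteq> 0")
        case False
        then show ?thesis using less.prems by (intro bexI[of _ v]) auto
      next
        case True
        then obtain i where i: "i \<in> I" "i \<noteq> k" "v i \<noteq> 0" by blast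
        have z: "v j = 0" if "j \<in> I" "j \<noteq> i" for j
          using F[of i j] F[of j i] that i by force
        \<comment> \<open>The only nonzero entry sits at \<open>i\<close>. A swap is not among the
          allowed operations, so the entry is copied to \<open>k\<close> and then cancelled at
          \<open>i\<close>.\<close>
        let ?a = "v(k := v k + 1 * v i)"
        let ?w = "?a(i := ?a i + (- 1) * ?a k)"
        have "?a \<in> X" by (rule euclid_closedD[OF cl less.prems I(2) i(1)]) (use i in auto)
        then have w: "?w \<in> X" by (rule euclid_closedD[OF cl _ i(1) I(2) i(2)])
        have "(\<forall>l\<in>I. d dvd ?w l) \<longleftrightarrow> (\<forall>l\<in>I. d dvd v l)" for d
          using euclid_step_dvd[OF i(1) I(2) i(2), of d ?a "-1"] euclid_step_dvd[OF I(2) i(1), of d v 1] i(2)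
          by metis
        moreover have "?w l = 0" if "l \<in> I" "l \<noteq> k" for l using that z i I by auto
        moreover have "?w l = v l" if "l \<notin> I" for l using that i I by auto
        ultimately show ?thesis using w by blast
      qed
    qed
  qed
  then obtain w where w: "w \<in> X" "\<forall>i\<in>I. i \<noteq> k \<longrightarrow> w i = 0" "\<forall>i. i \<notin> I \<longrightarrow> w i = v i"
    and d: "\<forall>d. (\<forall>i\<in>I. d dvd w i) \<longleftrightarrow> (\<forall>i\<in>I. d dvd v i)" by blast
  have "\<forall>i\<in>I. w k dvd w i" using w(2) by (metis dvd_0_right dvd_refl)
  then have "\<forall>i\<in>I. w k dvd v i" using d by blast
  then show ?thesis using w by blast
qed

text \<open>A row \<open>(d, 0)\<close> with \<open>d s \<equiv> 1\<close> is moved through \<open>(d, d s)\<close> and \<open>(1, d s)\<close> to \<open>(1, 0)\<close>.\<close>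

lemma euclid_unit:
  assumes k: "k \<in> I" "k' \<in> I" "k' \<noteq> k" and cl: "euclid_closed I X" and w: "w \<in> X"
    and d: "w k dvd r" "int m dvd r - 1" and z: "w k' = 0"
  shows "\<exists>x\<in>X. int m dvd x k - 1 \<and> int m dvd x k' \<and> (\<forall>i. i \<noteq> k \<longrightarrow> i \<noteq> k' \<longrightarrow> x i = w i)"
proof -
  obtain s where s: "r = w k * s" using d by blast
  define a where "a = w k"
  let ?x = "w(k' := w k' + s * w k)"
  let ?y = "?x(k := ?x k + (1 - a) * ?x k')"
  let ?z = "?y(k' := ?y k' + (- 1) * ?y k)"
  have x: "?x \<in> X" using euclid_closedD[OF cl w k(2,1,3)] .
  have y: "?y \<in> X" by (rule euclid_closedD[OF cl x k(1,2)]) (use k in auto)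
  have zO: "?z \<in> X" by (rule euclid_closedD[OF cl y k(2,1,3)])
  have m: "int m dvd a * s - 1" using d s by (simp add: a_def)
  have "?z k - 1 = (a * s - 1) * (1 - a)" using k z by (simp add: a_def algebra_simps)
  moreover have "?z k' = (a * s - 1) * a" using k z by (simp add: a_def algebra_simps)
  ultimately have "int m dvd ?z k - 1" "int m dvd ?z k'" using m by (metis dvd_mult2)+
  then show ?thesis using zO by (intro bexI[of _ ?z]) auto
qed

section \<open>Congruence subgroups of integer matrix groups\<close>

abbreviation mat_group :: "nat \<Rightarrow> int mat set \<Rightarrow> int mat monoid" where
  "mat_group n X \<equiv> \<lparr>carrier = X, monoid.mult = (*), one = 1\<^sub>m n\<rparr>"

locale matgroup =
  fixes n :: nat and X :: "int mat set"
  assumes X_carrier: "A \<in> X \<Longrightarrow> A \<in> carrier_mat n n"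
    and X_one: "1\<^sub>m n \<in> X"
    and X_mult: "A \<in> X \<Longrightarrow> B \<in> X \<Longrightarrow> A * B \<in> X"
    and X_inv: "A \<in> X \<Longrightarrow> \<exists>B\<in>X. B * A = 1\<^sub>m n"
begin

abbreviation "\<Gamma> \<equiv> mat_group n X"

sublocale group \<Gamma>
proof (rule groupI)
  show "x \<otimes>\<^bsub>\<Gamma>\<^esub> y \<otimes>\<^bsub>\<Gamma>\<^esub> z = x \<otimes>\<^bsub>\<Gamma>\<^esub> (y \<otimes>\<^bsub>\<Gamma>\<^esub> z)"
    if "x \<in> carrier \<Gamma>" "y \<in> carrier \<Gamma>" "z \<in> carrier \<Gamma>" for x y z
    using that X_carrier by (simp add: assoc_mult_mat[of _ n n _ n _ n])
  show "\<exists>y\<in>carrier \<Gamma>. y \<otimes>\<^bsub>\<Gamma>\<^esub> x = \<one>\<^bsub>\<Gamma>\<^esub>" if "x \<in> carrier \<Gamma>" for x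
    using that X_inv by simp
  show "\<one>\<^bsub>\<Gamma>\<^esub> \<otimes>\<^bsub>\<Gamma>\<^esub> x = x" if "x \<in> carrier \<Gamma>" for x
    using that X_carrier[of x] by simp
qed (use X_one X_mult in auto)

lemma inv_in: "A \<in> X \<Longrightarrow> inv\<^bsub>\<Gamma>\<^esub> A \<in> X"
  using inv_closed[of A] by simp

lemma ap_mult_X: "A \<in> X \<Longrightarrow> B \<in> X \<Longrightarrow> ap (A * B) x = ap A (ap B x)"
  by (simp add: ap_mult[of _ n] X_carrier)

lemma ap_inv1 [simp]: "A \<in> X \<Longrightarrow> ap A (ap (inv\<^bsub>\<Gamma>\<^esub> A) x) = x"
  using r_inv[of A] ap_mult_X[OF _ inv_in, of A A x] by simp

lemma ap_inv2 [simp]: "A \<in> X \<Longrightarrow> ap (inv\<^bsub>\<Gamma>\<^esub> A) (ap A x) = x"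
  using l_inv[of A] ap_mult_X[OF inv_in, of A A x] by simp

lemma ap_X_in_V [simp]: "A \<in> X \<Longrightarrow> x \<in> V n \<Longrightarrow> ap A x \<in> V n"
  using X_carrier by auto

lemma ap_commutator: "A \<in> X \<Longrightarrow> B \<in> X \<Longrightarrow> ap (A * B * inv\<^bsub>\<Gamma>\<^esub> A * inv\<^bsub>\<Gamma>\<^esub> B) x
    = ap A (ap B (ap (inv\<^bsub>\<Gamma>\<^esub> A) (ap (inv\<^bsub>\<Gamma>\<^esub> B) x)))"
  by (simp add: ap_mult_X X_mult inv_in)

lemma X_eqI: "A \<in> X \<Longrightarrow> B \<in> X \<Longrightarrow> (\<And>x. ap A x = ap B x) \<Longrightarrow> A = B"
  using ap_eqI' X_carrier by blast

text \<open>The quantifier over all integer sequences is harmless, since a matrix does nothing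
  beyond its size.\<close>

definition CC :: "nat \<Rightarrow> int mat set" where
  "CC m = {A \<in> X. \<forall>x. vcong m (ap A x) x}"

lemma CC_1: "CC 1 = X"
  by (auto simp: CC_def)

lemma CC_normal: "CC m \<lhd> \<Gamma>"
proof (rule normal_invI)
  have inv: "vcong m (ap (inv\<^bsub>\<Gamma>\<^esub> A) x) x" if A: "A \<in> X" "\<forall>x. vcong m (ap A x) x" for A x
    using A(2)[rule_format, of "ap (inv\<^bsub>\<Gamma>\<^esub> A) x"] A(1) by (simp add: vcong_sym)
  show "subgroup (CC m) \<Gamma>"
    by unfold_locales
      (auto simp: CC_def X_one X_mult inv_in ap_mult_X inv intro: vcong_trans)
  show "A \<otimes>\<^bsub>\<Gamma>\<^esub> B \<otimes>\<^bsub>\<Gamma>\<^esub> inv\<^bsub>\<Gamma>\<^esub> A \<in> CC m" if "A \<in> carrier \<Gamma>" "B \<in> CC m" for A B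
  proof -
    have A: "A \<in> X" and B: "B \<in> X" "\<And>x. vcong m (ap B x) x" using that by (auto simp: CC_def)
    have "vcong m (ap A (ap B (ap (inv\<^bsub>\<Gamma>\<^esub> A) x))) x" for x
      using ap_vcong[OF B(2), of A "ap (inv\<^bsub>\<Gamma>\<^esub> A) x"] A by simp
    then show ?thesis using A B by (simp add: CC_def ap_mult_X X_mult inv_in)
  qed
qed

lemma commutator_in_CC:
  assumes "A \<in> X" "B \<in> X"
    and "\<And>j. j < n \<Longrightarrow> vcong m (ap A (ap B (bas j))) (ap B (ap A (bas j)))"
  shows "A \<otimes>\<^bsub>\<Gamma>\<^esub> B \<otimes>\<^bsub>\<Gamma>\<^esub> inv\<^bsub>\<Gamma>\<^esub> A \<otimes>\<^bsub>\<Gamma>\<^esub> inv\<^bsub>\<Gamma>\<^esub> B \<in> CC m"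
proof -
  have "vcong m (ap (A * B) x) (ap (B * A) x)" for x
    by (rule ap_congI[of _ n]) (use assms X_carrier X_mult in \<open>auto simp: ap_mult_X\<close>)
  then have "vcong m (ap A (ap B (ap (inv\<^bsub>\<Gamma>\<^esub> A) (ap (inv\<^bsub>\<Gamma>\<^esub> B) x)))) x" for x
    using assms(1,2) by (metis ap_mult_X ap_inv1 inv_in)
  then show ?thesis using assms(1,2) by (simp add: CC_def ap_commutator X_mult inv_in)
qed

text \<open>The equation \<open>A B = D B A\<close> contains no inverses and can be checked vector
  by vector.\<close>

lemma commutator_eqI:
  assumes "A \<in> X" "B \<in> X" "D \<in> X" "\<And>x. ap A (ap B x) = ap D (ap B (ap A x))"
  shows "A \<otimes>\<^bsub>\<Gamma>\<^esub> B \<otimes>\<^bsub>\<Gamma>\<^esub> inv\<^bsub>\<Gamma>\<^esub> A \<otimes>\<^bsub>\<Gamma>\<^esub> inv\<^bsub>\<Gamma>\<^esub> B = D"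
  by (rule X_eqI) (use assms in \<open>simp_all add: X_mult inv_in ap_commutator\<close>)

text \<open>With \<open>A = 1 + a U\<close> and \<open>B = 1 + b W\<close>, the terms of first order
  cancel and \<open>A B - B A = a b (U W - W U)\<close>.\<close>

lemma CC_commutator:
  assumes "A \<in> CC a" "B \<in> CC b"
  shows "A \<otimes>\<^bsub>\<Gamma>\<^esub> B \<otimes>\<^bsub>\<Gamma>\<^esub> inv\<^bsub>\<Gamma>\<^esub> A \<otimes>\<^bsub>\<Gamma>\<^esub> inv\<^bsub>\<Gamma>\<^esub> B \<in> CC (a * b)"
proof (rule commutator_in_CC)
  have A: "A \<in> X" "\<And>x. vcong a (ap A x) x" and B: "B \<in> X" "\<And>x. vcong b (ap B x) x"
    using assms by (auto simp: CC_def)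
  show "A \<in> X" "B \<in> X" by fact+
  fix j
  define y :: "nat \<Rightarrow> int" where "y = bas j"
  obtain u where u: "ap A y = y + int a \<cdot> u" using A(2)[of y] by (blast elim: vcong_obtain)
  obtain v where v: "ap B y = y + int b \<cdot> v" using B(2)[of y] by (blast elim: vcong_obtain)
  obtain u' where u': "ap A v = v + int a \<cdot> u'" using A(2)[of v] by (blast elim: vcong_obtain)
  obtain v' where v': "ap B u = u + int b \<cdot> v'" using B(2)[of u] by (blast elim: vcong_obtain)
  have "ap A (ap B y) = ap B (ap A y) + int (a * b) \<cdot> (u' - v')"
    by (simp add: u v u' v' ap_linear fun_eq_iff algebra_simps)
  then show "vcong (a * b) (ap A (ap B (bas j))) (ap B (ap A (bas j)))"
    by (simp add: y_def del: of_nat_mult)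
qed

lemma ap_pow: "A \<in> X \<Longrightarrow> ap (A [^]\<^bsub>\<Gamma>\<^esub> Suc k) x = ap (A [^]\<^bsub>\<Gamma>\<^esub> k) (ap A x)"
  using nat_pow_closed[of A k] by (simp add: ap_mult_X)

section \<open>Transvections, scalar matrices and Iwasawa's criterion\<close>

definition lin_form :: "((nat \<Rightarrow> int) \<Rightarrow> int) \<Rightarrow> bool" where
  "lin_form f \<longleftrightarrow> (\<forall>x y. f (x + y) = f x + f y) \<and> (\<forall>c x. f (c \<cdot> x) = c * f x)"

lemma lin_form_vcong:
  assumes "lin_form f" "vcong m x y"
  shows "int m dvd f x - f y"
  using assms by (auto simp: lin_form_def elim!: vcong_obtain)

definition transvection :: "int mat \<Rightarrow> bool" where
  "transvection A \<longleftrightarrow> (\<exists>f v. lin_form f \<and> v \<in> V n \<and> f v = 0 \<and> (\<forall>x. ap A x = x + f x \<cdot> v))"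

text \<open>Comparing coordinates 0 and \<open>i\<close> of the image of
  \<open>bas 0 + bas i\<close> shows that the factors of the two basis vectors agree modulo
  \<open>m\<close>. So \<open>A\<close> is scalar modulo \<open>m\<close>, and scalars commute with
  everything.\<close>

lemma commutes_if_all_lines_fixed:
  assumes n: "n > 0" and A: "A \<in> X" and lines: "\<And>x. x \<in> V n \<Longrightarrow> \<exists>l. vcong m (ap A x) (l \<cdot> x)"
  shows "A \<in> central_mod (CC m)"
proof -
  obtain l where l: "\<And>x. x \<in> V n \<Longrightarrow> vcong m (ap A x) (l x \<cdot> x)" using lines by metis
  have l0: "int m dvd l (bas i) - l (bas 0)" if i: "i < n" for i
  proof (cases "i = 0")
    case False
    have "vcong m (l (bas 0 + bas i) \<cdot> (bas 0 + bas i)) (l (bas 0) \<cdot> bas 0 + l (bas i) \<cdot> bas i)"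
      using vcong_trans[OF vcong_sym[OF l[of "bas 0 + bas i"]], of "ap A (bas 0) + ap A (bas i)"]
        vcong_add[OF l[of "bas 0"] l[of "bas i"]] n i by (auto simp: ap_add dest: vcong_trans)
    from this[unfolded vcong_def, rule_format, of 0] this[unfolded vcong_def, rule_format, of i]
    have "int m dvd l (bas 0 + bas i) - l (bas 0)" "int m dvd l (bas 0 + bas i) - l (bas i)"
      using False by (simp_all add: bas_def)
    from dvd_diff[OF this] show ?thesis by simp
  qed simp
  have sc: "vcong m (ap A x) (l (bas 0) \<cdot> x)" if x: "x \<in> V n" for x
    unfolding vcong_def
  proof
    fix i
    show "int m dvd ap A x i - (l (bas 0) \<cdot> x) i"
    proof (cases "i < n")
      case True
      have b: "int m dvd ap A (bas j) i - l (bas 0) * bas j i" if "j < n" for j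
      proof -
        have "int m dvd (ap A (bas j) i - l (bas j) * bas j i) + (l (bas j) - l (bas 0)) * bas j i"
          using l[of "bas j"] l0[OF that] that by (intro dvd_add dvd_mult2) (auto simp: vcong_def)
        then show ?thesis by (simp add: algebra_simps)
      qed
      have "x i = (\<Sum>j<n. bas j i * x j)"
        using ap_sum[of "1\<^sub>m n" n i x] True by simp
      then have "ap A x i - (l (bas 0) \<cdot> x) i = (\<Sum>j<n. (ap A (bas j) i - l (bas 0) * bas j i) * x j)"
        unfolding ap_sum[OF X_carrier[OF A] True, of x]
        by (simp add: sum_subtractf left_diff_distrib sum_distrib_left mult.assoc)
      then show ?thesis using b by (auto intro!: dvd_sum dvd_mult2)
    next
      case False
      then show ?thesis using x ap_X_in_V[OF A x] by (auto simp: V_def)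
    qed
  qed
  have "A \<otimes>\<^bsub>\<Gamma>\<^esub> B \<otimes>\<^bsub>\<Gamma>\<^esub> inv\<^bsub>\<Gamma>\<^esub> A \<otimes>\<^bsub>\<Gamma>\<^esub> inv\<^bsub>\<Gamma>\<^esub> B \<in> CC m" if B: "B \<in> X" for B
  proof (rule commutator_in_CC[OF A B])
    fix j assume j: "j < n"
    have "vcong m (ap A (ap B (bas j))) (l (bas 0) \<cdot> ap B (bas j))" using sc B j by simp
    moreover have "vcong m (ap B (ap A (bas j))) (ap B (l (bas 0) \<cdot> bas j))"
      using sc j by (intro ap_vcong) simp
    ultimately show "vcong m (ap A (ap B (bas j))) (ap B (ap A (bas j)))"
      by (metis ap_scal vcong_sym vcong_trans)
  qed
  then show ?thesis using A by (simp add: central_mod_def)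
qed

text \<open>Iwasawa's argument: a normal subgroup transitive on lines modulo \<open>p\<close> conjugates every
  transvection, modulo itself, into the commutative group of transvections along \<open>bas 0\<close>.\<close>

lemma full_if_line_transitive:
  assumes p: "prime p" and n: "0 < n"
    and H: "H \<lhd> \<Gamma>" and CH: "CC p \<subseteq> H"
    and perfect: "\<And>D. subgroup D \<Gamma> \<Longrightarrow> (\<And>A B. A \<in> X \<Longrightarrow> B \<in> X \<Longrightarrow>
        A \<otimes>\<^bsub>\<Gamma>\<^esub> B \<otimes>\<^bsub>\<Gamma>\<^esub> inv\<^bsub>\<Gamma>\<^esub> A \<otimes>\<^bsub>\<Gamma>\<^esub> inv\<^bsub>\<Gamma>\<^esub> B \<in> D) \<Longrightarrow> D = X"
    and T: "T \<subseteq> X" "\<And>A. A \<in> T \<Longrightarrow> transvection A"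
    and gen: "\<And>D. subgroup D \<Gamma> \<Longrightarrow> T \<subseteq> D \<Longrightarrow> D = X"
    and trans: "\<And>v. v \<in> V n \<Longrightarrow> \<not> vcong p v 0 \<Longrightarrow> \<exists>A\<in>H. \<exists>l. vcong p (ap A v) (l \<cdot> bas 0)"
  shows "H = X"
proof -
  interpret H: normal H \<Gamma> by (rule H)
  have H_in_SpZ: "H \<subseteq> X" using H.subset by simp
  \<comment> \<open>The matrices that are transvections along \<open>bas 0\<close> modulo
    \<open>p\<close>. They commute modulo \<open>CC p\<close>: the cross term contains
    \<open>f (bas 0)\<close>, which is divisible by \<open>p\<close>.\<close>
  define U where "U = {A \<in> X. \<exists>f. lin_form f \<and> int p dvd f (bas 0) \<and>
    (\<forall>x. vcong p (ap A x) (x + f x \<cdot> bas 0))}"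
  have U_comm: "A \<otimes>\<^bsub>\<Gamma>\<^esub> B \<otimes>\<^bsub>\<Gamma>\<^esub> inv\<^bsub>\<Gamma>\<^esub> A \<otimes>\<^bsub>\<Gamma>\<^esub> inv\<^bsub>\<Gamma>\<^esub> B \<in> H" if AB: "A \<in> U" "B \<in> U" for A B
  proof -
    obtain f where A: "A \<in> X" and f: "lin_form f" "int p dvd f (bas 0)"
      "\<And>x. vcong p (ap A x) (x + f x \<cdot> bas 0)" using AB by (auto simp: U_def)
    obtain g where B: "B \<in> X" and g: "lin_form g" "int p dvd g (bas 0)"
      "\<And>x. vcong p (ap B x) (x + g x \<cdot> bas 0)" using AB by (auto simp: U_def)
    have comp: "vcong p (ap A (ap B x)) (x + (f x + g x) \<cdot> bas 0)"
      if A: "A \<in> X" and f: "lin_form f" "int p dvd f (bas 0)" "\<And>x. vcong p (ap A x) (x + f x \<cdot> bas 0)"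
        and g: "\<And>x. vcong p (ap B x) (x + g x \<cdot> bas 0)" for A B f g x
    proof -
      have "vcong p (ap A (ap B x)) (ap A (x + g x \<cdot> bas 0))" by (rule ap_vcong[OF g])
      also have "vcong p \<dots> (x + g x \<cdot> bas 0 + f (x + g x \<cdot> bas 0) \<cdot> bas 0)" by (rule f(3))
      also have "vcong p \<dots> (x + g x \<cdot> bas 0 + f x \<cdot> bas 0)"
        using f(1,2) by (intro vcong_add vcong_scal_left) (auto simp: lin_form_def)
      also have "x + g x \<cdot> bas 0 + f x \<cdot> bas 0 = x + (f x + g x) \<cdot> bas 0"
        by (simp add: fun_eq_iff algebra_simps)
      finally show ?thesis .
    qed
    have "vcong p (ap A (ap B x)) (ap B (ap A x))" for x
    proof -
      have "vcong p (ap A (ap B x)) (x + (f x + g x) \<cdot> bas 0)" by (rule comp) fact+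
      moreover have "vcong p (ap B (ap A x)) (x + (g x + f x) \<cdot> bas 0)" by (rule comp) fact+
      ultimately show ?thesis by (metis add.commute vcong_sym vcong_trans)
    qed
    then show ?thesis using commutator_in_CC[OF A B] CH by blast
  qed
  have conj: "\<exists>u\<in>U. H #>\<^bsub>\<Gamma>\<^esub> t = H #>\<^bsub>\<Gamma>\<^esub> u" if t: "t \<in> T" for t
  proof -
    have tX: "t \<in> X" using T t by auto
    obtain f v where f: "lin_form f" "v \<in> V n" "f v = 0" "\<And>x. ap t x = x + f x \<cdot> v"
      using T(2)[OF t] unfolding transvection_def by blast
    show ?thesis
    proof (cases "vcong p v 0")
      case True
      have "vcong p (ap t x) (x + 0 \<cdot> bas 0)" for x
        using vcong_add[OF vcong_refl[of p x] vcong_scal[OF True, of "f x"]] f(4)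
        by (auto simp: vcong_def)
      then have "t \<in> U" using tX by (auto simp: U_def lin_form_def intro!: exI[of _ "\<lambda>x. 0"])
      then show ?thesis by blast
    next
      case False
      obtain h l where h: "h \<in> H" "vcong p (ap h v) (l \<cdot> bas 0)" using trans[OF f(2) False] by blast
      have hX: "h \<in> X" using h H_in_SpZ by auto
      have pull: "vcong p v (l \<cdot> ap (inv\<^bsub>\<Gamma>\<^esub> h) (bas 0))"
        using ap_vcong[OF h(2), of "inv\<^bsub>\<Gamma>\<^esub> h"] hX by (simp add: ap_scal)
      have "\<not> int p dvd l"
      proof
        assume "int p dvd l"
        then have "vcong p (l \<cdot> ap (inv\<^bsub>\<Gamma>\<^esub> h) (bas 0)) 0" by (auto simp: vcong_def)
        then show False using pull False vcong_trans by blast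
      qed
      \<comment> \<open>From \<open>f v = 0\<close>, since \<open>v\<close> is congruent to
        \<open>l\<close> times the preimage of \<open>bas 0\<close>. As \<open>l\<close> is a unit
        modulo \<open>p\<close>, primality cancels it, and this places the conjugate in
        \<open>U\<close>.\<close>
      moreover have "int p dvd l * f (ap (inv\<^bsub>\<Gamma>\<^esub> h) (bas 0))"
        using lin_form_vcong[OF f(1) pull] f(1,3) by (simp add: lin_form_def)
      ultimately have f0: "int p dvd f (ap (inv\<^bsub>\<Gamma>\<^esub> h) (bas 0))"
        using p prime_dvd_mult_iff[of "int p"] by auto
      define u where "u = h * t * inv\<^bsub>\<Gamma>\<^esub> h"
      define g where "g = (\<lambda>x. l * f (ap (inv\<^bsub>\<Gamma>\<^esub> h) x))"
      have uX: "u \<in> X" using hX tX by (simp add: u_def X_mult inv_in)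
      have "ap u x = x + f (ap (inv\<^bsub>\<Gamma>\<^esub> h) x) \<cdot> ap h v" for x
        using hX tX by (simp add: u_def ap_mult_X X_mult inv_in f(4) ap_linear)
      moreover have "vcong p (x + c \<cdot> ap h v) (x + c \<cdot> l \<cdot> bas 0)" for x c
        by (intro vcong_add vcong_scal h) simp
      moreover have "x + f (ap (inv\<^bsub>\<Gamma>\<^esub> h) x) \<cdot> l \<cdot> bas 0 = x + g x \<cdot> bas 0" for x
        by (simp add: g_def fun_eq_iff mult_ac)
      ultimately have "vcong p (ap u x) (x + g x \<cdot> bas 0)" for x by metis
      moreover have "lin_form g" using f(1) by (simp add: lin_form_def g_def ap_linear algebra_simps)
      moreover have "int p dvd g (bas 0)" using f0 by (simp add: g_def)
      ultimately have uU: "u \<in> U" using uX by (auto simp: U_def)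
      \<comment> \<open>Conjugation by the element \<open>h\<close> of \<open>H\<close> changes
        nothing modulo \<open>H\<close>.\<close>
      interpret q: group_hom \<Gamma> "\<Gamma> Mod H" "\<lambda>a. H #>\<^bsub>\<Gamma>\<^esub> a" by (rule H.group_hom_Mod)
      have "H #>\<^bsub>\<Gamma>\<^esub> h = \<one>\<^bsub>\<Gamma> Mod H\<^esub>" using H.r_coset_eq_iff[of h] h hX by simp
      then have "H #>\<^bsub>\<Gamma>\<^esub> (h \<otimes>\<^bsub>\<Gamma>\<^esub> t \<otimes>\<^bsub>\<Gamma>\<^esub> inv\<^bsub>\<Gamma>\<^esub> h) = H #>\<^bsub>\<Gamma>\<^esub> t"
        using q.hom_mult[of h t] q.hom_mult[of "h \<otimes>\<^bsub>\<Gamma>\<^esub> t" "inv\<^bsub>\<Gamma>\<^esub> h"] q.hom_inv[of h] hX tX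
          q.hom_closed[of t]
        by (simp add: X_mult inv_in del: one_FactGroup mult_FactGroup q.hom_mult)
      then have "H #>\<^bsub>\<Gamma>\<^esub> t = H #>\<^bsub>\<Gamma>\<^esub> u" by (simp add: u_def)
      then show ?thesis using uU by blast
    qed
  qed
  have TT: "t \<otimes>\<^bsub>\<Gamma>\<^esub> t' \<otimes>\<^bsub>\<Gamma>\<^esub> inv\<^bsub>\<Gamma>\<^esub> t \<otimes>\<^bsub>\<Gamma>\<^esub> inv\<^bsub>\<Gamma>\<^esub> t' \<in> H" if tt: "t \<in> T" "t' \<in> T" for t t'
  proof -
    obtain u u' where u: "u \<in> U" "H #>\<^bsub>\<Gamma>\<^esub> t = H #>\<^bsub>\<Gamma>\<^esub> u" and u': "u' \<in> U" "H #>\<^bsub>\<Gamma>\<^esub> t' = H #>\<^bsub>\<Gamma>\<^esub> u'"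
      using conj tt by metis
    have c: "t \<in> carrier \<Gamma>" "t' \<in> carrier \<Gamma>" "u \<in> carrier \<Gamma>" "u' \<in> carrier \<Gamma>"
      using tt T u u' by (auto simp: U_def)
    show ?thesis using U_comm[OF u(1) u'(1)] c u(2) u'(2) H.commutator_mem_iff by metis
  qed
  \<comment> \<open>Commutation modulo \<open>H\<close> spreads from the generators to the whole
    group in one argument at a time, because centralizers modulo \<open>H\<close> are
    subgroups.\<close>
  have TX: "t \<otimes>\<^bsub>\<Gamma>\<^esub> b \<otimes>\<^bsub>\<Gamma>\<^esub> inv\<^bsub>\<Gamma>\<^esub> t \<otimes>\<^bsub>\<Gamma>\<^esub> inv\<^bsub>\<Gamma>\<^esub> b \<in> H" if t: "t \<in> T" and b: "b \<in> X" for t b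
  proof -
    have "t \<in> carrier \<Gamma>" using t T by auto
    from H.subgroup_commuting_mod[OF this]
    have "{b \<in> carrier \<Gamma>. t \<otimes>\<^bsub>\<Gamma>\<^esub> b \<otimes>\<^bsub>\<Gamma>\<^esub> inv\<^bsub>\<Gamma>\<^esub> t \<otimes>\<^bsub>\<Gamma>\<^esub> inv\<^bsub>\<Gamma>\<^esub> b \<in> H} = X"
      by (rule gen) (use TT[OF t] T in auto)
    then show ?thesis using b by blast
  qed
  have "a \<otimes>\<^bsub>\<Gamma>\<^esub> b \<otimes>\<^bsub>\<Gamma>\<^esub> inv\<^bsub>\<Gamma>\<^esub> a \<otimes>\<^bsub>\<Gamma>\<^esub> inv\<^bsub>\<Gamma>\<^esub> b \<in> H" if a: "a \<in> X" and b: "b \<in> X" for a b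
  proof -
    have a': "a \<in> carrier \<Gamma>" using a by simp
    have "t \<in> {b \<in> carrier \<Gamma>. a \<otimes>\<^bsub>\<Gamma>\<^esub> b \<otimes>\<^bsub>\<Gamma>\<^esub> inv\<^bsub>\<Gamma>\<^esub> a \<otimes>\<^bsub>\<Gamma>\<^esub> inv\<^bsub>\<Gamma>\<^esub> b \<in> H}" if t: "t \<in> T" for t
    proof -
      have t': "t \<in> carrier \<Gamma>" using t T by auto
      show ?thesis using H.commutator_mem_sym[OF t' a'] TX[OF t a] t' by blast
    qed
    then have "{b \<in> carrier \<Gamma>. a \<otimes>\<^bsub>\<Gamma>\<^esub> b \<otimes>\<^bsub>\<Gamma>\<^esub> inv\<^bsub>\<Gamma>\<^esub> a \<otimes>\<^bsub>\<Gamma>\<^esub> inv\<^bsub>\<Gamma>\<^esub> b \<in> H} = X"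
      by (intro gen H.subgroup_commuting_mod[OF a']) blast
    then show ?thesis using b by blast
  qed
  then show ?thesis by (intro perfect H.subgroup_axioms)
qed

section \<open>Cancellation and orbits modulo normal subgroups\<close>

lemma CC_subgroup: "subgroup (CC N) \<Gamma>"
  by (rule normal_imp_subgroup[OF CC_normal])

lemma subgroup_props:
  assumes "subgroup D \<Gamma>"
  shows "1\<^sub>m n \<in> D" "A \<in> D \<Longrightarrow> B \<in> D \<Longrightarrow> A * B \<in> D" "A \<in> D \<Longrightarrow> inv\<^bsub>\<Gamma>\<^esub> A \<in> D" "D \<subseteq> X"
  using subgroup.one_closed[OF assms] subgroup.m_closed[OF assms, of A B]
    subgroup.m_inv_closed[OF assms, of A] subgroup.subset[OF assms] by auto

lemma conj_closed: "H \<lhd> \<Gamma> \<Longrightarrow> A \<in> X \<Longrightarrow> B \<in> H \<Longrightarrow> A * B * inv\<^bsub>\<Gamma>\<^esub> A \<in> H"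
  using normal.inv_op_closed2[of H \<Gamma> A B] by simp

context
  fixes K :: "int mat set"
  assumes K: "K \<lhd> \<Gamma>"
begin

lemma Z_normal: "central_mod K \<lhd> \<Gamma>"
  by (rule normal.central_mod_normal[OF K])

lemma K_Z: "B \<in> K \<Longrightarrow> B \<in> central_mod K"
  using normal.subset_central_mod[OF K] by blast

text \<open>Together with the next two rules: factors from \<open>K\<close> and conjugation may be
  stripped when centrality modulo \<open>K\<close> is at stake, so a matrix can be normalised step
  by step.\<close>

lemma Z_cancel_left:
  assumes "B \<in> K" "A \<in> X" "B * A \<in> central_mod K"
  shows "A \<in> central_mod K"
proof -
  note Zs = subgroup_props[OF normal_imp_subgroup[OF Z_normal]]
  have B: "B \<in> X" using Zs(4) K_Z[OF assms(1)] by blast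
  have "inv\<^bsub>\<Gamma>\<^esub> B * (B * A) \<in> central_mod K" by (intro Zs K_Z assms)
  moreover have "inv\<^bsub>\<Gamma>\<^esub> B * (B * A) = A"
    using B assms(2) by (intro X_eqI) (auto simp: X_mult inv_in ap_mult_X)
  ultimately show ?thesis by simp
qed

lemma Z_cancel_right:
  assumes "B \<in> K" "A \<in> X" "A * B \<in> central_mod K"
  shows "A \<in> central_mod K"
proof -
  note Zs = subgroup_props[OF normal_imp_subgroup[OF Z_normal]]
  have B: "B \<in> X" using Zs(4) K_Z[OF assms(1)] by blast
  have "A * B * inv\<^bsub>\<Gamma>\<^esub> B \<in> central_mod K" by (intro Zs K_Z assms)
  moreover have "A * B * inv\<^bsub>\<Gamma>\<^esub> B = A"
    using B assms(2) by (intro X_eqI) (auto simp: X_mult inv_in ap_mult_X)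
  ultimately show ?thesis by simp
qed

lemma Z_conj:
  assumes "B \<in> X" "A \<in> X" "B * A * inv\<^bsub>\<Gamma>\<^esub> B \<in> central_mod K"
  shows "A \<in> central_mod K"
proof -
  have "inv\<^bsub>\<Gamma>\<^esub> B * (B * A * inv\<^bsub>\<Gamma>\<^esub> B) * inv\<^bsub>\<Gamma>\<^esub> (inv\<^bsub>\<Gamma>\<^esub> B) \<in> central_mod K"
    by (rule conj_closed[OF Z_normal inv_in[OF assms(1)] assms(3)])
  moreover have "inv\<^bsub>\<Gamma>\<^esub> B * (B * A * inv\<^bsub>\<Gamma>\<^esub> B) * inv\<^bsub>\<Gamma>\<^esub> (inv\<^bsub>\<Gamma>\<^esub> B) = A"
    using assms(1,2) inv_inv[of B] by (intro X_eqI) (auto simp: X_mult inv_in ap_mult_X)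
  ultimately show ?thesis by simp
qed

end

text \<open>Orbits of \<open>H\<close> on vectors modulo \<open>p\<close>. For normal
  \<open>H\<close> this is an equivalence relation that the whole group preserves, so it may be
  tested on representatives of pairs of vectors.\<close>

definition reach :: "int mat set \<Rightarrow> nat \<Rightarrow> (nat \<Rightarrow> int) \<Rightarrow> (nat \<Rightarrow> int) \<Rightarrow> bool" where
  "reach H p x y \<longleftrightarrow> (\<exists>A\<in>H. vcong p (ap A x) y)"

context
  fixes H :: "int mat set"
  assumes H: "H \<lhd> \<Gamma>"
begin

lemma reach_vcong: "reach H p x y \<Longrightarrow> vcong p x x' \<Longrightarrow> vcong p y y' \<Longrightarrow> reach H p x' y'"
  unfolding reach_def by (meson ap_vcong vcong_sym vcong_trans)

lemma reach_sym:
  assumes "reach H p x y"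
  shows "reach H p y x"
proof -
  obtain A where A: "A \<in> H" "vcong p (ap A x) y" using assms by (auto simp: reach_def)
  have "A \<in> X" using A subgroup_props(4)[OF normal_imp_subgroup[OF H]] by blast
  then have "vcong p (ap (inv\<^bsub>\<Gamma>\<^esub> A) y) x"
    using ap_vcong[OF vcong_sym[OF A(2)], of "inv\<^bsub>\<Gamma>\<^esub> A"] by simp
  then show ?thesis
    using subgroup_props(3)[OF normal_imp_subgroup[OF H] A(1)] by (auto simp: reach_def)
qed

lemma reach_trans:
  assumes "reach H p x y" "reach H p y z"
  shows "reach H p x z"
proof -
  note Hs = subgroup_props[OF normal_imp_subgroup[OF H]]
  obtain A B where A: "A \<in> H" "vcong p (ap A x) y" and B: "B \<in> H" "vcong p (ap B y) z"
    using assms by (auto simp: reach_def)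
  have "A \<in> X" "B \<in> X" using A B Hs(4) by auto
  then have "vcong p (ap (B * A) x) z"
    using vcong_trans[OF ap_vcong[OF A(2), of B] B(2)] by (simp add: ap_mult_X)
  then show ?thesis using Hs(2)[OF B(1) A(1)] by (auto simp: reach_def)
qed

lemma reach_conj:
  assumes "reach H p x y" "G \<in> X"
  shows "reach H p (ap G x) (ap G y)"
proof -
  obtain A where A: "A \<in> H" "vcong p (ap A x) y" using assms by (auto simp: reach_def)
  have "A \<in> X" using A subgroup_props(4)[OF normal_imp_subgroup[OF H]] by blast
  then have "vcong p (ap (G * A * inv\<^bsub>\<Gamma>\<^esub> G) (ap G x)) (ap G y)"
    using assms(2) ap_vcong[OF A(2), of G] by (simp add: ap_mult_X X_mult inv_in)
  then show ?thesis using conj_closed[OF H assms(2) A(1)] by (auto simp: reach_def)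
qed

lemma reach_conj_iff:
  assumes "G \<in> X"
  shows "reach H p (ap G x) (ap G y) \<longleftrightarrow> reach H p x y"
  using reach_conj[of p x y G] reach_conj[of p "ap G x" "ap G y" "inv\<^bsub>\<Gamma>\<^esub> G"] assms inv_in by auto

end

text \<open>An \<open>h\<close> in \<open>H\<close> that is not central modulo \<open>CC p\<close>
  moves some \<open>x\<close> off its line. Normalising the pair \<open>(x, h x)\<close> shows that
  \<open>H\<close> moves \<open>bas 0\<close> to some \<open>z\<close> in \<open>Z\<close>. By
  \<open>connected\<close>, \<open>H\<close> then brings every \<open>z'\<close> in \<open>Z\<close>
  to the line of \<open>bas 0\<close>; this yields transitivity on lines and, by Iwasawa's argument,
  \<open>H = X\<close>. The set \<open>Z\<close> keeps the geometry of the family out of the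
  proof.\<close>

lemma almost_simple_if_pair_forms:
  assumes p: "prime p" and n: "0 < n"
    and H: "H \<lhd> \<Gamma>" "CC p \<subseteq> H" "H \<noteq> X"
    and perfect: "\<And>D. subgroup D \<Gamma> \<Longrightarrow> (\<And>A B. A \<in> X \<Longrightarrow> B \<in> X \<Longrightarrow>
        A \<otimes>\<^bsub>\<Gamma>\<^esub> B \<otimes>\<^bsub>\<Gamma>\<^esub> inv\<^bsub>\<Gamma>\<^esub> A \<otimes>\<^bsub>\<Gamma>\<^esub> inv\<^bsub>\<Gamma>\<^esub> B \<in> D) \<Longrightarrow> D = X"
    and T: "T \<subseteq> X" "\<And>A. A \<in> T \<Longrightarrow> transvection A"
    and gen: "\<And>D. subgroup D \<Gamma> \<Longrightarrow> T \<subseteq> D \<Longrightarrow> D = X"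
    and forms: "\<And>x y. x \<in> V n \<Longrightarrow> \<not> vcong p x 0 \<Longrightarrow> y \<in> V n \<Longrightarrow> \<exists>G\<in>X. vcong p (ap G x) (bas 0) \<and>
        ((\<exists>l. vcong p (ap G y) (l \<cdot> bas 0)) \<or> (\<exists>z\<in>Z. vcong p (ap G y) z))"
    and connected: "\<And>z z'. z \<in> Z \<Longrightarrow> z' \<in> Z \<Longrightarrow> reach H p (bas 0) z \<Longrightarrow> \<exists>l. reach H p z' (l \<cdot> bas 0)"
  shows "H \<subseteq> central_mod (CC p)"
proof (rule ccontr)
  note Hs = subgroup_props[OF normal_imp_subgroup[OF H(1)]]
  assume "\<not> H \<subseteq> central_mod (CC p)"
  then obtain h where h: "h \<in> H" "h \<notin> central_mod (CC p)" by blast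
  then have hX: "h \<in> X" using Hs by blast
  obtain x where x: "x \<in> V n" "\<And>l. \<not> vcong p (ap h x) (l \<cdot> x)"
    using commutes_if_all_lines_fixed[OF n hX] h by metis
  have "\<not> vcong p x 0"
  proof
    assume "vcong p x 0"
    from ap_vcong[OF this, of h] have "vcong p (ap h x) (0 \<cdot> x)" by simp
    then show False using x by blast
  qed
  with forms[OF x(1) _, of "ap h x"] x(1) hX obtain g where g: "g \<in> X" "vcong p (ap g x) (bas 0)"
    "(\<exists>l. vcong p (ap g (ap h x)) (l \<cdot> bas 0)) \<or> (\<exists>z\<in>Z. vcong p (ap g (ap h x)) z)"
    by auto
  have x0: "vcong p x (ap (inv\<^bsub>\<Gamma>\<^esub> g) (bas 0))"
    using ap_vcong[OF g(2), of "inv\<^bsub>\<Gamma>\<^esub> g"] g(1) by simp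
  have "\<not> vcong p (ap g (ap h x)) (l \<cdot> bas 0)" for l
  proof
    assume "vcong p (ap g (ap h x)) (l \<cdot> bas 0)"
    from ap_vcong[OF this, of "inv\<^bsub>\<Gamma>\<^esub> g"]
    have "vcong p (ap h x) (l \<cdot> ap (inv\<^bsub>\<Gamma>\<^esub> g) (bas 0))" using g(1) by (simp add: ap_scal)
    then show False using x(2) vcong_scal[OF x0, of l] vcong_sym vcong_trans by blast
  qed
  then obtain z where z: "z \<in> Z" "vcong p (ap g (ap h x)) z" using g(3) by blast
  have "reach H p x (ap h x)" using h(1) unfolding reach_def by (blast intro: vcong_refl)
  from reach_vcong[OF H(1) reach_conj[OF H(1) this g(1)] g(2) z(2)]
  have ez: "reach H p (bas 0) z" .
  have "H = X"
  proof (rule full_if_line_transitive[OF p n H(1,2) perfect T gen])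
    fix v assume v: "v \<in> V n"
    have "\<not> vcong p (bas 0) 0"
      using prime_gt_1_nat[OF p] by (auto simp: vcong_def bas_def intro!: exI[of _ 0])
    \<comment> \<open>Here the pair is \<open>(bas 0, v)\<close>, so \<open>k\<close> fixes
      \<open>bas 0\<close> modulo \<open>p\<close> and the conclusion can be pulled back along
      \<open>k\<close> without losing the line.\<close>
    from forms[OF _ this v] n obtain k where k: "k \<in> X" "vcong p (ap k (bas 0)) (bas 0)"
      "(\<exists>l. vcong p (ap k v) (l \<cdot> bas 0)) \<or> (\<exists>z\<in>Z. vcong p (ap k v) z)" by auto
    have "\<exists>l. reach H p (ap k v) (l \<cdot> bas 0)"
      using k(3)
    proof
      assume "\<exists>l. vcong p (ap k v) (l \<cdot> bas 0)"
      then show ?thesis using Hs(1) by (auto simp: reach_def intro!: bexI[of _ "1\<^sub>m n"])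
    next
      assume "\<exists>z\<in>Z. vcong p (ap k v) z"
      then show ?thesis using connected[OF z(1) _ ez] reach_vcong[OF H(1) _ vcong_sym vcong_refl] by meson
    qed
    then obtain l where "reach H p (ap k v) (l \<cdot> bas 0)" by blast
    then have "reach H p (ap k v) (ap k (l \<cdot> bas 0))"
      using reach_vcong[OF H(1) _ vcong_refl vcong_scal[OF vcong_sym[OF k(2)]]] by (simp add: ap_scal)
    then show "\<exists>A\<in>H. \<exists>l. vcong p (ap A v) (l \<cdot> bas 0)"
      using reach_conj_iff[OF H(1) k(1)] by (auto simp: reach_def)
  qed
  then show False using H(3) by blast
qed

text \<open>For one-parameter families, this identifies an \<open>N\<close>-th power with the member
  whose parameter is multiplied by \<open>N\<close>.\<close>

lemma ap_eq_imp_pow: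
  assumes "\<And>k. M k \<in> X" "\<And>k x. ap (M (Suc k)) x = ap (M k) (ap (M 1) x)" "\<And>x. ap (M 0) x = x"
  shows "M 1 [^]\<^bsub>\<Gamma>\<^esub> k = M k"
proof -
  have "ap (M 1 [^]\<^bsub>\<Gamma>\<^esub> k) x = ap (M k) x" for x
  proof (induction k arbitrary: x)
    case (Suc k)
    then show ?case using assms(2)[of k] ap_pow[OF assms(1), of 1 k] by simp
  qed (simp add: assms(3))
  then show ?thesis using nat_pow_closed[of "M 1" k] assms(1) by (intro X_eqI) auto
qed

lemma congruence_familyI:
  assumes perfect: "\<And>D. subgroup D \<Gamma> \<Longrightarrow> (\<And>A B. A \<in> X \<Longrightarrow> B \<in> X \<Longrightarrow>
        A \<otimes>\<^bsub>\<Gamma>\<^esub> B \<otimes>\<^bsub>\<Gamma>\<^esub> inv\<^bsub>\<Gamma>\<^esub> A \<otimes>\<^bsub>\<Gamma>\<^esub> inv\<^bsub>\<Gamma>\<^esub> B \<in> D) \<Longrightarrow> D = X"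
    and csp: "\<And>K N. K \<lhd> \<Gamma> \<Longrightarrow> N > 0 \<Longrightarrow> (\<And>A. A \<in> X \<Longrightarrow> A [^]\<^bsub>\<Gamma>\<^esub> N \<in> K) \<Longrightarrow> CC N \<subseteq> central_mod K"
    and almost_simple: "\<And>p H. prime p \<Longrightarrow> H \<lhd> \<Gamma> \<Longrightarrow> CC p \<subseteq> H \<Longrightarrow> H \<noteq> X \<Longrightarrow> H \<subseteq> central_mod (CC p)"
    and nonabelian: "\<And>p. prime p \<Longrightarrow> central_mod (CC p) \<noteq> X"
    and surj: "\<And>p. prime p \<Longrightarrow> reduce_mat p ` X = Y p"
  shows "congruence_family \<Gamma> CC
    (\<lambda>p. \<lparr>carrier = Y p, monoid.mult = (\<lambda>A B. reduce_mat p (A * B)), one = 1\<^sub>m n\<rparr>) reduce_mat"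
    (is "congruence_family _ _ ?R _")
proof (intro congruence_family.intro congruence_family_axioms.intro is_group CC_normal CC_commutator)
  show "CC 1 = carrier \<Gamma>" by (simp only: CC_1) simp
  show "reduce_mat p \<in> epi \<Gamma> (?R p)" if p: "prime p" for p
    using reduce_mat_mult[OF X_carrier X_carrier] surj[OF p] by (auto simp: epi_def hom_def)
  show "reduce_mat p \<one>\<^bsub>\<Gamma>\<^esub> = \<one>\<^bsub>?R p\<^esub>" if p: "prime p" for p
    using prime_gt_1_nat[OF p] by (simp add: reduce_mat_one)
  show "reduce_mat p A = \<one>\<^bsub>?R p\<^esub> \<longleftrightarrow> A \<in> CC p" if p: "prime p" and A: "A \<in> carrier \<Gamma>" for p A
    using reduce_mat_eq_iff[OF X_carrier[of A] one_carrier_mat, of p] A prime_gt_1_nat[OF p]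
    by (simp add: reduce_mat_one CC_def)
  show "finite (carrier (?R p))" if p: "prime p" for p
  proof -
    have "reduce_mat p ` X \<subseteq> residue_mats n p"
      using prime_gt_0_nat[OF p] reduce_mat_in_residue_mats X_carrier by blast
    then show ?thesis using surj[OF p] finite_subset[OF _ finite_residue_mats[of n p]] by simp
  qed
qed (use assms in auto)

end

section \<open>The special linear group\<close>

text \<open>The pivot at \<open>k\<close> is 1 only modulo \<open>m\<close>, so entries are cleared
  only modulo \<open>m\<close>. As \<open>k\<close> is not in \<open>J\<close>, the pivot survives
  all the operations.\<close>

lemma clear_column:
  fixes x :: "nat \<Rightarrow> int"
  assumes J: "finite J" "k \<notin> J"
    and cl: "\<And>x t i. x \<in> X \<Longrightarrow> i \<in> J \<Longrightarrow> x(i := x i + t * x k) \<in> X"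
    and x: "x \<in> X" "int m dvd x k - 1"
  shows "\<exists>y\<in>X. (\<forall>i\<in>J. int m dvd y i) \<and> (\<forall>i. i \<notin> J \<longrightarrow> y i = x i)"
proof -
  have "\<exists>y\<in>X. (\<forall>i\<in>I. int m dvd y i) \<and> (\<forall>i. i \<notin> I \<longrightarrow> y i = x i)" if "finite I" "I \<subseteq> J" for I
    using that
  proof induction
    case (insert i I)
    then obtain y where y: "y \<in> X" "\<forall>i\<in>I. int m dvd y i" "\<forall>i. i \<notin> I \<longrightarrow> y i = x i" by auto
    let ?z = "y(i := y i + (- y i) * y k)"
    have "?z \<in> X" using cl y insert by blast
    moreover have "y i + (- y i) * y k = - (y i * (x k - 1))"
      using y(3) insert J by (auto simp: algebra_simps)
    then have "int m dvd ?z i" using x(2) by simp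
    ultimately show ?case using y insert by (intro bexI[of _ ?z]) auto
  qed (use x in auto)
  then show ?thesis using J by blast
qed

lemma det_dvd_diff:
  assumes "A \<in> carrier_mat n n" "B \<in> carrier_mat n n"
    and "\<And>i j. i < n \<Longrightarrow> j < n \<Longrightarrow> m dvd A $$ (i, j) - B $$ (i, j)"
  shows "m dvd det A - (det B :: int)"
proof -
  have "[(\<Prod>i = 0..<n. A $$ (i, q i)) = (\<Prod>i = 0..<n. B $$ (i, q i))] (mod m)"
    if "q permutes {0..<n}" for q
    using that assms(3) permutes_in_image[OF that] by (intro cong_prod) (auto simp: cong_iff_dvd_diff)
  then have "[det A = det B] (mod m)"
    unfolding det_def'[OF assms(1)] det_def'[OF assms(2)] by (intro cong_sum cong_scalar_left) auto
  then show ?thesis by (simp add: cong_iff_dvd_diff)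
qed

lemma prime_unit:
  fixes a :: int
  assumes "prime p" "\<not> int p dvd a"
  obtains s where "int p dvd a * s - 1"
proof -
  have "coprime a (int p)" using assms by (metis coprime_commute prime_imp_coprime prime_int_nat_transfer prime_nat_int_transfer)
  then obtain s where "[a * s = 1] (mod int p)" using cong_solve_coprime_int by blast
  then show ?thesis using that by (simp add: cong_iff_dvd_diff)
qed

section \<open>Rank-one perturbations and elementary matrices\<close>

definition dot :: "nat \<Rightarrow> (nat \<Rightarrow> int) \<Rightarrow> (nat \<Rightarrow> int) \<Rightarrow> int" where
  "dot n r x = (\<Sum>j<n. r j * x j)"

lemma dot_linear [simp]:
  "dot n r (x + y) = dot n r x + dot n r y" "dot n r (x - y) = dot n r x - dot n r y"
  "dot n r (c \<cdot> x) = c * dot n r x" "dot n r (- x) = - dot n r x"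
  "dot n (r + s) x = dot n r x + dot n s x" "dot n (r - s) x = dot n r x - dot n s x"
  "dot n (c \<cdot> r) x = c * dot n r x" "dot n (- r) x = - dot n r x"
  by (simp_all add: dot_def algebra_simps sum.distrib sum_subtractf sum_distrib_left sum_negf)

lemma dot_zero [simp]: "dot n 0 x = 0" "dot n r 0 = 0"
  by (simp_all add: dot_def)

lemma dot_bas [simp]: "j < n \<Longrightarrow> dot n r (bas j) = r j" "j < n \<Longrightarrow> dot n (bas j) x = x j"
  by (simp_all add: dot_def bas_def if_distrib[of "\<lambda>c. _ * c"] if_distrib[of "\<lambda>c. c * _"] cong: if_cong)

text \<open>The matrix \<open>1 + v r^T\<close>. With \<open>r = bas 0\<close> it runs through the
  first-column unipotent group, with \<open>v = bas 0\<close> through the opposite first-row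
  group.\<close>

definition rank1 :: "nat \<Rightarrow> (nat \<Rightarrow> int) \<Rightarrow> (nat \<Rightarrow> int) \<Rightarrow> int mat" where
  "rank1 n v r = mat n n (\<lambda>(i, j). (if i = j then 1 else 0) + v i * r j)"

lemma rank1_carrier [simp]: "rank1 n v r \<in> carrier_mat n n"
  by (simp add: rank1_def)

lemma ap_rank1:
  assumes "v \<in> V n"
  shows "ap (rank1 n v r) x = x + dot n r x \<cdot> v"
proof
  fix i
  have "(\<Sum>j<n. ((if i = j then 1 else 0) + v i * r j) * x j) = x i + dot n r x * v i" if "i < n"
  proof -
    have "(\<Sum>j<n. ((if i = j then 1 else 0) + v i * r j) * x j)
        = (\<Sum>j<n. (if i = j then x j else 0)) + (\<Sum>j<n. r j * x j * v i)"
      unfolding sum.distrib[symmetric] by (rule sum.cong) (auto simp: algebra_simps)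
    then show ?thesis using that by (simp add: dot_def sum_distrib_right)
  qed
  then show "ap (rank1 n v r) x i = (x + dot n r x \<cdot> v) i"
    using assms by (auto simp: ap_def rank1_def V_def)
qed

definition SLZ :: "nat \<Rightarrow> int mat set" where
  "SLZ n = {A \<in> carrier_mat n n. det A = 1}"

lemma rank1_in_SLZ:
  assumes "v = bas 0 \<and> r 0 = 0 \<or> r = bas 0 \<and> v 0 = 0"
  shows "rank1 n v r \<in> SLZ n"
proof -
  have diag: "prod_list (diag_mat (rank1 n v r)) = 1"
    unfolding prod_list_diag_prod using assms by (intro prod.neutral) (auto simp: rank1_def bas_def intro: gr0I split: if_splits)
  have "det (rank1 n v r) = 1"
  proof (cases "v = bas 0 \<and> r 0 = 0")
    case True
    then have "upper_triangular (rank1 n v r)" by (auto simp: rank1_def bas_def)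
    then show ?thesis using det_upper_triangular[of "rank1 n v r" n] diag by simp
  next
    case False
    then have "r = bas 0" "v 0 = 0" using assms by auto
    then have "\<And>i j. i < j \<Longrightarrow> j < n \<Longrightarrow> rank1 n v r $$ (i, j) = 0" by (auto simp: rank1_def bas_def)
    then show ?thesis using det_lower_triangular[of n "rank1 n v r"] diag by simp
  qed
  then show ?thesis by (simp add: SLZ_def)
qed

abbreviation El :: "nat \<Rightarrow> nat \<Rightarrow> nat \<Rightarrow> int \<Rightarrow> int mat" where
  "El n i j t \<equiv> addrow_mat n t i j"

lemma El_rank1: "El n i j t = rank1 n (t \<cdot> bas i) (bas j)" if "i < n" "j < n"
  by (rule eq_matI) (auto simp: rank1_def bas_def)

lemma ap_El: "i < n \<Longrightarrow> j < n \<Longrightarrow> ap (El n i j t) x = x(i := x i + t * x j)"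
  by (auto simp: El_rank1 ap_rank1 bas_apply fun_eq_iff)

lemma El_in_SLZ: "i \<noteq> j \<Longrightarrow> El n i j t \<in> SLZ n"
  by (simp add: SLZ_def det_addrow_mat)

definition ElS :: "nat \<Rightarrow> int mat set" where
  "ElS n = {El n i j t | i j t. i < n \<and> j < n \<and> i \<noteq> j}"

locale sl =
  fixes n :: nat
  assumes n3: "3 \<le> n"
begin

sublocale matgroup n "SLZ n"
proof
  show "\<exists>B\<in>SLZ n. B * A = 1\<^sub>m n" if "A \<in> SLZ n" for A
  proof -
    have A: "A \<in> carrier_mat n n" "det A = 1" using that by (auto simp: SLZ_def)
    have B: "adj_mat A \<in> carrier_mat n n" "adj_mat A * A = 1\<^sub>m n" using adj_mat[OF A(1)] A(2) by auto
    then have "det (adj_mat A) = 1" using det_mult[OF B(1) A(1)] A(2) by simp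
    then show ?thesis using B by (auto simp: SLZ_def)
  qed
qed (auto simp: SLZ_def det_mult)

lemma n_gt [simp]: "0 < n" "Suc 0 < n" "2 < n" "Suc (Suc 0) < n"
  using n3 by auto

lemma El_in_X [simp]: "i \<noteq> j \<Longrightarrow> El n i j t \<in> SLZ n"
  by (rule El_in_SLZ)

lemma ElS_subset: "ElS n \<subseteq> SLZ n"
  by (auto simp: ElS_def)

lemma inv_El: "i < n \<Longrightarrow> j < n \<Longrightarrow> i \<noteq> j \<Longrightarrow> inv\<^bsub>\<Gamma>\<^esub> (El n i j t) = El n i j (- t)"
  by (rule inv_equality) (auto intro!: X_eqI simp: X_one X_mult ap_mult_X ap_El fun_eq_iff)

text \<open>A Steinberg relation. The third index \<open>k\<close> is what makes the group perfect
  for \<open>n\<close> at least 3.\<close>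

lemma El_commutator:
  assumes "i < n" "j < n" "k < n" "i \<noteq> j" "i \<noteq> k" "j \<noteq> k"
  shows "El n i k t \<otimes>\<^bsub>\<Gamma>\<^esub> El n k j 1 \<otimes>\<^bsub>\<Gamma>\<^esub> inv\<^bsub>\<Gamma>\<^esub> (El n i k t) \<otimes>\<^bsub>\<Gamma>\<^esub> inv\<^bsub>\<Gamma>\<^esub> (El n k j 1) = El n i j t"
  by (rule commutator_eqI) (use assms in \<open>auto simp: ap_El fun_eq_iff algebra_simps\<close>)

text \<open>Unimodularity is stated through divisors: common divisors of the entries from
  \<open>k\<close> on divide some \<open>r\<close> that is 1 modulo \<open>m\<close>. Operations
  with source \<open>j \<ge> k\<close> fix the first \<open>k\<close> basis vectors whatever their
  target. Euclid leaves a pivot that is only a unit modulo \<open>m\<close>; turning it into 1 uses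
  coordinate \<open>k + 1\<close>, hence \<open>Suc k < n\<close>.\<close>

lemma column_reduction:
  assumes D: "subgroup D \<Gamma>" "ElS n \<subseteq> D" and k: "Suc k < n" and v: "v \<in> V n"
    and r: "int m dvd r - 1" "\<And>d. (\<And>j. j \<ge> k \<Longrightarrow> j < n \<Longrightarrow> d dvd v j) \<Longrightarrow> d dvd r"
  shows "\<exists>F\<in>D. (\<forall>j<k. ap F (bas j) = bas j) \<and> vcong m (ap F v) (bas k)"
proof -
  note D' = subgroup_props[OF D(1)]
  define Xs where "Xs = {ap F v | F. F \<in> D \<and> (\<forall>j<k. ap F (bas j) = bas j)}"
  have step: "x(i := x i + t * x j) \<in> Xs" if x: "x \<in> Xs" and ij: "i < n" "j < n" "i \<noteq> j" "k \<le> j" for x i j t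
  proof -
    obtain F where F: "F \<in> D" "\<forall>j<k. ap F (bas j) = bas j" "x = ap F v" using x by (auto simp: Xs_def)
    have El: "El n i j t \<in> D" using D(2) ij by (auto simp: ElS_def)
    have "ap (El n i j t * F) y = (ap F y)(i := ap F y i + t * ap F y j)" for y
      using El F(1) D'(4) ij by (simp add: ap_mult_X subset_iff ap_El)
    moreover have "(bas l)(i := bas l i + t * bas l j) = bas l" if "l < k" for l
      using that ij by (auto simp: bas_def)
    ultimately show ?thesis
      using D'(2)[OF El F(1)] F unfolding Xs_def by (auto intro!: exI[of _ "El n i j t * F"])
  qed
  have cl: "euclid_closed {k..<n} Xs" unfolding euclid_closed_def using step by auto
  have "v \<in> Xs" using D'(1) by (auto simp: Xs_def intro!: exI[of _ "1\<^sub>m n"])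
  from euclid_vector[OF _ _ cl this, of k] k obtain w where w: "w \<in> Xs"
    "\<forall>i\<in>{k..<n}. i \<noteq> k \<longrightarrow> w i = 0" "\<forall>i\<in>{k..<n}. w k dvd v i" by auto
  have "w k dvd r" by (rule r(2)) (use w in auto)
  then obtain x where x: "x \<in> Xs" "int m dvd x k - 1" "int m dvd x (Suc k)"
    "\<forall>i. i \<noteq> k \<longrightarrow> i \<noteq> Suc k \<longrightarrow> x i = w i"
    using euclid_unit[OF _ _ _ cl w(1) _ r(1), of k "Suc k"] k w(2) by auto
  have "\<exists>y\<in>Xs. (\<forall>i\<in>{..<k}. int m dvd y i) \<and> (\<forall>i. i \<notin> {..<k} \<longrightarrow> y i = x i)"
    by (rule clear_column[of _ k]) (use x k step in auto)
  then obtain y where y: "y \<in> Xs" "\<forall>i<k. int m dvd y i" "\<forall>i\<ge>k. y i = x i" by auto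
  obtain F where F: "F \<in> D" "\<forall>j<k. ap F (bas j) = bas j" "y = ap F v" using y by (auto simp: Xs_def)
  have "y \<in> V n" using F D'(4) v by (auto simp: subset_iff)
  have "int m dvd y i - bas k i" for i
  proof -
    consider "i < k" | "i = k" | "i = Suc k" | "Suc k < i" "i < n" | "i \<ge> n" by linarith
    then show ?thesis
      by cases (use y x w k \<open>y \<in> V n\<close> in \<open>auto simp: bas_def V_def\<close>)
  qed
  then show ?thesis using F unfolding vcong_def by auto
qed

text \<open>The columns are normalised one after the other until \<open>F * A\<close> is the
  identity modulo \<open>m\<close>; the inverse of \<open>F\<close> is the lift.\<close>

lemma lift_mod:
  assumes D: "subgroup D \<Gamma>" "ElS n \<subseteq> D" and A: "A \<in> carrier_mat n n" "int m dvd det A - 1"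
  shows "\<exists>F\<in>D. \<forall>x. vcong m (ap F x) (ap A x)"
proof -
  note D' = subgroup_props[OF D(1)]
  have "\<exists>F\<in>D. \<forall>j<k. vcong m (ap F (ap A (bas j))) (bas j)" if "k \<le> n" for k
    using that
  proof (induction k)
    case 0
    show ?case using D'(1) by blast
  next
    case (Suc k)
    then obtain F where F: "F \<in> D" "\<And>j. j < k \<Longrightarrow> vcong m (ap F (ap A (bas j))) (bas j)" by auto
    have FX: "F \<in> SLZ n" using F D'(4) by blast
    then have Fc: "F \<in> carrier_mat n n" "det F = 1" by (auto simp: SLZ_def)
    define A' where "A' = F * A"
    have A': "A' \<in> carrier_mat n n" "det A' = det A"
      using A Fc by (auto simp: A'_def det_mult[of _ n])
    have apA': "ap A' x = ap F (ap A x)" for x using A Fc by (simp add: A'_def ap_mult[of _ n])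
    have fixes_bas: "vcong m (ap A' (bas j)) (bas j)" if "j < k" for j using F(2)[OF that] apA' by simp
    define v where "v = ap A' (bas k)"
    have v: "v \<in> V n" using A' Suc.prems by (simp add: v_def)
    have main: "\<exists>E\<in>D. (\<forall>j<k. ap E (bas j) = bas j) \<and> vcong m (ap E v) (bas k)"
    proof (cases "Suc k < n")
      case True
      \<comment> \<open>The adjugate inverts \<open>A'\<close> modulo \<open>m\<close>. Its row
        \<open>k\<close> combines the entries of \<open>v\<close> to 1, and the entries of that row
        left of \<open>k\<close> vanish modulo \<open>m\<close>, so the entries of \<open>v\<close>
        from \<open>k\<close> on are unimodular.\<close>
      define B where "B = adj_mat A'"
      have B: "B \<in> carrier_mat n n" "B * A' = det A \<cdot>\<^sub>m 1\<^sub>m n"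
        using adj_mat[OF A'(1)] A'(2) by (auto simp: B_def)
      have BA: "vcong m (ap B (ap A' x)) x" for x
      proof -
        have "ap B (ap A' x) = ap (det A \<cdot>\<^sub>m 1\<^sub>m n) x" using B A' by (simp flip: ap_mult)
        moreover have "vcong m (ap (det A \<cdot>\<^sub>m 1\<^sub>m n) x) (ap (1\<^sub>m n) x)"
        proof (rule ap_congI)
          fix j assume "j < n"
          have "int m dvd ap (det A \<cdot>\<^sub>m 1\<^sub>m n) (bas j) i - ap (1\<^sub>m n) (bas j) i" for i
          proof (cases "i < n")
            case True
            then show ?thesis
              using A(2) ap_bas[of "det A \<cdot>\<^sub>m 1\<^sub>m n" n i j] \<open>j < n\<close> by (auto simp: bas_def)
          next
            case False
            then show ?thesis using ap_outside[of "det A \<cdot>\<^sub>m 1\<^sub>m n" n i] by simp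
          qed
          then show "vcong m (ap (det A \<cdot>\<^sub>m 1\<^sub>m n) (bas j)) (ap (1\<^sub>m n) (bas j))"
            by (simp add: vcong_def)
        qed auto
        ultimately show ?thesis by simp
      qed
      have Bj: "int m dvd ap B (bas j) k" if "j < k" for j
      proof -
        have "vcong m (ap B (bas j)) (bas j)"
          using ap_vcong[OF vcong_sym[OF fixes_bas[OF that]], of B] BA vcong_trans by blast
        then show ?thesis using that unfolding vcong_def by (auto dest: spec[of _ k] simp: bas_def)
      qed
      have "int m dvd ap B v k - 1"
        using BA[of "bas k", folded v_def] unfolding vcong_def by (auto dest: spec[of _ k] simp: bas_def)
      moreover have "ap B v k = (\<Sum>j<k. ap B (bas j) k * v j) + (\<Sum>j=k..<n. ap B (bas j) k * v j)"
        unfolding ap_sum[OF B(1) Suc_lessD[OF True], of v]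
        by (subst sum.union_disjoint[symmetric]) (use True in \<open>auto intro!: sum.cong\<close>)
      ultimately have "int m dvd (\<Sum>j<k. ap B (bas j) k * v j) + ((\<Sum>j=k..<n. ap B (bas j) k * v j) - 1)"
        by (simp add: algebra_simps)
      moreover have "int m dvd (\<Sum>j<k. ap B (bas j) k * v j)" using Bj by (auto intro!: dvd_sum)
      ultimately have "int m dvd (\<Sum>j=k..<n. ap B (bas j) k * v j) - 1"
        using dvd_add_right_iff by blast
      then show ?thesis
        by (rule column_reduction[OF D True v]) (auto intro!: dvd_sum)
    next
      case False
      then have kn: "n = Suc k" using Suc.prems by simp
      \<comment> \<open>For the last column no auxiliary coordinate is left. Replacing the finished
        columns by basis vectors changes the determinant only by a multiple of \<open>m\<close> and
        makes the matrix triangular, so the pivot is the determinant modulo \<open>m\<close>, that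
        is 1.\<close>
      define A2 where "A2 = mat n n (\<lambda>(i, j). if j < k then (if i = j then 1 else 0) else A' $$ (i, j))"
      have "int m dvd det A' - det A2"
      proof (rule det_dvd_diff[OF A'(1)])
        fix i j assume ij: "i < n" "j < n"
        show "int m dvd A' $$ (i, j) - A2 $$ (i, j)"
        proof (cases "j < k")
          case True
          then show ?thesis using fixes_bas[OF True] ij ap_bas[OF A'(1) ij]
            unfolding vcong_def by (auto dest!: spec[of _ i] simp: A2_def bas_def split: if_splits)
        qed (use ij in \<open>simp add: A2_def\<close>)
      qed (simp add: A2_def)
      moreover have "det A2 = v k"
      proof -
        have "upper_triangular A2" using kn by (auto simp: A2_def)
        then have "det A2 = prod_list (diag_mat A2)" using det_upper_triangular[of A2 n] by (simp add: A2_def)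
        also have "\<dots> = (\<Prod>i = 0..<Suc k. A2 $$ (i, i))"
          unfolding prod_list_diag_prod using kn by (simp add: A2_def)
        also have "\<dots> = v k" using kn ap_bas[OF A'(1), of k k] by (simp add: A2_def v_def)
        finally show ?thesis .
      qed
      moreover have "int m dvd det A' - 1" using A'(2) A(2) by simp
      ultimately have "int m dvd (det A' - 1) - (det A' - v k)" by (metis dvd_diff)
      then have vk: "int m dvd v k - 1" by simp
      define Xs where "Xs = {ap E v | E. E \<in> D \<and> (\<forall>j<k. ap E (bas j) = bas j)}"
      have "\<exists>y\<in>Xs. (\<forall>i\<in>{..<k}. int m dvd y i) \<and> (\<forall>i. i \<notin> {..<k} \<longrightarrow> y i = v i)"
      proof (rule clear_column[of _ k])
        show "v \<in> Xs" using D'(1) by (auto simp: Xs_def intro!: exI[of _ "1\<^sub>m n"])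
        fix x i t assume x: "x \<in> Xs" and i: "i \<in> {..<k}"
        obtain E where E: "E \<in> D" "\<forall>j<k. ap E (bas j) = bas j" "x = ap E v" using x by (auto simp: Xs_def)
        have "El n i k t \<in> ElS n" using i kn unfolding ElS_def by fastforce
        then have El: "El n i k t \<in> D" using D(2) by blast
        have "ap (El n i k t * E) y = (ap E y)(i := ap E y i + t * ap E y k)" for y
          using El E(1) D'(4) i kn by (simp add: ap_mult_X subset_iff ap_El)
        moreover have "(bas l)(i := bas l i + t * bas l k) = bas l" if "l < k" for l
          using that i by (auto simp: bas_def)
        ultimately show "x(i := x i + t * x k) \<in> Xs"
          using D'(2)[OF El E(1)] E unfolding Xs_def by (auto intro!: exI[of _ "El n i k t * E"])
      qed (use vk in auto)
      then obtain E where E: "E \<in> D" "\<forall>j<k. ap E (bas j) = bas j" "\<forall>i<k. int m dvd ap E v i"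
        "\<forall>i\<ge>k. ap E v i = v i" by (auto simp: Xs_def)
      have "int m dvd ap E v i - bas k i" for i
      proof -
        consider "i < k" | "i = k" | "i \<ge> n" using kn by linarith
        then show ?thesis by cases (use E vk v kn in \<open>auto simp: bas_def V_def\<close>)
      qed
      then show ?thesis using E unfolding vcong_def by auto
    qed
    then obtain E where E: "E \<in> D" "\<forall>j<k. ap E (bas j) = bas j" "vcong m (ap E v) (bas k)" by blast
    have "vcong m (ap (E * F) (ap A (bas j))) (bas j)" if "j < Suc k" for j
    proof -
      have "ap (E * F) (ap A (bas j)) = ap E (ap A' (bas j))"
        using E(1) FX D'(4) by (simp add: ap_mult_X subset_iff apA')
      moreover have "vcong m (ap E (ap A' (bas j))) (bas j)"
      proof (cases "j = k")
        case False
        then have "j < k" using that by simp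
        then show ?thesis using ap_vcong[OF fixes_bas, of j E] E(2) by simp
      qed (use E(3) v_def in simp)
      ultimately show ?thesis by simp
    qed
    then show ?case using D'(2)[OF E(1) F(1)] by blast
  qed
  from this[of n] obtain F where F: "F \<in> D" "\<And>j. j < n \<Longrightarrow> vcong m (ap F (ap A (bas j))) (bas j)" by auto
  have FX: "F \<in> SLZ n" using F D'(4) by blast
  have iF: "inv\<^bsub>\<Gamma>\<^esub> F \<in> D" using F D'(3) by blast
  have "vcong m (ap (inv\<^bsub>\<Gamma>\<^esub> F) x) (ap A x)" for x
  proof (rule ap_congI[OF _ A(1)])
    show "inv\<^bsub>\<Gamma>\<^esub> F \<in> carrier_mat n n" using inv_in[OF FX] X_carrier by blast
    show "vcong m (ap (inv\<^bsub>\<Gamma>\<^esub> F) (bas j)) (ap A (bas j))" if "j < n" for j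
      using vcong_sym[OF ap_vcong[OF F(2)[OF that], of "inv\<^bsub>\<Gamma>\<^esub> F"]] FX by simp
  qed
  then show ?thesis using iF by blast
qed

lemma generated_by_ElS:
  assumes "subgroup D \<Gamma>" "ElS n \<subseteq> D"
  shows "D = SLZ n"
proof
  show "SLZ n \<subseteq> D"
  proof
    fix A assume A: "A \<in> SLZ n"
    then obtain F where F: "F \<in> D" "\<forall>x. vcong 0 (ap F x) (ap A x)"
      using lift_mod[OF assms, of A 0] by (auto simp: SLZ_def)
    then have "F = A" using A subgroup_props(4)[OF assms(1)] by (intro X_eqI) auto
    then show "A \<in> D" using F by simp
  qed
qed (rule subgroup_props(4)[OF assms(1)])

lemma reduce_mat_image:
  assumes p: "p > 0"
  shows "reduce_mat p ` SLZ n = {A \<in> residue_mats n p. [det A = 1] (mod int p)}"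
proof (intro equalityI subsetI)
  fix B assume "B \<in> reduce_mat p ` SLZ n"
  then obtain A where A: "A \<in> carrier_mat n n" "det A = 1" and B: "B = reduce_mat p A"
    by (auto simp: SLZ_def)
  have "int p dvd det B - det A" unfolding B
    by (rule det_dvd_diff[of _ n]) (use A in \<open>auto simp: reduce_mat_def mod_eq_dvd_iff[symmetric]\<close>)
  then show "B \<in> {A \<in> residue_mats n p. [det A = 1] (mod int p)}"
    using A B p by (simp add: reduce_mat_in_residue_mats cong_iff_dvd_diff)
next
  fix B assume "B \<in> {A \<in> residue_mats n p. [det A = 1] (mod int p)}"
  then have B: "B \<in> residue_mats n p" "B \<in> carrier_mat n n" "int p dvd det B - 1"
    by (auto simp: residue_mats_def cong_iff_dvd_diff)
  have "subgroup (SLZ n) \<Gamma>" using subgroup_self by simp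
  then obtain F where F: "F \<in> SLZ n" "\<forall>x. vcong p (ap F x) (ap B x)"
    using lift_mod[OF _ ElS_subset B(2,3)] by blast
  then have "reduce_mat p F = B"
    using reduce_mat_eq_iff[of F n B p] B X_carrier[OF F(1)] reduce_residue_mats[OF B(1)] by simp
  then show "B \<in> reduce_mat p ` SLZ n" using F by blast
qed

section \<open>Perfectness and simplicity modulo \<open>p\<close>, linear case\<close>

lemma sl_perfect:
  assumes D: "subgroup D \<Gamma>" and c: "\<And>A B. A \<in> SLZ n \<Longrightarrow> B \<in> SLZ n \<Longrightarrow>
        A \<otimes>\<^bsub>\<Gamma>\<^esub> B \<otimes>\<^bsub>\<Gamma>\<^esub> inv\<^bsub>\<Gamma>\<^esub> A \<otimes>\<^bsub>\<Gamma>\<^esub> inv\<^bsub>\<Gamma>\<^esub> B \<in> D"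
  shows "D = SLZ n"
proof (rule generated_by_ElS[OF D], rule subsetI)
  fix A assume "A \<in> ElS n"
  then obtain i j t where A: "A = El n i j t" and ij: "i < n" "j < n" "i \<noteq> j" by (auto simp: ElS_def)
  obtain k where k: "k < n" "k \<noteq> i" "k \<noteq> j"
  proof -
    have "card {i, j} < card {..<n}" using n3 by (auto intro: le_less_trans[OF card_insert_le_m1])
    then have "\<not> {..<n} \<subseteq> {i, j}" by (meson card_mono finite.emptyI finite.insertI leD)
    then show ?thesis using that by blast
  qed
  show "A \<in> D" unfolding A using El_commutator[of i j k t] ij k c[of "El n i k t" "El n k j 1"] by simp
qed

lemma sl_nonabelian:
  assumes "p > 1"
  shows "central_mod (CC p) \<noteq> SLZ n"
proof
  assume "central_mod (CC p) = SLZ n"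
  then have "El n 0 1 1 \<in> central_mod (CC p)" by simp
  then have "El n 0 2 1 \<in> CC p"
    using El_commutator[of 0 2 1 1] by (auto simp: central_mod_def dest!: bspec[of _ _ "El n 1 2 1"])
  then have "vcong p (ap (El n 0 2 1) (bas 2)) (bas 2)" by (auto simp: CC_def)
  then have "int p dvd 1" by (auto simp: vcong_def ap_El bas_def dest!: spec[of _ 0])
  then show False using assms by simp
qed

text \<open>A vector nonzero modulo \<open>p\<close> has a unit entry, hence is unimodular.
  Reduction at 0 handles \<open>x\<close>; if \<open>y\<close> is not on the line, reduction at 1
  handles it while fixing \<open>bas 0\<close>, and this second reduction needs a third
  coordinate.\<close>

lemma pair_normal_form:
  assumes p: "prime p" and x: "x \<in> V n" "\<not> vcong p x 0" and y: "y \<in> V n"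
  shows "\<exists>g\<in>SLZ n. vcong p (ap g x) (bas 0) \<and> ((\<exists>l. vcong p (ap g y) (l \<cdot> bas 0)) \<or> vcong p (ap g y) (bas 1))"
proof -
  have self: "subgroup (SLZ n) \<Gamma>" using subgroup_self by simp
  obtain i where i: "\<not> int p dvd x i" using x by (auto simp: vcong_def)
  then have "i < n" using x by (auto simp: V_def intro: ccontr)
  obtain s where s: "int p dvd x i * s - 1" using prime_unit[OF p i] .
  obtain F where F: "F \<in> SLZ n" "vcong p (ap F x) (bas 0)"
    using column_reduction[OF self ElS_subset _ x(1) s, of 0] \<open>i < n\<close> by auto
  define z where "z = ap F y"
  have z: "z \<in> V n" using F y by (simp add: z_def)
  show ?thesis
  proof (cases "\<forall>j\<ge>1. int p dvd z j")
    case True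
    then have "vcong p z (z 0 \<cdot> bas 0)" by (auto simp: vcong_def bas_def)
    then show ?thesis using F unfolding z_def by blast
  next
    case False
    then obtain j where j: "j \<ge> 1" "\<not> int p dvd z j" by blast
    then have "j < n" using z by (auto simp: V_def intro: ccontr)
    obtain s where s: "int p dvd z j * s - 1" using prime_unit[OF p j(2)] .
    obtain E where E: "E \<in> SLZ n" "\<forall>j<1. ap E (bas j) = bas j" "vcong p (ap E z) (bas 1)"
      using column_reduction[OF self ElS_subset _ z s, of 1] \<open>j < n\<close> j by auto
    have "vcong p (ap (E * F) x) (bas 0)"
      using ap_vcong[OF F(2), of E] E F by (simp add: ap_mult_X)
    moreover have "vcong p (ap (E * F) y) (bas 1)" using E F by (simp add: ap_mult_X z_def)
    ultimately show ?thesis using X_mult[OF E(1) F(1)] by blast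
  qed
qed

text \<open>All independent pairs are equivalent, so \<open>Z\<close> is \<open>{bas 1}\<close> and
  connectedness is just symmetry of \<open>reach\<close>.\<close>

lemma sl_almost_simple:
  assumes p: "prime p" and H: "H \<lhd> \<Gamma>" "CC p \<subseteq> H" "H \<noteq> SLZ n"
  shows "H \<subseteq> central_mod (CC p)"
proof (rule almost_simple_if_pair_forms[OF p n_gt(1) H sl_perfect ElS_subset _ generated_by_ElS])
  show "transvection A" if El: "A \<in> ElS n" for A
  proof -
    obtain i j t where A: "A = El n i j t" and ij: "i < n" "j < n" "i \<noteq> j"
      using El by (auto simp: ElS_def)
    have "ap A x = x + x j \<cdot> (t \<cdot> bas i)" for x
      using ij by (simp add: A El_rank1 ap_rank1)
    then show ?thesis unfolding transvection_def using ij
      by (intro exI[of _ "\<lambda>x. x j"] exI[of _ "t \<cdot> bas i"]) (auto simp: lin_form_def bas_apply)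
  qed
  show "\<exists>G\<in>SLZ n. vcong p (ap G x) (bas 0) \<and>
      ((\<exists>l. vcong p (ap G y) (l \<cdot> bas 0)) \<or> (\<exists>z\<in>{bas 1}. vcong p (ap G y) z))"
    if "x \<in> V n" "\<not> vcong p x 0" "y \<in> V n" for x y
    using pair_normal_form[OF p that] by simp
  show "\<exists>l. reach H p z' (l \<cdot> bas 0)" if "z \<in> {bas 1}" "z' \<in> {bas 1}" "reach H p (bas 0) z" for z z'
    using reach_sym[OF H(1) that(3)] that(1,2) by (intro exI[of _ 1]) simp
qed

lemma rank1_X [simp]:
  "r 0 = 0 \<Longrightarrow> rank1 n (bas 0) r \<in> SLZ n" "v 0 = 0 \<Longrightarrow> rank1 n v (bas 0) \<in> SLZ n"
  by (auto intro: rank1_in_SLZ)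

lemma bas0 [simp]: "bas 0 0 = 1"
  by (simp add: bas_def)

lemma dot_ap:
  assumes "A \<in> carrier_mat n n"
  shows "dot n r (ap A y) = dot n (\<lambda>j. dot n r (ap A (bas j))) y"
proof -
  have "dot n r (ap A y) = (\<Sum>i<n. \<Sum>j<n. r i * (ap A (bas j) i * y j))"
    unfolding dot_def by (rule sum.cong) (simp_all add: ap_sum[OF assms, of _ y] sum_distrib_left)
  also have "\<dots> = (\<Sum>j<n. \<Sum>i<n. r i * (ap A (bas j) i * y j))" by (rule sum.swap)
  finally show ?thesis by (simp add: dot_def sum_distrib_right mult.assoc)
qed

lemma El_eq_rank1:
  "j < n \<Longrightarrow> El n j 0 t = rank1 n (t \<cdot> bas j) (bas 0)"
  "j < n \<Longrightarrow> El n 0 j t = rank1 n (bas 0) (t \<cdot> bas j)"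
  by (auto simp: El_rank1 rank1_def fun_eq_iff mult_ac intro!: eq_matI)

section \<open>The weak congruence property, linear case\<close>

context
  fixes K :: "int mat set" and N :: nat
  assumes K: "K \<lhd> \<Gamma>" and N: "N > 0" and pow: "\<And>A. A \<in> SLZ n \<Longrightarrow> A [^]\<^bsub>\<Gamma>\<^esub> N \<in> K"
begin

lemma multiple_in_K:
  "i < n \<Longrightarrow> j < n \<Longrightarrow> i \<noteq> j \<Longrightarrow> El n i j (int N * t) \<in> K"
  "r 0 = 0 \<Longrightarrow> rank1 n (bas 0) (int N \<cdot> r) \<in> K"
  "v \<in> V n \<Longrightarrow> v 0 = 0 \<Longrightarrow> rank1 n (int N \<cdot> v) (bas 0) \<in> K"
proof -
  show "El n i j (int N * t) \<in> K" if "i < n" "j < n" "i \<noteq> j"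
    using ap_eq_imp_pow[of "\<lambda>k. El n i j (int k * t)" N] pow[of "El n i j t"] that
    by (auto simp: ap_El fun_eq_iff algebra_simps)
  show "rank1 n (bas 0) (int N \<cdot> r) \<in> K" if "r 0 = 0"
    using ap_eq_imp_pow[of "\<lambda>k. rank1 n (bas 0) (int k \<cdot> r)" N] pow[of "rank1 n (bas 0) r"] that
    by (auto simp: ap_rank1 fun_eq_iff algebra_simps)
  show "rank1 n (int N \<cdot> v) (bas 0) \<in> K" if "v \<in> V n" "v 0 = 0"
    using ap_eq_imp_pow[of "\<lambda>k. rank1 n (int k \<cdot> v) (bas 0)" N] pow[of "rank1 n v (bas 0)"] that
    by (auto simp: ap_rank1 fun_eq_iff algebra_simps)
qed

text \<open>Conjugation by \<open>A\<close> permutes the first-column group and the first-row group,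
  and displaces their parameters by multiples of \<open>N\<close>. So \<open>A\<close> commutes with
  both groups modulo \<open>K\<close>, and \<open>El_commutator\<close> through index 0 produces the
  remaining elementary matrices.\<close>

lemma central_if_block:
  assumes A: "A \<in> CC N" and e: "ap A (bas 0) = bas 0" and row: "\<And>x. ap A x 0 = x 0"
  shows "A \<in> central_mod K"
proof -
  have AX: "A \<in> SLZ n" and Ac: "\<And>x. vcong N (ap A x) x" using A by (auto simp: CC_def)
  have iA: "\<And>x. vcong N (ap (inv\<^bsub>\<Gamma>\<^esub> A) x) x"
    using subgroup_props(3)[OF CC_subgroup A] by (auto simp: CC_def)
  have ie: "ap (inv\<^bsub>\<Gamma>\<^esub> A) (bas 0) = bas 0" using ap_inv2[OF AX, of "bas 0"] e by simp
  define D where "D = {b \<in> carrier \<Gamma>. A \<otimes>\<^bsub>\<Gamma>\<^esub> b \<otimes>\<^bsub>\<Gamma>\<^esub> inv\<^bsub>\<Gamma>\<^esub> A \<otimes>\<^bsub>\<Gamma>\<^esub> inv\<^bsub>\<Gamma>\<^esub> b \<in> K}"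
  have D: "subgroup D \<Gamma>" unfolding D_def using normal.subgroup_commuting_mod[OF K] AX by simp
  have Lo: "rank1 n c (bas 0) \<in> D" if c: "c \<in> V n" "c 0 = 0" for c
  proof -
    obtain z where zV: "z \<in> V n" and z: "ap A c = c + int N \<cdot> z"
      by (rule vcong_obtain_V[OF Ac[of c], of n]) (use c AX in auto)
    \<comment> \<open>The hypothesis \<open>row\<close> keeps the correction inside the first-column
      group.\<close>
    have "int N * z 0 = 0" using row[of c] z by (simp add: fun_eq_iff)
    then have z0: "z 0 = 0" using N by simp
    have "A \<otimes>\<^bsub>\<Gamma>\<^esub> rank1 n c (bas 0) \<otimes>\<^bsub>\<Gamma>\<^esub> inv\<^bsub>\<Gamma>\<^esub> A \<otimes>\<^bsub>\<Gamma>\<^esub> inv\<^bsub>\<Gamma>\<^esub> (rank1 n c (bas 0))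
        = rank1 n (int N \<cdot> z) (bas 0)"
      by (rule commutator_eqI)
        (use AX c zV z0 z row in \<open>auto simp: ap_rank1 ap_linear fun_eq_iff algebra_simps\<close>)
    then show ?thesis using multiple_in_K(3)[OF zV z0] c by (simp add: D_def)
  qed
  have Up: "rank1 n (bas 0) r \<in> D" if r: "r 0 = 0" for r
  proof -
    \<comment> \<open>The row \<open>r\<close> times the inverse of \<open>A\<close>, which is how
      conjugation transports \<open>r\<close>. It differs from \<open>r\<close> by a multiple of
      \<open>N\<close>, and \<open>u\<close> is the quotient.\<close>
    define s where "s = (\<lambda>j. dot n r (ap (inv\<^bsub>\<Gamma>\<^esub> A) (bas j)))"
    define u where "u = (\<lambda>j. if j < n then (s j - r j) div int N else 0)"
    have s: "int N * u j = s j - r j" if j: "j < n" for j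
    proof -
      obtain z where "ap (inv\<^bsub>\<Gamma>\<^esub> A) (bas j) = bas j + int N \<cdot> z"
        by (rule vcong_obtain[OF iA[of "bas j"]])
      then have "s j - r j = int N * dot n r z" using j by (simp add: s_def)
      then show ?thesis using j by (simp add: u_def)
    qed
    have u0: "u 0 = 0" using s[of 0] r N by (simp add: s_def ie)
    have dot: "dot n (r + int N \<cdot> u) (ap A x) = dot n r x" for x
    proof -
      have "dot n (r + int N \<cdot> u) (ap A x) = dot n s (ap A x)"
        unfolding dot_def by (rule sum.cong) (simp_all add: s)
      also have "\<dots> = dot n r (ap (inv\<^bsub>\<Gamma>\<^esub> A) (ap A x))"
        unfolding s_def by (rule dot_ap[symmetric]) (use AX inv_in X_carrier in blast)
      finally show ?thesis using AX by simp
    qed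
    have "A \<otimes>\<^bsub>\<Gamma>\<^esub> rank1 n (bas 0) r \<otimes>\<^bsub>\<Gamma>\<^esub> inv\<^bsub>\<Gamma>\<^esub> A \<otimes>\<^bsub>\<Gamma>\<^esub> inv\<^bsub>\<Gamma>\<^esub> (rank1 n (bas 0) r)
        = rank1 n (bas 0) (int N \<cdot> u)"
    proof (rule commutator_eqI)
      fix x
      have "dot n r x = dot n r (ap A x) + int N * dot n u (ap A x)" using dot[of x] by simp
      then show "ap A (ap (rank1 n (bas 0) r) x) = ap (rank1 n (bas 0) (int N \<cdot> u)) (ap (rank1 n (bas 0) r) (ap A x))"
        using u0 e by (simp add: ap_rank1 ap_linear) (simp add: fun_eq_iff algebra_simps)
    qed (use AX r u0 in auto)
    then show ?thesis using multiple_in_K(2)[where r = u] u0 r by (simp add: D_def)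
  qed
  have El0: "El n i 0 t \<in> D" "El n 0 i t \<in> D" if "i < n" "i \<noteq> 0" for i t
    using Lo[of "t \<cdot> bas i"] Up[of "t \<cdot> bas i"] that by (simp_all add: El_eq_rank1 bas_apply)
  have "El n i j t \<in> D" if ij: "i < n" "j < n" "i \<noteq> j" for i j t
  proof (cases "i = 0 \<or> j = 0")
    case False
    then have "El n i 0 t \<in> D" "El n 0 j 1 \<in> D" using El0 ij by auto
    then have "El n i 0 t \<otimes>\<^bsub>\<Gamma>\<^esub> El n 0 j 1 \<otimes>\<^bsub>\<Gamma>\<^esub> inv\<^bsub>\<Gamma>\<^esub> (El n i 0 t) \<otimes>\<^bsub>\<Gamma>\<^esub> inv\<^bsub>\<Gamma>\<^esub> (El n 0 j 1) \<in> D"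
      using D by (meson subgroup.m_closed subgroup.m_inv_closed)
    then show ?thesis using El_commutator[of i j 0 t] ij False by simp
  qed (use El0 ij in auto)
  then have "D = SLZ n" by (intro generated_by_ElS[OF D]) (auto simp: ElS_def)
  then show ?thesis using AX by (auto simp: central_mod_def D_def)
qed

lemma central_if_fixes_bas:
  assumes A: "A \<in> CC N" and e: "ap A (bas 0) = bas 0"
  shows "A \<in> central_mod K"
proof -
  have AX: "A \<in> SLZ n" and Ac: "\<And>x. vcong N (ap A x) x" using A by (auto simp: CC_def)
  \<comment> \<open>The first row of \<open>A\<close> is \<open>bas 0 - N u\<close>. Because
    \<open>A\<close> fixes \<open>bas 0\<close>, multiplying by \<open>?B\<close> on the right adds
    \<open>N u\<close> to that row.\<close>
  define u where "u = (\<lambda>j. if j = 0 then 0 else - (ap A (bas j) 0 div int N))"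
  have u: "ap A (bas j) 0 = bas 0 j - int N * u j" for j
    using Ac[of "bas j"] e by (auto simp: vcong_def bas_apply u_def dest!: spec[of _ 0])
  let ?B = "rank1 n (bas 0) (int N \<cdot> u)"
  have u0: "u 0 = 0" by (simp add: u_def)
  have B: "?B \<in> SLZ n" "?B \<in> K" using multiple_in_K(2)[where r = u] u0 by simp_all
  have Bc: "?B \<in> CC N" using B(1) by (auto simp: CC_def ap_rank1 vcong_def)
  have "ap A x 0 = x 0 - int N * dot n u x" for x
  proof -
    have "ap A x 0 = (\<Sum>j<n. (bas 0 j - int N * u j) * x j)"
      unfolding ap_sum[OF X_carrier[OF AX] n_gt(1), of x] by (simp add: u)
    also have "\<dots> = dot n (bas 0) x - int N * dot n u x"
      by (simp add: dot_def left_diff_distrib sum_subtractf sum_distrib_left mult.assoc)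
    finally show ?thesis by simp
  qed
  moreover have "ap (A * ?B) x = ap A x + (int N * dot n u x) \<cdot> bas 0" for x
    using AX B by (simp add: ap_mult_X ap_rank1 ap_linear e)
  ultimately have "A * ?B \<in> central_mod K"
    by (intro central_if_block subgroup_props(2)[OF CC_subgroup A Bc]) (auto simp: e u0 bas_apply)
  then show ?thesis using Z_cancel_right[OF K B(2) AX] by blast
qed

text \<open>With the corner exactly 1, the rest of the first column is a multiple of
  \<open>N\<close> and is cleared from the left by an element of \<open>K\<close>. A corner that is
  merely 1 modulo \<open>N\<close> would leave a remainder.\<close>

lemma central_if_coordinate_one:
  assumes A: "A \<in> CC N" and e: "ap A (bas 0) 0 = 1"
  shows "A \<in> central_mod K"
proof -
  have AX: "A \<in> SLZ n" and Ac: "vcong N (ap A (bas 0)) (bas 0)" using A by (auto simp: CC_def)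
  obtain y where yV: "y \<in> V n" and y: "ap A (bas 0) = bas 0 + int N \<cdot> y"
    by (rule vcong_obtain_V[OF Ac, of n]) (use AX in auto)
  define z where "z = - y"
  have zV: "z \<in> V n" and z: "ap A (bas 0) = bas 0 - int N \<cdot> z" using y yV by (auto simp: z_def fun_eq_iff)
  have z0: "z 0 = 0" using e z N by simp
  let ?B = "rank1 n (int N \<cdot> z) (bas 0)"
  have B: "?B \<in> SLZ n" "?B \<in> K" using multiple_in_K(3)[OF zV z0] z0 by simp_all
  have Bc: "?B \<in> CC N" using B(1) zV by (auto simp: CC_def ap_rank1 vcong_def)
  have "ap (?B * A) (bas 0) = bas 0"
    using AX B zV z z0 e by (auto simp: ap_mult_X ap_rank1 fun_eq_iff)
  then have "?B * A \<in> central_mod K"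
    by (intro central_if_fixes_bas subgroup_props(2)[OF CC_subgroup Bc A])
  then show ?thesis using Z_cancel_left[OF K B(2) AX] by blast
qed

text \<open>The first column \<open>(1 + N y, b, 0, \<dots>)\<close> is unimodular, so multiples of \<open>N\<close> of its first two
  entries put \<open>N y\<close> into the third coordinate; conjugation by an elementary matrix fixing
  \<open>bas 0\<close> then subtracts it from the first one.\<close>

lemma central_if_two_coordinates:
  assumes A: "A \<in> CC N" and v: "\<And>j. j \<ge> 2 \<Longrightarrow> ap A (bas 0) j = 0"
  shows "A \<in> central_mod K"
proof -
  note Cs = subgroup_props[OF CC_subgroup]
  have AX: "A \<in> SLZ n" and Ac: "vcong N (ap A (bas 0)) (bas 0)" using A by (auto simp: CC_def)
  let ?v = "ap A (bas 0)"
  let ?I = "inv\<^bsub>\<Gamma>\<^esub> A"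
  \<comment> \<open>Row 0 of the inverse of \<open>A\<close> multiplies the first column to 1. Only
    two entries of that column survive, which gives the Bezout relation \<open>ab\<close>.\<close>
  define a b where "a = ap ?I (bas 0) 0" and "b = ap ?I (bas 1) 0"
  have "1 = ap ?I ?v 0" using AX by simp
  also have "\<dots> = (\<Sum>j<n. ap ?I (bas j) 0 * ?v j)"
    by (rule ap_sum) (use AX inv_in X_carrier in auto)
  also have "\<dots> = (\<Sum>j\<in>{0,1}. ap ?I (bas j) 0 * ?v j)"
    by (rule sum.mono_neutral_right) (use v n_gt in \<open>auto simp: not_less_eq_eq numeral_2_eq_2\<close>)
  finally have ab: "a * ?v 0 + b * ?v 1 = 1" by (simp add: a_def b_def)
  obtain z where "?v = bas 0 + int N \<cdot> z" by (rule vcong_obtain[OF Ac])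
  moreover define y where "y = z 0"
  ultimately have y: "?v 0 = 1 + int N * y" by simp
  let ?P = "El n 2 0 (int N * (y * a))" and ?Q = "El n 2 1 (int N * (y * b))"
  have PK: "?P \<in> K" "?Q \<in> K" and PX: "?P \<in> SLZ n" "?Q \<in> SLZ n" by (auto intro!: multiple_in_K(1))
  have Pc: "?P \<in> CC N" "?Q \<in> CC N" using PX by (auto simp: CC_def vcong_def ap_El)
  let ?A = "?P * (?Q * A)"
  have A': "?A \<in> CC N" "?A \<in> SLZ n" by (intro Cs(2) Pc A) (intro X_mult PX AX)
  have v': "ap ?A (bas 0) = ?v(2 := int N * y)"
  proof -
    have "int N * (y * b) * ?v 1 + int N * (y * a) * ?v 0 = int N * y"
      using arg_cong[OF ab, of "\<lambda>t. int N * y * t"] by (simp add: algebra_simps)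
    then show ?thesis using PX AX v[of 2] by (simp add: ap_mult_X X_mult ap_El fun_eq_iff)
  qed
  let ?E = "El n 0 2 (- 1)"
  have E: "?E \<in> SLZ n" "inv\<^bsub>\<Gamma>\<^esub> ?E = El n 0 2 1" by (simp_all add: inv_El)
  have "?E * ?A * inv\<^bsub>\<Gamma>\<^esub> ?E \<in> CC N" by (rule conj_closed[OF CC_normal E(1) A'(1)])
  moreover have "ap (El n 0 2 1) (bas 0) = bas 0" by (simp add: ap_El) (simp add: bas_def fun_eq_iff)
  then have "ap (?E * ?A * inv\<^bsub>\<Gamma>\<^esub> ?E) (bas 0) 0 = 1"
    unfolding E(2) using E(1) A' v' y by (simp add: ap_mult_X X_mult ap_El)
  ultimately have "?E * ?A * inv\<^bsub>\<Gamma>\<^esub> ?E \<in> central_mod K" by (rule central_if_coordinate_one)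
  then have "?A \<in> central_mod K" using Z_conj[OF K E(1) A'(2)] by blast
  then show ?thesis using Z_cancel_left[OF K PK(1) X_mult[OF PX(2) AX]] Z_cancel_left[OF K PK(2) AX] by blast
qed

text \<open>Conjugation by an \<open>F\<close> that fixes \<open>bas 0\<close> applies
  \<open>F\<close> to the first column, so Euclid on the other coordinates leaves at most its first
  two entries.\<close>

lemma sl_csp: "CC N \<subseteq> central_mod K"
proof
  fix A assume A: "A \<in> CC N"
  then have AX: "A \<in> SLZ n" by (auto simp: CC_def)
  define v where "v = ap A (bas 0)"
  define Xs where "Xs = {ap F v | F. F \<in> SLZ n \<and> ap F (bas 0) = bas 0}"
  have cl: "euclid_closed {1..<n} Xs" unfolding euclid_closed_def
  proof (intro ballI impI allI)
    fix x i j t assume x: "x \<in> Xs" and ij: "i \<in> {1..<n}" "j \<in> {1..<n}" "i \<noteq> j"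
    obtain F where F: "F \<in> SLZ n" "ap F (bas 0) = bas 0" "x = ap F v" using x by (auto simp: Xs_def)
    have "(bas 0)(i := bas 0 i + t * bas 0 j) = bas 0" using ij by (auto simp: bas_def)
    then have "ap (El n i j t * F) (bas 0) = bas 0" "ap (El n i j t * F) v = x(i := x i + t * x j)"
      using ij F by (simp_all add: ap_mult_X ap_El)
    then show "x(i := x i + t * x j) \<in> Xs" using F ij X_mult[of "El n i j t" F] unfolding Xs_def by (auto intro!: exI[of _ "El n i j t * F"])
  qed
  have "v \<in> Xs" using X_one by (auto simp: Xs_def intro!: exI[of _ "1\<^sub>m n"])
  from euclid_vector[OF _ _ cl this, of 1] obtain F where F: "F \<in> SLZ n" "ap F (bas 0) = bas 0"
    "\<forall>i\<in>{1..<n}. i \<noteq> 1 \<longrightarrow> ap F v i = 0" by (auto simp: Xs_def)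
  have "ap (inv\<^bsub>\<Gamma>\<^esub> F) (bas 0) = bas 0" using ap_inv2[OF F(1), of "bas 0"] F(2) by simp
  then have e: "ap (F * A * inv\<^bsub>\<Gamma>\<^esub> F) (bas 0) = ap F v"
    using F(1) AX by (simp add: ap_mult_X X_mult inv_in v_def)
  have "ap F v \<in> V n" using F(1) AX by (simp add: v_def)
  then have "ap F v j = 0" if "j \<ge> 2" for j using F(3) that by (cases "j < n") (auto simp: V_def)
  then have "F * A * inv\<^bsub>\<Gamma>\<^esub> F \<in> central_mod K"
    by (intro central_if_two_coordinates conj_closed[OF CC_normal F(1) A]) (simp add: e)
  then show "A \<in> central_mod K" using Z_conj[OF K F(1) AX] by blast
qed

end

theorem congruence_family_SL:
  "congruence_family (SL_int n) CC (SL_mod n) reduce_mat"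
proof -
  have "congruence_family \<Gamma> CC (\<lambda>p. \<lparr>carrier = {A \<in> residue_mats n p. [det A = 1] (mod int p)},
      monoid.mult = (\<lambda>A B. reduce_mat p (A * B)), one = 1\<^sub>m n\<rparr>) reduce_mat"
  proof (rule congruence_familyI)
    show "\<And>p. prime p \<Longrightarrow> central_mod (CC p) \<noteq> SLZ n"
      by (rule sl_nonabelian[OF prime_gt_1_nat])
    show "\<And>p. prime p \<Longrightarrow> reduce_mat p ` SLZ n = {A \<in> residue_mats n p. [det A = 1] (mod int p)}"
      by (rule reduce_mat_image[OF prime_gt_0_nat])
  qed (fact sl_perfect sl_csp sl_almost_simple)+
  moreover have "(\<lambda>p. \<lparr>carrier = {A \<in> residue_mats n p. [det A = 1] (mod int p)},
      monoid.mult = (\<lambda>A B. reduce_mat p (A * B)), one = 1\<^sub>m n\<rparr>) = SL_mod n"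
    by (simp add: SL_mod_def fun_eq_iff)
  ultimately show ?thesis by (simp add: SL_int_def SLZ_def)
qed

end

section \<open>The symplectic group\<close>

definition om :: "nat \<Rightarrow> (nat \<Rightarrow> int) \<Rightarrow> (nat \<Rightarrow> int) \<Rightarrow> int" where
  "om g x y = (\<Sum>i<g. x i * y (g + i) - x (g + i) * y i)"

lemma om_linear [simp]:
  "om g (x + y) z = om g x z + om g y z" "om g (x - y) z = om g x z - om g y z"
  "om g (c \<cdot> x) z = c * om g x z" "om g (- x) z = - om g x z" "om g 0 z = 0"
  "om g z (x + y) = om g z x + om g z y" "om g z (x - y) = om g z x - om g z y"
  "om g z (c \<cdot> x) = c * om g z x" "om g z (- x) = - om g z x" "om g z 0 = 0"
  by (simp_all add: om_def algebra_simps sum.distrib sum_subtractf sum_distrib_left sum_negf)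

lemma om_self [simp]: "om g x x = 0"
  by (simp add: om_def mult.commute)

lemma om_swap: "om g y x = - om g x y"
  by (simp add: om_def sum_negf[symmetric] mult.commute)

lemma om_bas [simp]:
  "i < g \<Longrightarrow> om g (bas i) x = x (g + i)" "i < g \<Longrightarrow> om g (bas (g + i)) x = - x i"
  "i < g \<Longrightarrow> om g x (bas i) = - x (g + i)" "i < g \<Longrightarrow> om g x (bas (g + i)) = x i"
proof -
  have 1: "om g (bas i) x = x (g + i)" if "i < g" for i x
  proof -
    have "om g (bas i) x = (\<Sum>j<g. if j = i then x (g + j) else 0)"
      unfolding om_def using that by (intro sum.cong) (auto simp: bas_def)
    then show ?thesis using that by simp
  qed
  have 2: "om g (bas (g + i)) x = - x i" if "i < g" for i x
  proof -
    have "om g (bas (g + i)) x = (\<Sum>j<g. if j = i then - x j else 0)"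
      unfolding om_def using that by (intro sum.cong) (auto simp: bas_def)
    then show ?thesis using that by simp
  qed
  show "i < g \<Longrightarrow> om g (bas i) x = x (g + i)" "i < g \<Longrightarrow> om g (bas (g + i)) x = - x i" by (simp_all add: 1 2)
  show "i < g \<Longrightarrow> om g x (bas i) = - x (g + i)" "i < g \<Longrightarrow> om g x (bas (g + i)) = x i"
    using 1[of i x] 2[of i x] om_swap[of g x] by simp_all
qed

lemma sum_double: "(\<Sum>i<2 * g. f i) = (\<Sum>i<g. f i) + (\<Sum>i<g. f (g + i))" for f :: "nat \<Rightarrow> int"
proof -
  have "(\<Sum>i<g + m. f i) = (\<Sum>i<g. f i) + (\<Sum>i<m. f (g + i))" for m
    by (induction m) (simp_all add: algebra_simps)
  then show ?thesis by (simp add: mult_2)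
qed

lemma dot_om [simp]: "dot (2 * g) (\<lambda>j. om g u (bas j)) x = om g u x"
proof -
  have "dot (2 * g) (\<lambda>j. om g u (bas j)) x = (\<Sum>j<g. - u (g + j) * x j) + (\<Sum>j<g. u j * x (g + j))"
    unfolding dot_def sum_double by (intro arg_cong2[of _ _ _ _ "(+)"] sum.cong) simp_all
  then show ?thesis by (simp add: om_def sum_subtractf sum_negf)
qed

lemma symplectic_form_carrier [simp]: "symplectic_form g \<in> carrier_mat (2 * g) (2 * g)"
  by (simp add: symplectic_form_def mult_2)

lemma dot_symplectic_form: "dot (2 * g) x (ap (symplectic_form g) y) = om g x y"
proof -
  have J: "symplectic_form g $$ (i, j) = (if i < g then if j = g + i then 1 else 0 else if i = g + j then - 1 else 0)"
    if "i < 2 * g" "j < 2 * g" for i j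
    using that by (auto simp: symplectic_form_def)
  have "ap (symplectic_form g) y i = y (g + i)" "ap (symplectic_form g) y (g + i) = - y i" if "i < g" for i
  proof -
    note d = carrier_matD[OF symplectic_form_carrier[of g]]
    show "ap (symplectic_form g) y i = y (g + i)" "ap (symplectic_form g) y (g + i) = - y i"
      using that d by (simp_all add: ap_def J if_distrib[of "\<lambda>c. c * _"] cong: if_cong)
  qed
  then show ?thesis by (simp add: dot_def sum_double om_def sum_subtractf sum_negf)
qed

lemma dot_transpose:
  assumes A: "A \<in> carrier_mat n n"
  shows "dot n (ap A x) y = dot n x (ap (transpose_mat A) y)"
proof -
  have "dot n (ap A x) y = (\<Sum>i<n. \<Sum>j<n. A $$ (i, j) * x j * y i)"
    unfolding dot_def using A by (auto simp: ap_def sum_distrib_right intro!: sum.cong)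
  also have "\<dots> = (\<Sum>j<n. \<Sum>i<n. A $$ (i, j) * x j * y i)" by (rule sum.swap)
  also have "\<dots> = dot n x (ap (transpose_mat A) y)"
    unfolding dot_def using A by (auto simp: ap_def sum_distrib_left mult_ac intro!: sum.cong)
  finally show ?thesis .
qed

lemma om_ap:
  assumes A: "A \<in> carrier_mat (2 * g) (2 * g)"
  shows "om g (ap A x) (ap A y) = dot (2 * g) x (ap (transpose_mat A * symplectic_form g * A) y)"
proof -
  have "om g (ap A x) (ap A y) = dot (2 * g) x (ap (transpose_mat A) (ap (symplectic_form g) (ap A y)))"
    using dot_transpose[OF A] by (simp add: dot_symplectic_form[symmetric])
  also have "ap (transpose_mat A) (ap (symplectic_form g) (ap A y)) = ap (transpose_mat A * symplectic_form g * A) y"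
    using A by (simp add: ap_mult[of _ "2 * g"] mult_carrier_mat[of _ "2 * g" "2 * g"])
  finally show ?thesis .
qed

definition symplectic_mod :: "nat \<Rightarrow> nat \<Rightarrow> int mat \<Rightarrow> bool" where
  "symplectic_mod g m A \<longleftrightarrow> (\<forall>x y. int m dvd om g (ap A x) (ap A y) - om g x y)"

text \<open>Testing against basis vectors recovers the matrix of the pulled-back form, so preserving
  the form modulo \<open>m\<close> is the matrix congruence that defines
  \<open>Sp_mod\<close>.\<close>

lemma symplectic_mod_iff:
  assumes A: "A \<in> carrier_mat (2 * g) (2 * g)"
  shows "symplectic_mod g m A \<longleftrightarrow>
    reduce_mat m (transpose_mat A * symplectic_form g * A) = reduce_mat m (symplectic_form g)"
proof -
  let ?M = "transpose_mat A * symplectic_form g * A" and ?n = "2 * g"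
  have M: "?M \<in> carrier_mat ?n ?n" using A by (simp add: mult_carrier_mat[of _ ?n ?n])
  have "symplectic_mod g m A \<longleftrightarrow> (\<forall>y. vcong m (ap ?M y) (ap (symplectic_form g) y))"
  proof
    assume s: "symplectic_mod g m A"
    show "\<forall>y. vcong m (ap ?M y) (ap (symplectic_form g) y)"
    proof (unfold vcong_def, intro allI)
      fix y i
      show "int m dvd ap ?M y i - ap (symplectic_form g) y i"
      proof (cases "i < ?n")
        case True
        then show ?thesis
          using s[unfolded symplectic_mod_def, rule_format, of "bas i" y]
          unfolding om_ap[OF A] by (simp flip: dot_symplectic_form)
      qed (use M in \<open>simp add: ap_outside[of _ ?n]\<close>)
    qed
  next
    assume c: "\<forall>y. vcong m (ap ?M y) (ap (symplectic_form g) y)"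
    show "symplectic_mod g m A"
      unfolding symplectic_mod_def om_ap[OF A]
    proof (intro allI)
      fix x y
      obtain z where "ap ?M y = ap (symplectic_form g) y + int m \<cdot> z"
        using c by (meson vcong_obtain)
      then show "int m dvd dot ?n x (ap ?M y) - om g x y" by (simp add: dot_symplectic_form)
    qed
  qed
  then show ?thesis by (simp add: reduce_mat_eq_iff[OF M symplectic_form_carrier])
qed

lemma om_vcong:
  assumes "vcong m x x'" "vcong m y y'"
  shows "int m dvd om g x y - om g x' y'"
proof -
  obtain u v where "x = x' + int m \<cdot> u" "y = y' + int m \<cdot> v" using assms by (meson vcong_obtain)
  then have "om g x y - om g x' y' = int m * (om g u y' + om g x' v + int m * om g u v)"
    by (simp add: algebra_simps)
  then show ?thesis by simp
qed

definition SpZ :: "nat \<Rightarrow> int mat set" where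
  "SpZ g = {A \<in> carrier_mat (2 * g) (2 * g). \<forall>x y. om g (ap A x) (ap A y) = om g x y}"

text \<open>Level 0 of \<open>symplectic_mod_iff\<close>: as \<open>x mod 0 = x\<close>, reduction
  modulo 0 does nothing.\<close>

lemma SpZ_eq: "SpZ g = {A \<in> carrier_mat (2 * g) (2 * g). transpose_mat A * symplectic_form g * A = symplectic_form g}"
proof -
  have "reduce_mat 0 B = B" for B by (rule eq_matI) (auto simp: reduce_mat_def)
  moreover have "symplectic_mod g 0 A \<longleftrightarrow> (\<forall>x y. om g (ap A x) (ap A y) = om g x y)" for A
    by (simp add: symplectic_mod_def)
  ultimately have "(\<forall>x y. om g (ap A x) (ap A y) = om g x y) \<longleftrightarrow>
      transpose_mat A * symplectic_form g * A = symplectic_form g"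
    if "A \<in> carrier_mat (2 * g) (2 * g)" for A
    using symplectic_mod_iff[OF that, of 0] by simp
  then show ?thesis unfolding SpZ_def by blast
qed

text \<open>For \<open>\<omega>(u,w) = 0\<close> these elements form the Heisenberg group attached to \<open>u\<close>; those with \<open>w = 0\<close> are
  the symplectic transvections along \<open>u\<close>.\<close>

definition Hm :: "nat \<Rightarrow> (nat \<Rightarrow> int) \<Rightarrow> (nat \<Rightarrow> int) \<Rightarrow> int \<Rightarrow> int mat" where
  "Hm g u w t = mat (2 * g) (2 * g) (\<lambda>(i, j). (if i = j then 1 else 0) + w i * om g u (bas j)
      + u i * (om g w (bas j) + t * om g u (bas j)))"

lemma Hm_carrier [simp]: "Hm g u w t \<in> carrier_mat (2 * g) (2 * g)"
  by (simp add: Hm_def)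

lemma ap_Hm:
  assumes "u \<in> V (2 * g)" "w \<in> V (2 * g)"
  shows "ap (Hm g u w t) x = x + om g u x \<cdot> w + (om g w x + t * om g u x) \<cdot> u"
proof
  fix i
  show "ap (Hm g u w t) x i = (x + om g u x \<cdot> w + (om g w x + t * om g u x) \<cdot> u) i"
  proof (cases "i < 2 * g")
    case True
    have "ap (Hm g u w t) x i = (\<Sum>j<2 * g. (if i = j then x j else 0)
        + w i * (om g u (bas j) * x j) + u i * (om g w (bas j) * x j) + u i * t * (om g u (bas j) * x j))"
      using True by (auto simp: ap_def Hm_def algebra_simps intro!: sum.cong)
    also have "\<dots> = x i + w i * om g u x + u i * om g w x + u i * t * om g u x"
      using True dot_om[of g u x] dot_om[of g w x]
      by (simp add: sum.distrib dot_def flip: sum_distrib_left)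
    finally show ?thesis by (simp add: algebra_simps)
  next
    case False
    then show ?thesis using assms by (auto simp: ap_def Hm_def V_def)
  qed
qed

section \<open>Heisenberg elements of the integral symplectic group\<close>

locale sp =
  fixes g :: nat
  assumes g3: "3 \<le> g"
begin

abbreviation "n \<equiv> 2 * g"
abbreviation "\<omega> \<equiv> om g"
abbreviation "H \<equiv> Hm g"

text \<open>A left inverse is \<open>- J A^T J\<close>, directly from \<open>A^T J A = J\<close> and
  \<open>- J J = 1\<close>.\<close>

lemma symplectic_inverse:
  assumes "A \<in> SpZ g"
  shows "\<exists>B\<in>SpZ g. B * A = 1\<^sub>m n"
proof -
  let ?J = "symplectic_form g"
  have A: "A \<in> carrier_mat n n" and AJ: "transpose_mat A * ?J * A = ?J" using assms by (auto simp: SpZ_eq)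
  have J: "?J \<in> carrier_mat n n" by simp
  have apJ: "ap ?J y i = y (g + i)" "ap ?J y (g + i) = - y i" if "i < g" for y i
  proof -
    show "ap ?J y i = y (g + i)" using dot_symplectic_form[of g "bas i" y] that by simp
    show "ap ?J y (g + i) = - y i" using dot_symplectic_form[of g "bas (g + i)" y] that by simp
  qed
  have JJ: "ap (- ?J) (ap ?J x) = x" if "x \<in> V n" for x
  proof
    fix i
    have neg: "ap (- ?J) y i = - ap ?J y i" if "i < n" for y
      using that carrier_matD[OF J] by (auto simp: ap_def sum_negf[symmetric] intro!: sum.cong)
    consider "i < g" | k where "k < g" "i = g + k" | "i \<ge> n"
      by (metis le_add_diff_inverse linorder_not_le mult_2 nat_add_left_cancel_less)
    then show "ap (- ?J) (ap ?J x) i = x i"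
    proof cases
      case 3
      then show ?thesis using carrier_matD[OF J] by (auto simp: ap_def)
    qed (use neg apJ in auto)
  qed
  define B where "B = (- ?J) * (transpose_mat A * ?J)"
  have B: "B \<in> carrier_mat n n" using A J by (simp add: B_def mult_carrier_mat[of _ n n])
  have BA: "B * A = 1\<^sub>m n"
  proof (rule ap_eqI)
    show "B * A \<in> carrier_mat n n" using A B by (simp add: mult_carrier_mat[of _ n n])
    fix j assume j: "j < n"
    have "ap (B * A) (bas j) = ap (- ?J) (ap (transpose_mat A * ?J * A) (bas j))"
      using A B J by (simp add: ap_mult[of _ n] B_def mult_carrier_mat[of _ n n])
    then show "ap (B * A) (bas j) = ap (1\<^sub>m n) (bas j)" using j JJ by (simp add: AJ)
  qed simp
  \<comment> \<open>That \<open>B\<close> preserves the form follows from \<open>A * B = 1\<close>.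
    Since \<open>det A\<close> is a sign, \<open>det A\<close> times the adjugate is a right inverse
    of \<open>A\<close>, and it must coincide with the left inverse \<open>B\<close>.\<close>
  define E where "E = det A \<cdot>\<^sub>m adj_mat A"
  have E: "E \<in> carrier_mat n n" using adj_mat(1)[OF A] by (simp add: E_def)
  have "det B * det A = 1" using det_mult[OF B A] BA by simp
  then have dd: "det A * det A = 1" by (metis zmult_eq_1_iff mult_1 mult_minus_left minus_minus)
  have "A * E = det A \<cdot>\<^sub>m (A * adj_mat A)" unfolding E_def by (rule mult_smult_distrib[OF A adj_mat(1)[OF A]])
  also have "\<dots> = 1\<^sub>m n" unfolding adj_mat(2)[OF A] by (rule eq_matI) (auto simp: dd)
  finally have AE: "A * E = 1\<^sub>m n" .
  have "B = B * (A * E)" using B by (simp add: AE)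
  also have "\<dots> = E" using assoc_mult_mat[OF B A E] BA E by simp
  finally have "A * B = 1\<^sub>m n" using AE by simp
  then have AB: "ap A (ap B x) = x" for x using ap_mult[OF A B, of x] by simp
  have "\<omega> (ap B x) (ap B y) = \<omega> x y" for x y
    using assms AB[of x] AB[of y] unfolding SpZ_def by (metis (mono_tags, lifting) mem_Collect_eq)
  then have "B \<in> SpZ g" using B by (simp add: SpZ_def)
  then show ?thesis using BA by blast
qed

sublocale matgroup n "SpZ g"
proof
  show "\<exists>B\<in>SpZ g. B * A = 1\<^sub>m n" if "A \<in> SpZ g" for A using symplectic_inverse[OF that] .
qed (auto simp: SpZ_def ap_mult[of _ n])

lemma om_inv: "A \<in> SpZ g \<Longrightarrow> \<omega> (ap A x) (ap A y) = \<omega> x y"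
  by (simp add: SpZ_def)

lemma om_inv1: "A \<in> SpZ g \<Longrightarrow> \<omega> (ap A x) y = \<omega> x (ap (inv\<^bsub>\<Gamma>\<^esub> A) y)"
  using om_inv[of A x "ap (inv\<^bsub>\<Gamma>\<^esub> A) y"] by simp

lemma g_gt [simp]: "0 < g" "Suc 0 < g" "2 < g" "Suc (Suc 0) < g" "g \<noteq> 0" "g \<noteq> Suc 0"
  "Suc 0 < 2 * g" "Suc (Suc 0) < 2 * g" "Suc g < 2 * g"
  using g3 by auto

lemma om_bas_g [simp]:
  "\<omega> (bas g) x = - x 0" "\<omega> x (bas g) = x 0"
  "\<omega> (bas (Suc g)) x = - x (Suc 0)" "\<omega> x (bas (Suc g)) = x (Suc 0)"
  using om_bas(2,4)[of 0 g x] om_bas(2,4)[of 1 g x] by simp_all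

lemma H_in_SpZ:
  assumes "u \<in> V n" "w \<in> V n" "\<omega> u w = 0"
  shows "H u w t \<in> SpZ g"
proof -
  have "\<omega> (ap (H u w t) x) (ap (H u w t) y) = \<omega> x y" for x y
    using assms om_swap[of g u w] om_swap[of g x u] om_swap[of g x w]
    by (simp add: ap_Hm algebra_simps)
  then show ?thesis by (simp add: SpZ_def)
qed

text \<open>The Heisenberg group law: the vectors add up, and the last parameter picks up the
  cocycle \<open>\<omega> w w'\<close>.\<close>

lemma H_comp:
  assumes "u \<in> V n" "w \<in> V n" "w' \<in> V n" "\<omega> u w = 0" "\<omega> u w' = 0"
  shows "ap (H u w t) (ap (H u w' t') x) = ap (H u (w + w') (t + t' + \<omega> w w')) x"
  using assms om_swap[of g u w] by (simp add: ap_Hm fun_eq_iff algebra_simps)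

lemma H_mult:
  assumes "u \<in> V n" "w \<in> V n" "w' \<in> V n" "\<omega> u w = 0" "\<omega> u w' = 0"
  shows "H u w t * H u w' t' = H u (w + w') (t + t' + \<omega> w w')"
  by (rule X_eqI) (use assms in \<open>simp_all add: X_mult H_in_SpZ ap_mult_X H_comp\<close>)

lemma H_zero: "u \<in> V n \<Longrightarrow> H u 0 0 = 1\<^sub>m n"
  by (rule X_eqI) (simp_all add: H_in_SpZ X_one ap_Hm)

lemma H_inv:
  assumes "u \<in> V n" "w \<in> V n" "\<omega> u w = 0"
  shows "inv\<^bsub>\<Gamma>\<^esub> (H u w t) = H u (- w) (- t)"
  by (rule inv_equality) (use assms in \<open>simp_all add: H_in_SpZ H_mult H_zero\<close>)

lemma H_pow:
  assumes "u \<in> V n" "w \<in> V n" "\<omega> u w = 0"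
  shows "H u w t [^]\<^bsub>\<Gamma>\<^esub> k = H u (int k \<cdot> w) (int k * t)"
  using ap_eq_imp_pow[of "\<lambda>k. H u (int k \<cdot> w) (int k * t)" k] assms om_swap[of g u w]
  by (simp add: H_in_SpZ ap_Hm) (simp add: ap_Hm fun_eq_iff algebra_simps)

lemma H_conj:
  assumes "A \<in> SpZ g" "u \<in> V n" "w \<in> V n" "\<omega> u w = 0"
  shows "A * H u w t * inv\<^bsub>\<Gamma>\<^esub> A = H (ap A u) (ap A w) t"
  by (rule X_eqI) (use assms in \<open>simp_all add: X_mult H_in_SpZ inv_in ap_mult_X om_inv ap_Hm ap_linear om_inv1\<close>)

text \<open>Conjugation by \<open>A\<close> only replaces \<open>w\<close> by \<open>ap A w\<close>,
  and the group law does the rest. For \<open>A\<close> in \<open>CC N\<close> both new parameters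
  are divisible by \<open>N\<close>, since
  \<open>\<omega> (ap A w) w = \<omega> (ap A w - w) w\<close>. For explicit \<open>A\<close> the
  formula supplies the commutators behind perfectness.\<close>

lemma H_commutator:
  assumes "A \<in> SpZ g" "u \<in> V n" "w \<in> V n" "\<omega> u w = 0" and fixu: "ap A u = u"
  shows "A \<otimes>\<^bsub>\<Gamma>\<^esub> H u w t \<otimes>\<^bsub>\<Gamma>\<^esub> inv\<^bsub>\<Gamma>\<^esub> A \<otimes>\<^bsub>\<Gamma>\<^esub> inv\<^bsub>\<Gamma>\<^esub> (H u w t) = H u (ap A w - w) (- \<omega> (ap A w) w)"
proof -
  have uw: "\<omega> u (ap A w) = 0" using om_inv[OF assms(1), of u w] assms by simp
  have "A * H u w t * inv\<^bsub>\<Gamma>\<^esub> A * inv\<^bsub>\<Gamma>\<^esub> (H u w t) = H u (ap A w) t * H u (- w) (- t)"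
    using H_conj[OF assms(1-4)] fixu assms by (simp add: H_inv)
  also have "\<dots> = H u (ap A w - w) (- \<omega> (ap A w) w)"
    using H_mult[of u "ap A w" "- w"] assms uw by simp
  finally show ?thesis by simp
qed

definition HS :: "int mat set" where
  "HS = {H (bas b) w t | b w t. b < n \<and> w \<in> V n \<and> \<omega> (bas b) w = 0}"

lemma HS_subset: "HS \<subseteq> SpZ g"
  by (auto simp: HS_def H_in_SpZ)

lemma HS_I: "b < n \<Longrightarrow> w \<in> V n \<Longrightarrow> \<omega> (bas b) w = 0 \<Longrightarrow> H (bas b) w t \<in> HS"
  unfolding HS_def by blast

definition fixes_below :: "nat \<Rightarrow> int mat \<Rightarrow> bool" where
  "fixes_below k F \<longleftrightarrow> (\<forall>j<k. ap F (bas j) = bas j \<and> ap F (bas (g + j)) = bas (g + j))"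

lemma index_cases:
  obtains "i < g" | j where "j < g" "i = g + j" | "i \<ge> n"
  by (metis le_add_diff_inverse linorder_not_le mult_2 nat_add_left_cancel_less)

section \<open>Symplectic reduction of vectors and lifting modulo \<open>m\<close>\<close>

context
  fixes D :: "int mat set"
  assumes D: "subgroup D \<Gamma>" "HS \<subseteq> D"
begin

lemma D_subset: "F \<in> D \<Longrightarrow> F \<in> SpZ g"
  using subgroup_props(4)[OF D(1)] by blast

definition orbit :: "nat \<Rightarrow> (nat \<Rightarrow> int) \<Rightarrow> (nat \<Rightarrow> int) set" where
  "orbit k v = {ap F v | F. F \<in> D \<and> fixes_below k F}"

lemma orbit_step:
  assumes x: "x \<in> orbit k v" and E: "E \<in> HS" "fixes_below k E"
  shows "ap E x \<in> orbit k v"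
proof -
  obtain F where F: "F \<in> D" "fixes_below k F" "x = ap F v" using x by (auto simp: orbit_def)
  have ED: "E \<in> D" using E D(2) by blast
  have "ap (E * F) y = ap E (ap F y)" for y using ED F D_subset by (simp add: ap_mult_X)
  then show ?thesis using subgroup_props(2)[OF D(1) ED F(1)] F E(2)
    unfolding orbit_def by (auto simp: fixes_below_def intro!: exI[of _ "E * F"])
qed

lemma orbit_plane1:
  assumes x: "x \<in> orbit k v" and i: "k \<le> i" "i < g"
  shows "x(i := x i + t * x (g + i)) \<in> orbit k v"
proof -
  have "ap (H (bas i) 0 t) x = x(i := x i + t * x (g + i))"
    using i by (simp add: ap_Hm fun_eq_iff bas_apply)
  moreover have "fixes_below k (H (bas i) 0 t)"
    using i by (auto simp: fixes_below_def ap_Hm bas_apply)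
  ultimately show ?thesis using orbit_step[OF x HS_I, of i 0 t] i by simp
qed

lemma orbit_plane2:
  assumes x: "x \<in> orbit k v" and i: "k \<le> i" "i < g"
  shows "x(g + i := x (g + i) + t * x i) \<in> orbit k v"
proof -
  have "ap (H (bas (g + i)) 0 (- t)) x = x(g + i := x (g + i) + t * x i)"
    using i by (simp add: ap_Hm fun_eq_iff bas_apply)
  moreover have "fixes_below k (H (bas (g + i)) 0 (- t))"
    using i by (auto simp: fixes_below_def ap_Hm bas_apply)
  ultimately show ?thesis using orbit_step[OF x HS_I, of "g + i" 0 "- t"] i by simp
qed

text \<open>The transvections along \<open>bas i\<close> and \<open>bas (g + i)\<close> act on this
  plane as the two kinds of elementary 2 by 2 matrices and touch no other coordinate.\<close>

lemma orbit_plane_closed: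
  assumes "k \<le> i" "i < g"
  shows "euclid_closed {i, g + i} (orbit k v)"
  unfolding euclid_closed_def using orbit_plane1 orbit_plane2 assms by auto

text \<open>A short root element: preserving the form forces the compensating change in coordinate
  \<open>g + j\<close>.\<close>

lemma orbit_short:
  assumes x: "x \<in> orbit k v" and ij: "k \<le> i" "i < g" "k \<le> j" "j < g" "i \<noteq> j"
  shows "x(i := x i + t * x j, g + j := x (g + j) - t * x (g + i)) \<in> orbit k v"
proof -
  let ?w = "(- t) \<cdot> bas (g + j)"
  have w: "?w \<in> V n" "\<omega> (bas i) ?w = 0" using ij by (simp_all add: bas_apply)
  have "ap (H (bas i) ?w 0) x = x(i := x i + t * x j, g + j := x (g + j) - t * x (g + i))"
    using ij w by (auto simp: ap_Hm fun_eq_iff bas_apply)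
  moreover have "fixes_below k (H (bas i) ?w 0)"
    using ij w by (auto simp: fixes_below_def ap_Hm bas_apply)
  ultimately show ?thesis using orbit_step[OF x HS_I, of i ?w 0] ij w by simp
qed

text \<open>Euclid is applied plane by plane. The clause on divisors, that common divisors of the
  new entries divide the old ones, is what remains of the gcd and survives composition of the
  steps.\<close>

lemma kill_second_half:
  assumes "finite J" "J \<subseteq> {k..<g}"
  shows "\<exists>y\<in>orbit k v. (\<forall>j\<in>J. y (g + j) = 0) \<and> (\<forall>j<k. y j = v j \<and> y (g + j) = v (g + j)) \<and>
    (\<forall>d. (\<forall>j\<in>{k..<g}. d dvd y j \<and> d dvd y (g + j)) \<longrightarrow> (\<forall>j\<in>{k..<g}. d dvd v j \<and> d dvd v (g + j)))"
  using assms
proof (induction J)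
  case empty
  have "v \<in> orbit k v" using subgroup_props(1)[OF D(1)]
    by (auto simp: orbit_def fixes_below_def intro!: exI[of _ "1\<^sub>m n"])
  then show ?case by auto
next
  case (insert i J)
  then obtain y where y: "y \<in> orbit k v" "\<forall>j\<in>J. y (g + j) = 0"
    "\<forall>j<k. y j = v j \<and> y (g + j) = v (g + j)"
    "\<forall>d. (\<forall>j\<in>{k..<g}. d dvd y j \<and> d dvd y (g + j)) \<longrightarrow> (\<forall>j\<in>{k..<g}. d dvd v j \<and> d dvd v (g + j))"
    by auto
  have i: "k \<le> i" "i < g" using insert by auto
  obtain w where w: "w \<in> orbit k v" "w (g + i) = 0" "\<forall>l. l \<noteq> i \<longrightarrow> l \<noteq> g + i \<longrightarrow> w l = y l"
    "w i dvd y i" "w i dvd y (g + i)"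
    using euclid_vector[OF _ _ orbit_plane_closed[OF i] y(1), of i] i by auto
  have wy: "w j = y j" "w (g + j) = y (g + j)" if "j \<noteq> i" "j < g" for j
    using w(3) i that by auto
  have dy: "\<forall>j\<in>{k..<g}. d dvd y j \<and> d dvd y (g + j)" if d: "\<forall>j\<in>{k..<g}. d dvd w j \<and> d dvd w (g + j)" for d
  proof
    fix j assume j: "j \<in> {k..<g}"
    show "d dvd y j \<and> d dvd y (g + j)"
    proof (cases "j = i")
      case True
      then show ?thesis using d j w(4,5) dvd_trans by blast
    next
      case False
      have "d dvd w j \<and> d dvd w (g + j)" using d j by blast
      then show ?thesis using wy[OF False] j by simp
    qed
  qed
  have "\<forall>d. (\<forall>j\<in>{k..<g}. d dvd w j \<and> d dvd w (g + j)) \<longrightarrow> (\<forall>j\<in>{k..<g}. d dvd v j \<and> d dvd v (g + j))"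
  proof (intro allI impI)
    fix d assume d: "\<forall>j\<in>{k..<g}. d dvd w j \<and> d dvd w (g + j)"
    show "\<forall>j\<in>{k..<g}. d dvd v j \<and> d dvd v (g + j)" using y(4) dy[OF d] by simp
  qed
  moreover have "\<forall>j\<in>insert i J. w (g + j) = 0"
  proof
    fix j assume "j \<in> insert i J"
    then show "w (g + j) = 0" using w(2) y(2) wy(2)[of j] insert.prems by (cases "j = i") auto
  qed
  moreover have "\<forall>j<k. w j = v j \<and> w (g + j) = v (g + j)" using y(3) wy i by simp
  ultimately show ?case using w(1) by (intro bexI[of _ w]) simp_all
qed

lemma vector_reduction:
  assumes k: "k < g"
  shows "\<exists>w\<in>orbit k v. (\<forall>j\<in>{k..<g}. w (g + j) = 0) \<and> (\<forall>j\<in>{k<..<g}. w j = 0) \<and>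
    (\<forall>j<k. w j = v j \<and> w (g + j) = v (g + j)) \<and> (\<forall>j\<in>{k..<g}. w k dvd v j \<and> w k dvd v (g + j))"
proof -
  obtain y where y: "y \<in> orbit k v" "\<forall>j\<in>{k..<g}. y (g + j) = 0" "\<forall>j<k. y j = v j \<and> y (g + j) = v (g + j)"
    "\<forall>d. (\<forall>j\<in>{k..<g}. d dvd y j \<and> d dvd y (g + j)) \<longrightarrow> (\<forall>j\<in>{k..<g}. d dvd v j \<and> d dvd v (g + j))"
    using kill_second_half[of "{k..<g}" k v] by auto
  \<comment> \<open>On vectors with vanishing second half the compensation in
    \<open>orbit_short\<close> is zero, so the first half admits all elementary operations.\<close>
  define O2 where "O2 = {x \<in> orbit k v. \<forall>j\<in>{k..<g}. x (g + j) = 0}"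
  have "euclid_closed {k..<g} O2" unfolding euclid_closed_def
  proof (intro ballI allI impI)
    fix x i j t assume x: "x \<in> O2" and ij: "i \<in> {k..<g}" "j \<in> {k..<g}" "i \<noteq> j"
    have "x(i := x i + t * x j, g + j := x (g + j) - t * x (g + i)) \<in> orbit k v"
      using x ij by (intro orbit_short) (auto simp: O2_def)
    moreover have "x(i := x i + t * x j, g + j := x (g + j) - t * x (g + i)) = x(i := x i + t * x j)"
      using x ij by (auto simp: O2_def fun_eq_iff)
    ultimately show "x(i := x i + t * x j) \<in> O2" using x ij by (auto simp: O2_def)
  qed
  moreover have "y \<in> O2" using y by (simp add: O2_def)
  ultimately obtain w where w: "w \<in> O2" "\<forall>i\<in>{k..<g}. i \<noteq> k \<longrightarrow> w i = 0" "\<forall>i. i \<notin> {k..<g} \<longrightarrow> w i = y i"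
    "\<forall>i\<in>{k..<g}. w k dvd y i"
    using euclid_vector[of "{k..<g}" k O2 y] k by auto
  have "\<forall>j\<in>{k..<g}. w k dvd v j \<and> w k dvd v (g + j)" using y(2,4) w(4) by auto
  then show ?thesis using w y(3) by (intro bexI[of _ w]) (auto simp: O2_def)
qed

text \<open>Every pivot \<open>k\<close> has its partner \<open>g + k\<close> as auxiliary
  coordinate for \<open>euclid_unit\<close>, so the last pivot needs no separate argument, unlike in
  the linear case. Coordinates below \<open>k\<close> are out of reach of isometries that fix the
  first \<open>k\<close> pairs.\<close>

lemma column_reduction:
  assumes k: "k < g" and v: "v \<in> V n"
    and r: "int m dvd r - 1"
      "\<And>d. (\<And>j. k \<le> j \<Longrightarrow> j < g \<Longrightarrow> d dvd v j \<and> d dvd v (g + j)) \<Longrightarrow> d dvd r"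
  obtains F where "F \<in> D" "fixes_below k F" "int m dvd ap F v k - 1"
    "\<And>j. k < j \<Longrightarrow> j < g \<Longrightarrow> int m dvd ap F v j" "\<And>j. k \<le> j \<Longrightarrow> j < g \<Longrightarrow> int m dvd ap F v (g + j)"
    "\<And>j. j < k \<Longrightarrow> ap F v j = v j" "\<And>j. j < k \<Longrightarrow> ap F v (g + j) = v (g + j)"
proof -
  obtain w where w: "w \<in> orbit k v" "\<forall>j\<in>{k..<g}. w (g + j) = 0" "\<forall>j\<in>{k<..<g}. w j = 0"
    "\<forall>j<k. w j = v j \<and> w (g + j) = v (g + j)" "\<forall>j\<in>{k..<g}. w k dvd v j \<and> w k dvd v (g + j)"
    using vector_reduction[OF k] by blast
  have "w k dvd r" by (rule r(2)) (use w in auto)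
  then obtain x where x: "x \<in> orbit k v" "int m dvd x k - 1" "int m dvd x (g + k)"
    "\<forall>i. i \<noteq> k \<longrightarrow> i \<noteq> g + k \<longrightarrow> x i = w i"
    using euclid_unit[OF _ _ _ orbit_plane_closed[of k k] w(1) _ r(1), of k "g + k"] k w(2) by auto
  obtain F where F: "F \<in> D" "fixes_below k F" "x = ap F v" using x by (auto simp: orbit_def)
  show ?thesis
  proof (rule that[OF F(1,2)])
    show "int m dvd ap F v (g + j)" if "k \<le> j" "j < g" for j
      using x w F that k by (cases "j = k") auto
  qed (use x w F k in auto)
qed

text \<open>A Heisenberg element along \<open>bas k\<close> fixes \<open>bas k\<close>, and its
  parameters are solved from \<open>y\<close>: \<open>w\<close> cancels the components of
  \<open>y\<close> in the later planes, and \<open>t\<close> cancels coordinate \<open>k\<close>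
  together with the contribution \<open>\<omega> w y\<close>. The pivot \<open>y (g + k)\<close> is
  1 only modulo \<open>m\<close>, so the result is a congruence.\<close>

lemma complete_hyperbolic_pair:
  assumes k: "k < g" and y: "int m dvd y (g + k) - 1"
    "\<And>j. j < k \<Longrightarrow> int m dvd y j \<and> int m dvd y (g + j)" "y \<in> V n"
  obtains E where "E \<in> D" "fixes_below k E" "ap E (bas k) = bas k" "vcong m (ap E y) (bas (g + k))"
proof
  define w where "w = (\<lambda>i. if k < i \<and> i < g \<or> g + k < i \<and> i < n then - y i else 0)"
  define t where "t = - y k - \<omega> w y"
  define E where "E = H (bas k) w t"
  have w: "w \<in> V n" "\<omega> (bas k) w = 0" using k by (auto simp: w_def V_def)
  have E: "ap E x = x + \<omega> (bas k) x \<cdot> w + (\<omega> w x + t * \<omega> (bas k) x) \<cdot> bas k" for x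
    unfolding E_def using w k by (intro ap_Hm) auto
  show "E \<in> D" using HS_I[OF _ w] k D(2) by (auto simp: E_def)
  show "fixes_below k E" using k by (auto simp: fixes_below_def E bas_apply w_def)
  show "ap E (bas k) = bas k" using k by (simp add: E bas_apply w_def)
  show "vcong m (ap E y) (bas (g + k))" unfolding vcong_def
  proof
    fix i
    have yk: "int m dvd (y (g + k) - 1) * c" for c using y(1) by simp
    have gen: "ap E y i = y i + y (g + k) * w i + (\<omega> w y + t * y (g + k)) * bas k i" for i
      using k by (simp add: E)
    consider "i = k" | "i = g + k" | "i < k" | j where "j < k" "i = g + j" | "k < i \<and> i < g \<or> g + k < i \<and> i < n" | "i \<ge> n"
      using k by (metis le_add_diff_inverse linorder_neqE_nat linorder_not_le nat_add_left_cancel_less)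
    then show "int m dvd ap E y i - bas (g + k) i"
    proof cases
      case 1
      then have "ap E y i - bas (g + k) i = (y (g + k) - 1) * (- y k - \<omega> w y)"
        using k unfolding gen by (simp add: w_def bas_apply t_def algebra_simps)
      then show ?thesis using yk by simp
    next
      case 5
      then have "ap E y i - bas (g + k) i = (y (g + k) - 1) * (- y i)"
        using k unfolding gen by (auto simp: w_def bas_apply algebra_simps)
      then show ?thesis using yk by simp
    qed (use k y in \<open>auto simp: gen w_def bas_apply V_def\<close>)
  qed
qed

text \<open>Hyperbolic pairs are normalised one at a time: \<open>E\<close> brings the image of
  \<open>bas k\<close> into place, then \<open>G\<close> fixes \<open>bas k\<close> and brings in
  the image of \<open>bas (g + k)\<close>.\<close>

lemma lift_mod:
  assumes A: "A \<in> carrier_mat n n" "symplectic_mod g m A"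
  shows "\<exists>F\<in>D. \<forall>x. vcong m (ap F x) (ap A x)"
proof -
  note D' = subgroup_props[OF D(1)]
  have "\<exists>F\<in>D. \<forall>j<k. vcong m (ap F (ap A (bas j))) (bas j) \<and> vcong m (ap F (ap A (bas (g + j)))) (bas (g + j))"
    if "k \<le> g" for k
    using that
  proof (induction k)
    case 0
    show ?case using D'(1) by blast
  next
    case (Suc k)
    then have k: "k < g" by simp
    from Suc obtain F where F: "F \<in> D" and F': "\<And>j. j < k \<Longrightarrow> vcong m (ap F (ap A (bas j))) (bas j)"
      "\<And>j. j < k \<Longrightarrow> vcong m (ap F (ap A (bas (g + j)))) (bas (g + j))" by auto
    have FX: "F \<in> SpZ g" using F D_subset by blast
    define L where "L x = ap F (ap A x)" for x
    have LV: "L x \<in> V n" if "x \<in> V n" for x using that FX A by (simp add: L_def)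
    have om: "int m dvd \<omega> (L x) (L y) - \<omega> x y" for x y
      using A(2) om_inv[OF FX] by (simp add: L_def symplectic_mod_def)
    \<comment> \<open>The new pair is orthogonal modulo \<open>m\<close> to the finished ones, and
      these are already basis vectors modulo \<open>m\<close>; so its lower coordinates vanish
      modulo \<open>m\<close>.\<close>
    have below: "int m dvd L x j" "int m dvd L x (g + j)"
      if "j < k" "x = bas k \<or> x = bas (g + k)" for x j
    proof -
      have 1: "int m dvd \<omega> (L (bas j)) (L x) - \<omega> (bas j) (L x)"
        unfolding L_def using F'(1)[OF that(1)] by (intro om_vcong vcong_refl)
      have 2: "int m dvd \<omega> (L (bas (g + j))) (L x) - \<omega> (bas (g + j)) (L x)"
        unfolding L_def using F'(2)[OF that(1)] by (intro om_vcong vcong_refl)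
      have "\<omega> (bas j) x = 0" "\<omega> (bas (g + j)) x = 0" using that k by (auto simp: bas_apply)
      then have "int m dvd \<omega> (bas j) (L x)" "int m dvd \<omega> (bas (g + j)) (L x)"
        using dvd_diff[OF om[of "bas j" x] 1] dvd_diff[OF om[of "bas (g + j)" x] 2] by simp_all
      then show "int m dvd L x j" "int m dvd L x (g + j)" using that k by auto
    qed
    define v y where "v = L (bas k)" and "y = L (bas (g + k))"
    \<comment> \<open>The share of the unfinished planes in \<open>\<omega> v y\<close>. It is 1
      modulo \<open>m\<close> and a combination of the remaining entries of \<open>v\<close>, which
      is the unimodularity that \<open>column_reduction\<close> asks for.\<close>
    define r where "r = (\<Sum>j=k..<g. v j * y (g + j) - v (g + j) * y j)"
    have s0: "\<omega> v y = (\<Sum>j<k. v j * y (g + j) - v (g + j) * y j) + r"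
      unfolding om_def r_def by (subst sum.union_disjoint[symmetric]) (use k in \<open>auto intro!: sum.cong\<close>)
    have s1: "int m dvd (\<Sum>j<k. v j * y (g + j) - v (g + j) * y j)"
      using below by (auto simp: v_def intro!: dvd_sum)
    have s2: "int m dvd \<omega> v y - 1" using om[of "bas k" "bas (g + k)"] k by (simp add: v_def y_def bas_apply)
    have r: "int m dvd r - 1" using dvd_diff[OF s2 s1] s0 by simp
    have vV: "v \<in> V n" using k by (simp add: v_def LV)
    obtain E where E: "E \<in> D" "fixes_below k E" "int m dvd ap E v k - 1"
      "\<And>j. k < j \<Longrightarrow> j < g \<Longrightarrow> int m dvd ap E v j" "\<And>j. k \<le> j \<Longrightarrow> j < g \<Longrightarrow> int m dvd ap E v (g + j)"
      "\<And>j. j < k \<Longrightarrow> ap E v j = v j" "\<And>j. j < k \<Longrightarrow> ap E v (g + j) = v (g + j)"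
      by (rule column_reduction[OF k vV r]) (auto simp: r_def intro!: dvd_sum)
    have EX: "E \<in> SpZ g" using E D_subset by blast
    have Ev: "vcong m (ap E v) (bas k)" unfolding vcong_def
    proof
      fix i
      show "int m dvd ap E v i - bas k i"
      proof (cases i rule: index_cases)
        case 1
        consider "i < k" | "i = k" | "k < i" by linarith
        then show ?thesis by cases (use 1 E below in \<open>auto simp: bas_apply v_def\<close>)
      next
        case (2 j)
        then show ?thesis using E(5)[of j] E(7)[of j] below(2)[of j] k by (cases "j < k") (auto simp: bas_apply v_def)
      next
        case 3
        then show ?thesis using ap_X_in_V[OF EX vV] k by (auto simp: V_def bas_apply)
      qed
    qed
    define z where "z = ap E y"
    have yV: "y \<in> V n" using k by (simp add: y_def LV)
    have om': "int m dvd \<omega> (ap E (L x)) (ap E (L x')) - \<omega> x x'" for x x' using om om_inv[OF EX] by simp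
    have z1: "int m dvd \<omega> (ap E v) z - \<omega> (bas k) z" by (rule om_vcong[OF Ev vcong_refl])
    have z2: "int m dvd \<omega> (ap E v) z - 1" using om'[of "bas k" "bas (g + k)"] k
      by (simp add: v_def y_def z_def bas_apply)
    have zk: "int m dvd z (g + k) - 1" using dvd_diff[OF z2 z1] k by simp
    have Efix: "ap E (bas j) = bas j" "ap E (bas (g + j)) = bas (g + j)" if "j < k" for j
      using E(2) that by (auto simp: fixes_below_def)
    have zj: "int m dvd z j \<and> int m dvd z (g + j)" if "j < k" for j
    proof -
      have "\<omega> (bas j) z = \<omega> (bas j) y" "\<omega> (bas (g + j)) z = \<omega> (bas (g + j)) y"
        using om_inv[OF EX, of "bas j" y] om_inv[OF EX, of "bas (g + j)" y] Efix[OF that] by (simp_all add: z_def)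
      then show ?thesis using that k below[OF that, of "bas (g + k)"] by (simp add: y_def)
    qed
    obtain G where G: "G \<in> D" "fixes_below k G" "ap G (bas k) = bas k" "vcong m (ap G z) (bas (g + k))"
      by (rule complete_hyperbolic_pair[OF k zk zj]) (use EX yV in \<open>auto simp: z_def\<close>)
    have GX: "G \<in> SpZ g" using G D_subset by blast
    let ?F = "G * E * F"
    have apF: "ap ?F (ap A x) = ap G (ap E (L x))" for x
      using GX EX FX by (simp add: ap_mult_X X_mult L_def)
    have "vcong m (ap ?F (ap A (bas j))) (bas j) \<and> vcong m (ap ?F (ap A (bas (g + j)))) (bas (g + j))" if "j < Suc k" for j
    proof (cases "j = k")
      case True
      then show ?thesis using apF G(3,4) ap_vcong[OF Ev, of G] by (simp add: z_def y_def v_def)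
    next
      case False
      then have j: "j < k" using that by simp
      have "ap G (ap E (bas j)) = bas j" "ap G (ap E (bas (g + j))) = bas (g + j)"
        using Efix[OF j] G(2) j by (auto simp: fixes_below_def)
      then show ?thesis
        using ap_vcong[OF ap_vcong[OF F'(1)[OF j], of E], of G] ap_vcong[OF ap_vcong[OF F'(2)[OF j], of E], of G] apF
        by (simp add: L_def)
    qed
    moreover have "?F \<in> D" by (intro D' G E F)
    ultimately show ?case by blast
  qed
  from this[of g] obtain F where F: "F \<in> D" and F': "\<And>j. j < g \<Longrightarrow> vcong m (ap F (ap A (bas j))) (bas j)"
    "\<And>j. j < g \<Longrightarrow> vcong m (ap F (ap A (bas (g + j)))) (bas (g + j))" by auto
  have FX: "F \<in> SpZ g" using F D_subset by blast
  have "vcong m (ap (inv\<^bsub>\<Gamma>\<^esub> F) x) (ap A x)" for x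
  proof (rule ap_congI[OF _ A(1)])
    show "inv\<^bsub>\<Gamma>\<^esub> F \<in> carrier_mat n n" using inv_in[OF FX] X_carrier by blast
    show "vcong m (ap (inv\<^bsub>\<Gamma>\<^esub> F) (bas j)) (ap A (bas j))" if "j < n" for j
    proof -
      have "vcong m (ap F (ap A (bas j))) (bas j)"
        using that by (cases j rule: index_cases) (use F' in auto)
      from vcong_sym[OF ap_vcong[OF this, of "inv\<^bsub>\<Gamma>\<^esub> F"]] show ?thesis using FX by simp
    qed
  qed
  then show ?thesis using D'(3)[OF F] by blast
qed

lemma generated_by_HS: "D = SpZ g"
proof
  show "SpZ g \<subseteq> D"
  proof
    fix A assume A: "A \<in> SpZ g"
    then obtain F where F: "F \<in> D" "\<forall>x. vcong 0 (ap F x) (ap A x)"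
      using lift_mod[of A 0] by (auto simp: SpZ_def symplectic_mod_def)
    then have "F = A" using A D_subset by (intro X_eqI) auto
    then show "A \<in> D" using F by simp
  qed
qed (use D_subset in blast)

end

lemma self_subgroup: "subgroup (SpZ g) \<Gamma>"
  using subgroup_self by simp

lemma reduce_mat_image:
  assumes p: "p > 0"
  shows "reduce_mat p ` SpZ g = {A \<in> residue_mats n p.
       reduce_mat p (transpose_mat A * symplectic_form g * A) = reduce_mat p (symplectic_form g)}"
proof (intro equalityI subsetI)
  fix B assume "B \<in> reduce_mat p ` SpZ g"
  then obtain A where A: "A \<in> SpZ g" and B: "B = reduce_mat p A" by auto
  have Ac: "A \<in> carrier_mat n n" using A X_carrier by blast
  then have Bc: "B \<in> carrier_mat n n" by (simp add: B)
  have "vcong p (ap B x) (ap A x)" for x using ap_reduce_mat[OF Ac] by (simp add: B)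
  from om_vcong[OF this this] have "symplectic_mod g p B"
    unfolding symplectic_mod_def using om_inv[OF A] by metis
  then show "B \<in> {A \<in> residue_mats n p.
       reduce_mat p (transpose_mat A * symplectic_form g * A) = reduce_mat p (symplectic_form g)}"
    using symplectic_mod_iff[OF Bc] reduce_mat_in_residue_mats[OF Ac p] by (simp add: B)
next
  fix B assume "B \<in> {A \<in> residue_mats n p.
       reduce_mat p (transpose_mat A * symplectic_form g * A) = reduce_mat p (symplectic_form g)}"
  then have B: "B \<in> residue_mats n p" "B \<in> carrier_mat n n" "symplectic_mod g p B"
    by (auto simp: residue_mats_def symplectic_mod_iff)
  obtain F where F: "F \<in> SpZ g" "\<forall>x. vcong p (ap F x) (ap B x)"
    using lift_mod[OF self_subgroup HS_subset B(2,3)] by blast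
  then have "reduce_mat p F = B"
    using reduce_mat_eq_iff[of F n B p] B X_carrier[OF F(1)] reduce_residue_mats[OF B(1)] by simp
  then show "B \<in> reduce_mat p ` SpZ g" using F by blast
qed

section \<open>Transvections, perfectness and simplicity modulo \<open>p\<close>, symplectic
  case\<close>

definition TS :: "int mat set" where
  "TS = {H v 0 1 | v. v \<in> V n}"

lemma TS_subset: "TS \<subseteq> SpZ g"
  by (auto simp: TS_def H_in_SpZ)

lemma TS_transvection:
  assumes "A \<in> TS"
  shows "transvection A"
proof -
  obtain v where "v \<in> V n" "A = H v 0 1" using assms by (auto simp: TS_def)
  then show ?thesis unfolding transvection_def
    by (intro exI[of _ "\<omega> v"] exI[of _ v]) (simp add: ap_Hm lin_form_def)
qed

text \<open>Polarisation: the quadratic expression of the transvection along \<open>u + w\<close>,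
  minus those along \<open>u\<close> and \<open>w\<close>, leaves the mixed terms. Orthogonality of
  \<open>u\<close> and \<open>w\<close> makes the three factors commute.\<close>

lemma H_as_transvections:
  assumes "u \<in> V n" "w \<in> V n" "\<omega> u w = 0"
  shows "H u w 0 = H (u + w) 0 1 * (H u 0 (- 1) * H w 0 (- 1))"
proof (rule X_eqI)
  have "\<omega> w u = 0" using assms(3) om_swap[of g u w] by simp
  then show "ap (H u w 0) x = ap (H (u + w) 0 1 * (H u 0 (- 1) * H w 0 (- 1))) x" for x
    using assms by (simp add: ap_mult_X H_in_SpZ X_mult ap_Hm fun_eq_iff algebra_simps)
qed (use assms in \<open>simp_all add: H_in_SpZ X_mult\<close>)

lemma generated_by_TS:
  assumes D: "subgroup D \<Gamma>" and T: "TS \<subseteq> D"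
  shows "D = SpZ g"
proof (rule generated_by_HS[OF D], rule subsetI)
  note D' = subgroup_props[OF D]
  have Tp: "H v 0 1 \<in> D" if "v \<in> V n" for v using T that by (auto simp: TS_def)
  have pow: "A [^]\<^bsub>\<Gamma>\<^esub> k \<in> D" if "A \<in> D" for A and k :: nat
    using that D by (induction k) (auto simp: subgroup.m_closed D')
  have Tt: "H v 0 t \<in> D" if v: "v \<in> V n" for v t
  proof -
    have "H v 0 (int k) \<in> D" for k using pow[OF Tp[OF v], of k] H_pow[of v 0 1 k] v by simp
    moreover have "H v 0 (- int k) \<in> D" for k
      using D'(3)[OF calculation[of k]] H_inv[of v 0 "int k"] v by simp
    ultimately show ?thesis by (cases t rule: int_cases2) auto
  qed
  fix A assume "A \<in> HS"
  then obtain b w t where A: "A = H (bas b) w t" and b: "b < n" "w \<in> V n" "\<omega> (bas b) w = 0"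
    by (auto simp: HS_def)
  have "H (bas b) w t = H (bas b) w 0 * H (bas b) 0 t" using b by (simp add: H_mult)
  also have "\<dots> \<in> D" unfolding H_as_transvections[OF bas_in_V[THEN iffD2, OF b(1)] b(2,3)]
    using b by (intro D' Tp Tt) auto
  finally show "A \<in> D" by (simp add: A)
qed

text \<open>A subgroup containing all commutators is normal. Every vector reduces to a multiple of
  \<open>bas 0\<close>, so every transvection in \<open>TS\<close> is conjugate to a power of the
  one along \<open>bas 0\<close>, and only that one has to be found in \<open>D\<close>.\<close>

lemma sp_perfect:
  assumes D: "subgroup D \<Gamma>" and c: "\<And>A B. A \<in> SpZ g \<Longrightarrow> B \<in> SpZ g \<Longrightarrow>
        A \<otimes>\<^bsub>\<Gamma>\<^esub> B \<otimes>\<^bsub>\<Gamma>\<^esub> inv\<^bsub>\<Gamma>\<^esub> A \<otimes>\<^bsub>\<Gamma>\<^esub> inv\<^bsub>\<Gamma>\<^esub> B \<in> D"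
  shows "D = SpZ g"
proof (rule generated_by_TS[OF D], rule subsetI)
  note D' = subgroup_props[OF D]
  have comm: "H u (ap A w - w) (- \<omega> (ap A w) w) \<in> D"
    if "A \<in> SpZ g" "u \<in> V n" "w \<in> V n" "\<omega> u w = 0" "ap A u = u" for A u w
    using H_commutator[OF that, of 0] c[of A "H u w 0"] that H_in_SpZ by simp
  \<comment> \<open>The commutator formula yields the wanted parameter 1 together with an unwanted
    vector \<open>bas (g + 1)\<close>.\<close>
  have "H (bas 0) (bas (g + 1)) 1 \<in> D"
  proof -
    let ?A = "H (bas (g + 1)) 0 (- 1)"
    have ap: "ap ?A x = x + x 1 \<cdot> bas (g + 1)" for x
      by (simp add: ap_Hm fun_eq_iff)
    have "?A \<in> SpZ g" by (simp add: H_in_SpZ)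
    moreover have "ap ?A (bas 0) = bas 0" "ap ?A (bas 1) = bas 1 + bas (g + 1)"
      unfolding ap by (simp_all add: bas_apply)
    ultimately show ?thesis using comm[of ?A "bas 0" "bas 1"] by (simp add: bas_apply)
  qed
  \<comment> \<open>The same unwanted vector with parameter 0, by a commutator through the plane of
    \<open>bas 2\<close>; this uses \<open>g\<close> at least 3. Dividing by it leaves the pure
    transvection.\<close>
  moreover have "H (bas 0) (bas (g + 1)) 0 \<in> D"
  proof -
    let ?A = "H (bas (g + 1)) (bas 2) 0"
    have ap: "ap ?A x = x - x 1 \<cdot> bas 2 + x (g + 2) \<cdot> bas (g + 1)" for x
      by (simp add: ap_Hm fun_eq_iff)
    have "?A \<in> SpZ g" by (simp add: H_in_SpZ bas_apply)
    moreover have "ap ?A (bas 0) = bas 0" "ap ?A (bas (g + 2)) = bas (g + 2) + bas (g + 1)"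
      unfolding ap by (simp_all add: bas_apply)
    ultimately show ?thesis using comm[of ?A "bas 0" "bas (g + 2)"] by (simp add: bas_apply)
  qed
  then have "H (bas 0) (- bas (g + 1)) 0 \<in> D"
    using D'(3)[of "H (bas 0) (bas (g + 1)) 0"] by (simp add: H_inv bas_apply)
  ultimately have "H (bas 0) (bas (g + 1)) 1 * H (bas 0) (- bas (g + 1)) 0 \<in> D" by (rule D')
  then have T0: "H (bas 0) 0 1 \<in> D" by (simp add: H_mult bas_apply)
  have pow: "A [^]\<^bsub>\<Gamma>\<^esub> k \<in> D" if "A \<in> D" for A and k :: nat
    using that D by (induction k) (auto simp: subgroup.m_closed D')
  fix T assume "T \<in> TS"
  then obtain v where v: "v \<in> V n" and T: "T = H v 0 1" by (auto simp: TS_def)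
  obtain w where w: "w \<in> orbit (SpZ g) 0 v" "\<forall>j\<in>{0..<g}. w (g + j) = 0" "\<forall>j\<in>{0<..<g}. w j = 0"
    using vector_reduction[OF self_subgroup HS_subset, of 0 v] by auto
  then obtain F where F: "F \<in> SpZ g" "w = ap F v" by (auto simp: orbit_def[OF self_subgroup HS_subset])
  have wV: "w \<in> V n" using F v by simp
  have w0: "w = w 0 \<cdot> bas 0"
  proof
    fix i
    show "w i = (w 0 \<cdot> bas 0) i"
      by (cases i rule: index_cases) (use w wV in \<open>auto simp: bas_apply V_def\<close>)
  qed
  \<comment> \<open>A transvection is quadratic in its vector, so the exponent is a square and in
    particular nonnegative.\<close>
  have "H (w 0 \<cdot> bas 0) 0 1 = H (bas 0) 0 (w 0 * w 0)"
    by (rule X_eqI) (simp_all add: H_in_SpZ ap_Hm fun_eq_iff)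
  then have Hw: "H w 0 1 = H (bas 0) 0 (w 0 * w 0)"
    using arg_cong[OF w0, of "\<lambda>u. H u 0 1"] by simp
  define k where "k = nat (w 0 * w 0)"
  have "w 0 * w 0 = int k" by (simp add: k_def)
  then have "H w 0 1 = H (bas 0) 0 1 [^]\<^bsub>\<Gamma>\<^esub> k" using H_pow[of "bas 0" 0 1 k] Hw by simp
  then have "H w 0 1 \<in> D" using pow[OF T0, of k] by metis
  moreover have "T = inv\<^bsub>\<Gamma>\<^esub> F * H w 0 1 * inv\<^bsub>\<Gamma>\<^esub> (inv\<^bsub>\<Gamma>\<^esub> F)"
    using H_conj[OF inv_in[OF F(1)] wV, of 0 1] F T by simp
  moreover have "B * A * inv\<^bsub>\<Gamma>\<^esub> B \<in> D" if "A \<in> D" "B \<in> SpZ g" for A B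
  proof -
    have AX: "A \<in> SpZ g" using that D' by blast
    have "B * A * inv\<^bsub>\<Gamma>\<^esub> B * inv\<^bsub>\<Gamma>\<^esub> A * A \<in> D" by (rule D'(2)) (use c[OF that(2) AX] that(1) in simp_all)
    moreover have "B * A * inv\<^bsub>\<Gamma>\<^esub> B * inv\<^bsub>\<Gamma>\<^esub> A * A = B * A * inv\<^bsub>\<Gamma>\<^esub> B"
      using AX that by (intro X_eqI) (auto simp: X_mult inv_in ap_mult_X)
    ultimately show ?thesis by simp
  qed
  ultimately show "T \<in> D" using inv_in[OF F(1)] by simp
qed

lemma sp_nonabelian:
  assumes "p > 1"
  shows "central_mod (CC p) \<noteq> SpZ g"
proof
  assume Z: "central_mod (CC p) = SpZ g"
  let ?A = "H (bas (g + 1)) 0 (- 1)"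
  have ap: "ap ?A x = x + x 1 \<cdot> bas (g + 1)" for x
    by (simp add: ap_Hm fun_eq_iff)
  have A: "?A \<in> SpZ g" by (simp add: H_in_SpZ)
  have A0: "ap ?A (bas 0) = bas 0" unfolding ap by (simp add: bas_apply)
  have A1: "ap ?A (bas 1) = bas 1 + bas (g + 1)" unfolding ap by (simp add: bas_apply)
  have B: "H (bas 0) (bas 1) 0 \<in> SpZ g" by (simp add: H_in_SpZ bas_apply)
  have "?A \<otimes>\<^bsub>\<Gamma>\<^esub> H (bas 0) (bas 1) 0 \<otimes>\<^bsub>\<Gamma>\<^esub> inv\<^bsub>\<Gamma>\<^esub> ?A \<otimes>\<^bsub>\<Gamma>\<^esub> inv\<^bsub>\<Gamma>\<^esub> (H (bas 0) (bas 1) 0) \<in> CC p"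
    using A B Z unfolding central_mod_def by auto
  then have "H (bas 0) (bas (g + 1)) 1 \<in> CC p"
    using H_commutator[OF A, of "bas 0" "bas 1" 0] A0 A1 by (simp add: bas_apply)
  then have "vcong p (ap (H (bas 0) (bas (g + 1)) 1) (bas 1)) (bas 1)" by (auto simp: CC_def)
  then have "int p dvd (ap (H (bas 0) (bas (g + 1)) 1) (bas 1)) 0 - bas 1 0" by (auto simp: vcong_def)
  then have "int p dvd - 1" by (simp add: ap_Hm bas_apply)
  then show False using assms by simp
qed

text \<open>After \<open>x\<close> has become \<open>bas 0\<close>, the cases follow coordinate
  \<open>g\<close> of the image \<open>z\<close> of \<open>y\<close>, its product with
  \<open>bas 0\<close>. A unit modulo \<open>p\<close> means a hyperbolic pair, of which only the
  value \<open>c\<close> survives. Otherwise \<open>z\<close> lies on the line of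
  \<open>bas 0\<close> or has a nonzero part in the other planes, which can be moved to
  \<open>bas 1\<close>.\<close>

lemma pair_normal_form:
  assumes p: "prime p" and x: "x \<in> V n" "\<not> vcong p x 0" and y: "y \<in> V n"
  shows "\<exists>G\<in>SpZ g. vcong p (ap G x) (bas 0) \<and> ((\<exists>l. vcong p (ap G y) (l \<cdot> bas 0)) \<or>
    (\<exists>z\<in>insert (bas 1) {c \<cdot> bas g | c. \<not> int p dvd c}. vcong p (ap G y) z))"
proof -
  have unimodular: "\<exists>r. int p dvd r - 1 \<and>
      (\<forall>d. (\<forall>j. k \<le> j \<longrightarrow> j < g \<longrightarrow> d dvd v j \<and> d dvd v (g + j)) \<longrightarrow> d dvd r)"
    if i: "k \<le> i" "i < g" "\<not> (int p dvd v i \<and> int p dvd v (g + i))" for v :: "nat \<Rightarrow> int" and k i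
  proof -
    obtain l where l: "l = i \<or> l = g + i" "\<not> int p dvd v l" using i by blast
    obtain s where "int p dvd v l * s - 1" using prime_unit[OF p l(2)] .
    then show ?thesis using i l(1) by (intro exI[of _ "v l * s"]) auto
  qed
  obtain i where i: "\<not> int p dvd x i" using x by (auto simp: vcong_def)
  have "\<exists>j<g. \<not> (int p dvd x j \<and> int p dvd x (g + j))"
    using i x(1) by (cases i rule: index_cases) (auto simp: V_def)
  then obtain r where r: "int p dvd r - 1" "\<And>d. (\<And>j. 0 \<le> j \<Longrightarrow> j < g \<Longrightarrow> d dvd x j \<and> d dvd x (g + j)) \<Longrightarrow> d dvd r"
    using unimodular[of 0 _ x] by auto
  obtain F where F: "F \<in> SpZ g" "int p dvd ap F x 0 - 1" "\<And>j. 0 < j \<Longrightarrow> j < g \<Longrightarrow> int p dvd ap F x j"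
    "\<And>j. 0 \<le> j \<Longrightarrow> j < g \<Longrightarrow> int p dvd ap F x (g + j)"
    using column_reduction[OF self_subgroup HS_subset g_gt(1) x(1) r] by metis
  have FV: "ap F x \<in> V n" using F x by simp
  have Fx: "vcong p (ap F x) (bas 0)" unfolding vcong_def
  proof
    fix i
    show "int p dvd ap F x i - bas 0 i"
    proof (cases i rule: index_cases)
      case 1
      then show ?thesis using F(2,3) by (cases "i = 0") (auto simp: bas_apply)
    qed (use F(4) FV in \<open>auto simp: bas_apply V_def\<close>)
  qed
  define z where "z = ap F y"
  have zV: "z \<in> V n" using F y by (simp add: z_def)
  have extend: ?thesis if G: "G \<in> SpZ g" "ap G (bas 0) = bas 0"
    and Gz: "(\<exists>l. vcong p (ap G z) (l \<cdot> bas 0)) \<or>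
      (\<exists>w\<in>insert (bas 1) {c \<cdot> bas g | c. \<not> int p dvd c}. vcong p (ap G z) w)" for G
  proof (intro bexI[of _ "G * F"] conjI)
    show "vcong p (ap (G * F) x) (bas 0)" using ap_vcong[OF Fx, of G] G F by (simp add: ap_mult_X)
  qed (use G Gz F X_mult in \<open>simp_all add: ap_mult_X z_def\<close>)
  show ?thesis
  proof (cases "int p dvd z g")
    case False
    obtain s where s: "int p dvd z g * s - 1" using prime_unit[OF p False] .
    \<comment> \<open>Completing a hyperbolic pair requires product 1, so \<open>z\<close> is scaled
      by the inverse of its coordinate \<open>g\<close> and the scaling is undone
      afterwards.\<close>
    have s': "int p dvd (s \<cdot> z) (g + 0) - 1" using s by (simp add: mult.commute)
    obtain E where E: "E \<in> SpZ g" "ap E (bas 0) = bas 0" "vcong p (ap E (s \<cdot> z)) (bas (g + 0))"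
      by (rule complete_hyperbolic_pair[where y = "s \<cdot> z" and k = 0 and m = p, OF self_subgroup HS_subset g_gt(1)])
        (use s' zV in auto)
    have "vcong p ((z g * s) \<cdot> ap E z) (1 \<cdot> ap E z)" using s by (rule vcong_scal_left)
    moreover have "vcong p (z g \<cdot> ap E (s \<cdot> z)) (z g \<cdot> bas g)" using E(3) by (simp add: vcong_scal)
    moreover have "z g \<cdot> ap E (s \<cdot> z) = (z g * s) \<cdot> ap E z" by (simp add: ap_scal fun_eq_iff)
    ultimately have "vcong p (ap E z) (z g \<cdot> bas g)" by (metis scal_simps(1) vcong_sym vcong_trans)
    then show ?thesis using False by (intro extend[OF E(1,2)]) blast
  next
    case True
    show ?thesis
    proof (cases "\<forall>j. 1 \<le> j \<longrightarrow> j < g \<longrightarrow> int p dvd z j \<and> int p dvd z (g + j)")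
      case all: True
      have "vcong p z (z 0 \<cdot> bas 0)" unfolding vcong_def
      proof
        fix i
        show "int p dvd z i - (z 0 \<cdot> bas 0) i"
        proof (cases i rule: index_cases)
          case 1
          then show ?thesis using all by (cases "i = 0") (auto simp: bas_apply)
        next
          case (2 j)
          then show ?thesis using all True by (cases "j = 0") (auto simp: bas_apply)
        qed (use zV in \<open>auto simp: bas_apply V_def\<close>)
      qed
      then show ?thesis using X_one by (intro extend[of "1\<^sub>m n"]) auto
    next
      case False
      then obtain r where r: "int p dvd r - 1"
        "\<And>d. (\<And>j. 1 \<le> j \<Longrightarrow> j < g \<Longrightarrow> d dvd z j \<and> d dvd z (g + j)) \<Longrightarrow> d dvd r"
        using unimodular[of 1 _ z] by auto
      obtain E where E: "E \<in> SpZ g" "fixes_below 1 E" "int p dvd ap E z 1 - 1"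
        "\<And>j. 1 < j \<Longrightarrow> j < g \<Longrightarrow> int p dvd ap E z j" "\<And>j. 1 \<le> j \<Longrightarrow> j < g \<Longrightarrow> int p dvd ap E z (g + j)"
        "\<And>j. j < 1 \<Longrightarrow> ap E z j = z j" "\<And>j. j < 1 \<Longrightarrow> ap E z (g + j) = z (g + j)"
        using column_reduction[OF self_subgroup HS_subset g_gt(2)[folded One_nat_def] zV r] by metis
      have EV: "ap E z \<in> V n" using E zV by simp
      \<comment> \<open>Elements fixing the first plane cannot change coordinate 0. This one
        subtracts \<open>z 0\<close> times coordinate 1, which is 1 modulo \<open>p\<close>; its
        side effect on coordinate \<open>g + 1\<close> vanishes modulo \<open>p\<close> because
        coordinate \<open>g\<close> does.\<close>
      define B where "B = H (bas 0) (z 0 \<cdot> bas (g + 1)) 0"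
      have B: "B \<in> SpZ g" unfolding B_def by (simp add: H_in_SpZ bas_apply)
      have apB: "ap B x = x + (z 0 * x g) \<cdot> bas (g + 1) - (z 0 * x 1) \<cdot> bas 0" for x
        unfolding B_def by (subst ap_Hm) (simp_all add: fun_eq_iff algebra_simps)
      have "vcong p (ap B (ap E z)) (bas 1)" unfolding vcong_def
      proof
        fix i
        show "int p dvd ap B (ap E z) i - bas 1 i"
        proof (cases i rule: index_cases)
          case 1
          consider "i = 0" | "i = 1" | "1 < i" by linarith
          then show ?thesis
          proof cases
            case 1
            then have "ap B (ap E z) i - bas 1 i = (ap E z 1 - 1) * (- z 0)"
              using E(6)[of 0] by (simp add: apB bas_apply algebra_simps)
            then show ?thesis using E(3) by simp
          next
            case 2
            then show ?thesis using E(3) by (simp add: apB bas_apply)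
          next
            case 3
            then show ?thesis using E(4) \<open>i < g\<close> by (simp add: apB bas_apply)
          qed
        next
          case (2 j)
          have g: "int p dvd ap E z g" using E(7)[of 0] True by simp
          consider "j = 0" | "j = 1" | "1 < j" by linarith
          then show ?thesis by cases (use 2 E(5)[of j] g in \<open>auto simp: apB bas_apply\<close>)
        next
          case 3
          then show ?thesis using EV g3 by (auto simp: apB bas_apply V_def)
        qed
      qed
      moreover have "ap (B * E) (bas 0) = bas 0"
        using B E by (simp add: ap_mult_X fixes_below_def apB bas_apply)
      ultimately show ?thesis using B E X_mult by (intro extend[of "B * E"]) (auto simp: ap_mult_X)
    qed
  qed
qed

text \<open>There are two kinds of independent pairs, orthogonal ones and hyperbolic ones with a
  value \<open>c\<close>. The work lies in connectedness: whichever kind \<open>K\<close> realises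
  must lead to the other.\<close>

lemma sp_almost_simple:
  assumes p: "prime p" and K: "K \<lhd> \<Gamma>" "CC p \<subseteq> K" "K \<noteq> SpZ g"
  shows "K \<subseteq> central_mod (CC p)"
proof (rule almost_simple_if_pair_forms[OF p _ K sp_perfect TS_subset TS_transvection generated_by_TS])
  let ?Z = "insert (bas 1) {c \<cdot> bas g | c. \<not> int p dvd c}"
  show "0 < n" by simp
  show "\<exists>G\<in>SpZ g. vcong p (ap G x) (bas 0) \<and>
      ((\<exists>l. vcong p (ap G y) (l \<cdot> bas 0)) \<or> (\<exists>z\<in>?Z. vcong p (ap G y) z))"
    if "x \<in> V n" "\<not> vcong p x 0" "y \<in> V n" for x y
    by (rule pair_normal_form[OF p that])
  have om_form: "int p dvd \<omega> x y - \<omega> (bas 0) z" if "G \<in> SpZ g" "vcong p (ap G x) (bas 0)" "vcong p (ap G y) z" for G x y z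
    using om_vcong[OF that(2,3), of g] om_inv[OF that(1)] by simp
  have p1: "\<not> int p dvd 1" using prime_gt_1_nat[OF p] by simp
  \<comment> \<open>Pairs with the same nonzero value \<open>c\<close> are equivalent modulo
    \<open>p\<close>, so if \<open>K\<close> joins one of them it joins all.\<close>
  have hyp: "reach K p x y" if c: "reach K p (bas 0) (c \<cdot> bas g)" and xy: "x \<in> V n" "y \<in> V n" "\<omega> x y = c" "\<not> int p dvd c" for x y c
  proof -
    have "\<not> vcong p x 0"
    proof
      assume "vcong p x 0"
      from om_vcong[OF this vcong_refl[of p y], of g] show False using xy by simp
    qed
    then obtain G z where G: "G \<in> SpZ g" "vcong p (ap G x) (bas 0)" "vcong p (ap G y) z"
      and z: "(\<exists>l. z = l \<cdot> bas 0) \<or> z = bas 1 \<or> (\<exists>c. z = c \<cdot> bas g)"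
      using pair_normal_form[OF p xy(1) _ xy(2)] by blast
    have c': "int p dvd c - \<omega> (bas 0) z" using om_form[OF G] xy by simp
    obtain c' where z: "z = c' \<cdot> bas g"
      using z c' xy(4) by (auto simp: bas_apply)
    have "vcong p (c \<cdot> bas g) (c' \<cdot> bas g)" using c' unfolding z by (intro vcong_scal_left) (simp add: bas_apply)
    then have "reach K p (ap G x) (ap G y)"
      using reach_vcong[OF K(1) c vcong_sym[OF G(2)]] vcong_sym[OF G(3)] unfolding z by (blast intro: vcong_trans)
    then show ?thesis using reach_conj_iff[OF K(1) G(1)] by blast
  qed
  show "\<exists>l. reach K p z' (l \<cdot> bas 0)" if z: "z \<in> ?Z" "z' \<in> ?Z" "reach K p (bas 0) z" for z z'
  proof -
    \<comment> \<open>What sends \<open>c \<cdot> bas g\<close> to \<open>bas 0\<close> sends every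
      multiple of \<open>bas g\<close> into the line of \<open>bas 0\<close>, as \<open>c\<close> is
      invertible modulo \<open>p\<close>.\<close>
    have line: "\<exists>l. reach K p (c' \<cdot> bas g) (l \<cdot> bas 0)" if c: "reach K p (bas 0) (c \<cdot> bas g)" "\<not> int p dvd c" for c c'
    proof -
      obtain s where s: "int p dvd c * s - 1" using prime_unit[OF p c(2)] .
      obtain A where A: "A \<in> K" "vcong p (ap A (c \<cdot> bas g)) (bas 0)"
        using reach_sym[OF K(1) c(1)] by (auto simp: reach_def)
      have "vcong p ((s * c') \<cdot> ap A (c \<cdot> bas g)) ((s * c') \<cdot> bas 0)" using A(2) by (rule vcong_scal)
      moreover have "vcong p ((c * s) \<cdot> c' \<cdot> ap A (bas g)) (1 \<cdot> c' \<cdot> ap A (bas g))"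
        using s by (rule vcong_scal_left)
      moreover have "(s * c') \<cdot> ap A (c \<cdot> bas g) = (c * s) \<cdot> c' \<cdot> ap A (bas g)" by (simp add: ap_scal fun_eq_iff)
      moreover have "1 \<cdot> c' \<cdot> ap A (bas g) = ap A (c' \<cdot> bas g)" by (simp add: ap_scal)
      ultimately have "vcong p (ap A (c' \<cdot> bas g)) ((s * c') \<cdot> bas 0)" by (metis vcong_sym vcong_trans)
      then show ?thesis using A(1) by (auto simp: reach_def)
    qed
    show ?thesis
    proof (cases "z = bas 1")
      case True
      \<comment> \<open>The vectors \<open>bas 1\<close> and \<open>c' \<cdot> bas g\<close> are
        orthogonal and independent, like \<open>bas 0\<close> and \<open>bas 1\<close>. So
        \<open>K\<close> joins them as well, and composition links \<open>bas 0\<close> to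
        \<open>c' \<cdot> bas g\<close>.\<close>
      have "\<exists>l. reach K p (c' \<cdot> bas g) (l \<cdot> bas 0)" if c': "\<not> int p dvd c'" for c'
      proof -
        have n0: "\<not> vcong p (bas 1) 0" using p1 by (auto simp: vcong_def bas_apply intro!: exI[of _ 1])
        then obtain G w where G: "G \<in> SpZ g" "vcong p (ap G (bas 1)) (bas 0)" "vcong p (ap G (c' \<cdot> bas g)) w"
          and w: "(\<exists>l. w = l \<cdot> bas 0) \<or> w = bas 1 \<or> (\<exists>c. \<not> int p dvd c \<and> w = c \<cdot> bas g)"
          using pair_normal_form[OF p _ n0, of "c' \<cdot> bas g"] by auto
        have "int p dvd \<omega> (bas 0) w" using om_form[OF G] by (simp add: bas_apply)
        then have "\<not> (\<exists>c. \<not> int p dvd c \<and> w = c \<cdot> bas g)" by (auto simp: bas_apply)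
        moreover have "\<not> (\<exists>l. w = l \<cdot> bas 0)"
        proof
          assume "\<exists>l. w = l \<cdot> bas 0"
          then obtain l where l: "w = l \<cdot> bas 0" by blast
          have "vcong p (ap G (c' \<cdot> bas g)) (ap G (l \<cdot> bas 1))"
            using vcong_trans[OF G(3)[unfolded l] vcong_scal[OF vcong_sym[OF G(2)], of l]] by (simp add: ap_scal)
          from ap_vcong[OF this, of "inv\<^bsub>\<Gamma>\<^esub> G"] have "vcong p (c' \<cdot> bas g) (l \<cdot> bas 1)" using G(1) by simp
          then show False using c' by (auto simp: vcong_def bas_apply dest!: spec[of _ g])
        qed
        ultimately have "w = bas 1" using w by blast
        then have "reach K p (ap G (bas 1)) (ap G (c' \<cdot> bas g))"
          using reach_vcong[OF K(1) z(3) vcong_sym[OF G(2)]] vcong_sym[OF G(3)] True by simp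
        then have b1: "reach K p (bas 1) (c' \<cdot> bas g)" using reach_conj_iff[OF K(1) G(1)] by blast
        have b2: "reach K p (bas 0) (bas 1)" using z(3) True by simp
        have "reach K p (c' \<cdot> bas g) (bas 0)" by (rule reach_sym[OF K(1) reach_trans[OF K(1) b2 b1]])
        then show ?thesis by (intro exI[of _ 1]) simp
      qed
      moreover have "\<exists>l. reach K p (bas 1) (l \<cdot> bas 0)"
        using reach_sym[OF K(1) z(3)] True by (intro exI[of _ 1]) simp
      ultimately show ?thesis using z(2) by blast
    next
      case False
      then obtain c where c: "z = c \<cdot> bas g" "\<not> int p dvd c" using z(1) by blast
      have c0: "reach K p (bas 0) (c \<cdot> bas g)" using z(3) c by simp
      \<comment> \<open>The intermediate vector is chosen to have product \<open>c\<close> with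
        \<open>bas 0\<close> on its left and with \<open>bas 1\<close> on its right.\<close>
      have "reach K p (bas 0) (c \<cdot> bas g - c \<cdot> bas (g + 1))"
        by (rule hyp[OF c0]) (use c in \<open>auto simp: bas_apply\<close>)
      moreover have "reach K p (c \<cdot> bas g - c \<cdot> bas (g + 1)) (bas 1)"
        by (rule hyp[OF c0]) (use c in \<open>auto simp: bas_apply\<close>)
      ultimately have "reach K p (bas 0) (bas 1)" by (rule reach_trans[OF K(1)])
      then have "reach K p (bas 1) (1 \<cdot> bas 0)" using reach_sym[OF K(1)] by simp
      then show ?thesis using line[OF c0 c(2)] z(2) by blast
    qed
  qed
qed

section \<open>The weak congruence property, symplectic case\<close>

context
  fixes K :: "int mat set" and N :: nat
  assumes K: "K \<lhd> \<Gamma>" and N: "N > 0" and pow: "\<And>A. A \<in> SpZ g \<Longrightarrow> A [^]\<^bsub>\<Gamma>\<^esub> N \<in> K"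
begin

lemma multiple_in_K:
  assumes "u \<in> V n" "w \<in> V n" "\<omega> u w = 0"
  shows "H u (int N \<cdot> w) (int N * t) \<in> K"
  using pow[OF H_in_SpZ[OF assms, of t]] H_pow[OF assms, of t N] by simp

lemma multiple_in_CC:
  assumes "u \<in> V n" "w \<in> V n" "\<omega> u w = 0"
  shows "H u (int N \<cdot> w) (int N * t) \<in> CC N"
proof -
  have "ap (H u (int N \<cdot> w) (int N * t)) x = x + int N \<cdot> (\<omega> u x \<cdot> w + (\<omega> w x + t * \<omega> u x) \<cdot> u)" for x
    using assms by (simp add: ap_Hm fun_eq_iff algebra_simps)
  then show ?thesis using assms by (simp add: CC_def H_in_SpZ)
qed

text \<open>By \<open>H_commutator\<close>, \<open>A\<close> commutes modulo \<open>K\<close> with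
  the Heisenberg groups along \<open>bas 0\<close> and along \<open>bas g\<close>. These two
  opposite groups generate everything.\<close>

lemma central_if_block:
  assumes A: "A \<in> CC N" and e: "ap A (bas 0) = bas 0" and f: "ap A (bas g) = bas g"
  shows "A \<in> central_mod K"
proof -
  have AX: "A \<in> SpZ g" and Ac: "\<And>x. vcong N (ap A x) x" using A by (auto simp: CC_def)
  define D where "D = {b \<in> carrier \<Gamma>. A \<otimes>\<^bsub>\<Gamma>\<^esub> b \<otimes>\<^bsub>\<Gamma>\<^esub> inv\<^bsub>\<Gamma>\<^esub> A \<otimes>\<^bsub>\<Gamma>\<^esub> inv\<^bsub>\<Gamma>\<^esub> b \<in> K}"
  have D: "subgroup D \<Gamma>" unfolding D_def using normal.subgroup_commuting_mod[OF K] AX by simp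
  note D' = subgroup_props[OF D]
  have HD: "H u w t \<in> D" if u: "u \<in> V n" "ap A u = u" and w: "w \<in> V n" "\<omega> u w = 0" for u w t
  proof -
    obtain z where zV: "z \<in> V n" and z: "ap A w = w + int N \<cdot> z"
      by (rule vcong_obtain_V[OF Ac[of w], of n]) (use w AX in auto)
    have "\<omega> u (ap A w) = \<omega> u w" using om_inv[OF AX, of u w] u by simp
    then have uz: "\<omega> u z = 0" using z N by simp
    have "ap A w - w = int N \<cdot> z" "- \<omega> (ap A w) w = int N * (- \<omega> z w)" using z by simp_all
    then show ?thesis
      using H_commutator[OF AX u(1) w u(2), of t] multiple_in_K[OF u(1) zV uz, of "- \<omega> z w"] H_in_SpZ[OF u(1) w]
      by (simp add: D_def)
  qed
  have H0: "H (bas 0) w t \<in> D" if "w \<in> V n" "\<omega> (bas 0) w = 0" for w t using HD[OF _ e] that by simp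
  have Hg: "H (bas g) w t \<in> D" if "w \<in> V n" "\<omega> (bas g) w = 0" for w t using HD[OF _ f] that by simp
  \<comment> \<open>\<open>?G\<close> sends \<open>bas 0\<close> first to \<open>bas 0 + b\<close>
    and then, because \<open>\<omega> c b = - 1\<close>, to \<open>b\<close>. So it conjugates
    Heisenberg elements along \<open>bas 0\<close> into those along \<open>b\<close>.\<close>
  have moved: "H b w t \<in> D"
    if b: "b \<in> V n" "\<omega> (bas 0) b = 0" "\<omega> (bas g) b = 0" and c: "c \<in> V n" "\<omega> (bas 0) c = 0" "\<omega> c b = - 1"
      and w: "w \<in> V n" "\<omega> b w = 0" for b c w t
  proof -
    let ?G = "H (bas 0) c 0 * H (bas g) (- b) 0"
    have G: "?G \<in> D" by (intro D'(2) H0 Hg) (use b c in auto)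
    then have GX: "?G \<in> SpZ g" using D'(4) by blast
    have "ap (H (bas g) (- b) 0) (bas 0) = bas 0 + b"
      using b by (simp add: ap_Hm bas_apply fun_eq_iff)
    moreover have "ap (H (bas 0) c 0) (bas 0 + b) = b"
      using b c om_swap[of g c "bas 0"] by (simp add: ap_Hm fun_eq_iff bas_apply)
    ultimately have Gb: "ap ?G (bas 0) = b" using b c by (simp add: ap_mult_X H_in_SpZ)
    let ?w = "ap (inv\<^bsub>\<Gamma>\<^esub> ?G) w"
    have w': "?w \<in> V n" "\<omega> (bas 0) ?w = 0"
      using inv_in[OF GX] w om_inv1[OF GX, of "bas 0" w] Gb by auto
    have "?G * H (bas 0) ?w t * inv\<^bsub>\<Gamma>\<^esub> ?G = H b w t"
      using H_conj[OF GX _ w', of t] Gb GX by simp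
    then show ?thesis using D'(2)[OF D'(2)[OF G H0[OF w', of t]] D'(3)[OF G]] by simp
  qed
  have "HS \<subseteq> D"
  proof
    fix B assume "B \<in> HS"
    then obtain b w t where B: "B = H (bas b) w t" and b: "b < n" and w: "w \<in> V n" "\<omega> (bas b) w = 0"
      by (auto simp: HS_def)
    show "B \<in> D"
    proof (cases b rule: index_cases)
      case 1
      then show ?thesis unfolding B using H0[OF w(1)] moved[of "bas b" "bas (g + b)" w t] b w
        by (cases "b = 0") (simp_all add: bas_apply)
    next
      case (2 j)
      then show ?thesis unfolding B using Hg[OF w(1)] moved[of "bas b" "- bas j" w t] b w
        by (cases "j = 0") (simp_all add: bas_apply)
    qed (use b in simp)
  qed
  then have "D = SpZ g" by (rule generated_by_HS[OF D])
  then show ?thesis using AX by (auto simp: central_mod_def D_def)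
qed

text \<open>Since \<open>A\<close> is an isometry fixing \<open>bas 0\<close>, the image of
  \<open>bas g\<close> has coordinate \<open>g\<close> exactly 1. A Heisenberg element along
  \<open>bas 0\<close> with parameters divisible by \<open>N\<close> moves it back to
  \<open>bas g\<close>.\<close>

lemma central_if_fixes_bas:
  assumes A: "A \<in> CC N" and e: "ap A (bas 0) = bas 0"
  shows "A \<in> central_mod K"
proof -
  have AX: "A \<in> SpZ g" and Ac: "\<And>x. vcong N (ap A x) x" using A by (auto simp: CC_def)
  define y where "y = ap A (bas g)"
  obtain z where zV: "z \<in> V n" and z: "y = bas g + int N \<cdot> z"
    unfolding y_def by (rule vcong_obtain_V[OF Ac[of "bas g"], of n]) (use AX in auto)
  have yg: "y g = 1" using om_inv[OF AX, of "bas 0" "bas g"] e by (simp add: y_def bas_apply)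
  then have zg: "z g = 0" using z N by (simp add: bas_apply)
  define w where "w = z 0 \<cdot> bas 0 - z"
  have w: "w \<in> V n" "\<omega> (bas 0) w = 0" using zV zg by (simp_all add: w_def bas_apply)
  \<comment> \<open>\<open>w\<close> repairs all coordinates but coordinate 0, where
    \<open>N * z 0\<close> remains. The value of \<open>t\<close> removes it along with the
    contribution \<open>\<omega> w y\<close> of \<open>w\<close> itself.\<close>
  define t where "t = - (z 0 + \<omega> w y)"
  let ?B = "H (bas 0) (int N \<cdot> w) (int N * t)"
  have B: "?B \<in> K" "?B \<in> CC N" using multiple_in_K[of "bas 0" w t] multiple_in_CC[of "bas 0" w t] w by auto
  then have BX: "?B \<in> SpZ g" by (simp add: CC_def)
  have apB: "ap ?B x = x + x g \<cdot> (int N \<cdot> w) + (int N * \<omega> w x + int N * t * x g) \<cdot> bas 0" for x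
    using w by (simp add: ap_Hm)
  have "\<omega> w (bas 0) = 0" using w(2) om_swap[of g w "bas 0"] by simp
  then have "ap (?B * A) (bas 0) = bas 0" using AX BX by (simp add: ap_mult_X e apB bas_apply)
  moreover have "ap (?B * A) (bas g) = bas g"
  proof -
    have "ap (?B * A) (bas g) = ap ?B y" using AX BX by (simp add: ap_mult_X y_def)
    also have "\<dots> = y + int N \<cdot> w + (int N * \<omega> w y + int N * t) \<cdot> bas 0" by (simp add: apB yg)
    also have "\<dots> = bas g + int N \<cdot> z + int N \<cdot> w - (int N * z 0) \<cdot> bas 0"
      unfolding t_def by (subst z) (simp add: fun_eq_iff algebra_simps)
    also have "\<dots> = bas g" by (simp add: w_def fun_eq_iff algebra_simps)
    finally show ?thesis .
  qed
  ultimately have "?B * A \<in> central_mod K"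
    by (intro central_if_block subgroup_props(2)[OF CC_subgroup B(2) A])
  then show ?thesis using Z_cancel_left[OF K B(1) AX] by blast
qed

text \<open>The mirror image along \<open>bas g\<close>. A corner equal to 1 gives
  \<open>z 0 = 0\<close>, which is the orthogonality that a Heisenberg element along
  \<open>bas g\<close> requires.\<close>

lemma central_if_coordinate_one:
  assumes A: "A \<in> CC N" and e: "ap A (bas 0) 0 = 1"
  shows "A \<in> central_mod K"
proof -
  have AX: "A \<in> SpZ g" and Ac: "\<And>x. vcong N (ap A x) x" using A by (auto simp: CC_def)
  define v where "v = ap A (bas 0)"
  obtain z where zV: "z \<in> V n" and z: "v = bas 0 + int N \<cdot> z"
    unfolding v_def by (rule vcong_obtain_V[OF Ac[of "bas 0"], of n]) (use AX in auto)
  have v0: "v 0 = 1" using e by (simp add: v_def)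
  then have z0: "z 0 = 0" using z N by (simp add: bas_apply)
  define w where "w = z - z g \<cdot> bas g"
  have w: "w \<in> V n" "\<omega> (bas g) w = 0" using zV z0 by (simp_all add: w_def bas_apply)
  define t where "t = \<omega> w v + z g"
  let ?B = "H (bas g) (int N \<cdot> w) (int N * t)"
  have B: "?B \<in> K" "?B \<in> CC N" using multiple_in_K[of "bas g" w t] multiple_in_CC[of "bas g" w t] w by auto
  then have BX: "?B \<in> SpZ g" by (simp add: CC_def)
  have apB: "ap ?B x = x - x 0 \<cdot> (int N \<cdot> w) + (int N * \<omega> w x - int N * t * x 0) \<cdot> bas g" for x
    using w by (simp add: ap_Hm fun_eq_iff)
  have "ap (?B * A) (bas 0) = bas 0"
  proof -
    have "ap (?B * A) (bas 0) = ap ?B v" using AX BX by (simp add: ap_mult_X v_def)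
    also have "\<dots> = v - int N \<cdot> w + (int N * \<omega> w v - int N * t) \<cdot> bas g" by (simp add: apB v0)
    also have "\<dots> = bas 0 + int N \<cdot> z - int N \<cdot> w - (int N * z g) \<cdot> bas g"
      unfolding t_def by (subst z) (simp add: fun_eq_iff algebra_simps)
    also have "\<dots> = bas 0" by (simp add: w_def fun_eq_iff algebra_simps)
    finally show ?thesis .
  qed
  then have "?B * A \<in> central_mod K"
    by (intro central_if_fixes_bas subgroup_props(2)[OF CC_subgroup B(2) A])
  then show ?thesis using Z_cancel_left[OF K B(1) AX] by blast
qed

text \<open>Instead of a Bezout relation: the image of \<open>bas g\<close> has product 1 with the
  first column, so a Heisenberg element along \<open>bas 2\<close> with parameters divisible by
  \<open>N\<close> can write \<open>N * z 0\<close> into coordinate 2. Conjugation by an element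
  fixing \<open>bas 0\<close> then subtracts it from the corner.\<close>

lemma central_if_plane_vanishes:
  assumes A: "A \<in> CC N" and v: "ap A (bas 0) 2 = 0" "ap A (bas 0) (g + 2) = 0"
  shows "A \<in> central_mod K"
proof -
  have AX: "A \<in> SpZ g" and Ac: "\<And>x. vcong N (ap A x) x" using A by (auto simp: CC_def)
  let ?v = "ap A (bas 0)"
  obtain z where z: "?v = bas 0 + int N \<cdot> z" by (rule vcong_obtain[OF Ac[of "bas 0"]])
  define y where "y = ap A (bas g)"
  \<comment> \<open>Dropping the component in the plane of \<open>bas 2\<close> makes the vector
    orthogonal to \<open>bas 2\<close>. Its product with the first column stays 1, because that
    column vanishes in this plane.\<close>
  define y' where "y' = y - y 2 \<cdot> bas 2 - y (g + 2) \<cdot> bas (g + 2)"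
  have yV: "y \<in> V n" using AX by (simp add: y_def)
  have "2 < n" "g + 2 < n" using g_gt(3) by linarith+
  then have y'V: "y' \<in> V n" using yV by (simp add: y'_def)
  have "\<omega> ?v y = 1" using om_inv[OF AX, of "bas 0" "bas g"] by (simp add: y_def bas_apply)
  then have vy: "\<omega> ?v y' = 1" using v om_bas(3,4)[of 2 g ?v] g_gt(3) by (simp add: y'_def)
  have y2: "\<omega> (bas 2) y' = 0" using g_gt(3) by (simp add: y'_def bas_apply)
  let ?w = "(- z 0) \<cdot> y'"
  let ?B = "H (bas 2) (int N \<cdot> ?w) (int N * 0)"
  have w: "?w \<in> V n" "\<omega> (bas 2) ?w = 0" using y'V y2 by simp_all
  have B: "?B \<in> K" "?B \<in> CC N"
    using multiple_in_K[of "bas 2" ?w 0] multiple_in_CC[of "bas 2" ?w 0] w \<open>2 < n\<close> by auto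
  then have BX: "?B \<in> SpZ g" by (simp add: CC_def)
  have v': "ap (?B * A) (bas 0) = ?v + (int N * z 0) \<cdot> bas 2"
    using AX BX w v vy om_swap[of g y' ?v] \<open>2 < n\<close> g_gt(3) by (simp add: ap_mult_X ap_Hm)
  have BA: "?B * A \<in> CC N" "?B * A \<in> SpZ g"
    using subgroup_props(2)[OF CC_subgroup B(2) A] X_mult[OF BX AX] .
  let ?E = "H (bas 0) (bas (g + 2)) 0"
  have EX: "?E \<in> SpZ g" using \<open>g + 2 < n\<close> g_gt(3) by (simp add: H_in_SpZ bas_apply)
  have apE: "ap ?E x = x + x g \<cdot> bas (g + 2) - x 2 \<cdot> bas 0" for x
    using \<open>g + 2 < n\<close> g_gt(3) om_bas(2)[of 2 g x] by (subst ap_Hm) (simp_all add: fun_eq_iff)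
  have "ap ?E (bas 0) = bas 0" unfolding apE by (simp add: bas_apply)
  then have "ap (inv\<^bsub>\<Gamma>\<^esub> ?E) (bas 0) = bas 0" using ap_inv2[OF EX, of "bas 0"] by metis
  then have "ap (?E * (?B * A) * inv\<^bsub>\<Gamma>\<^esub> ?E) (bas 0) = ap ?E (?v + (int N * z 0) \<cdot> bas 2)"
    using EX BA v' inv_in[OF EX] X_mult[OF EX BA(2)] by (simp only: ap_mult_X)
  moreover have "ap ?E (?v + (int N * z 0) \<cdot> bas 2) 0 = ?v 0 - int N * z 0"
    unfolding apE using v(1) by (simp add: bas_apply)
  moreover have "?v 0 - int N * z 0 = 1" unfolding z by (simp add: bas_apply)
  ultimately have "ap (?E * (?B * A) * inv\<^bsub>\<Gamma>\<^esub> ?E) (bas 0) 0 = 1" by simp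
  then have "?E * (?B * A) * inv\<^bsub>\<Gamma>\<^esub> ?E \<in> central_mod K"
    by (intro central_if_coordinate_one conj_closed[OF CC_normal EX BA(1)])
  then have "?B * A \<in> central_mod K" using Z_conj[OF K EX BA(2)] by blast
  then show ?thesis using Z_cancel_left[OF K B(1) AX] by blast
qed

text \<open>Conjugation by an \<open>F\<close> that fixes plane 0 applies \<open>F\<close> to the
  first column. Reduction in the other planes leaves at most coordinates 0, 1 and \<open>g\<close>
  nonzero, and a further plane, that of \<open>bas 2\<close>, exists because \<open>g\<close> is at
  least 3.\<close>

lemma sp_csp: "CC N \<subseteq> central_mod K"
proof
  fix A assume A: "A \<in> CC N"
  then have AX: "A \<in> SpZ g" by (auto simp: CC_def)
  define v where "v = ap A (bas 0)"
  obtain w where w: "w \<in> orbit (SpZ g) 1 v" "\<forall>j\<in>{1..<g}. w (g + j) = 0" "\<forall>j\<in>{1<..<g}. w j = 0"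
    using vector_reduction[OF self_subgroup HS_subset, of 1 v] by auto
  then obtain F where F: "F \<in> SpZ g" "fixes_below 1 F" "w = ap F v"
    by (auto simp: orbit_def[OF self_subgroup HS_subset])
  have "ap (inv\<^bsub>\<Gamma>\<^esub> F) (bas 0) = bas 0" using ap_inv2[OF F(1), of "bas 0"] F(2) by (simp add: fixes_below_def)
  then have "ap (F * A * inv\<^bsub>\<Gamma>\<^esub> F) (bas 0) = w"
    using F AX by (simp add: ap_mult_X X_mult inv_in v_def)
  moreover have "w 2 = 0" "w (g + 2) = 0"
    using bspec[OF w(2), of 2] bspec[OF w(3), of 2] g_gt(3) by simp_all
  ultimately have "F * A * inv\<^bsub>\<Gamma>\<^esub> F \<in> central_mod K"
    by (intro central_if_plane_vanishes conj_closed[OF CC_normal F(1) A]) simp_all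
  then show "A \<in> central_mod K" using Z_conj[OF K F(1) AX] by blast
qed

end

theorem congruence_family_Sp:
  "congruence_family (Sp_int g) CC (Sp_mod g) reduce_mat"
proof -
  let ?Y = "\<lambda>p. {A \<in> residue_mats n p.
       reduce_mat p (transpose_mat A * symplectic_form g * A) = reduce_mat p (symplectic_form g)}"
  have "congruence_family \<Gamma> CC (\<lambda>p. \<lparr>carrier = ?Y p,
      monoid.mult = (\<lambda>A B. reduce_mat p (A * B)), one = 1\<^sub>m n\<rparr>) reduce_mat"
  proof (rule congruence_familyI)
    show "\<And>p. prime p \<Longrightarrow> central_mod (CC p) \<noteq> SpZ g"
      by (rule sp_nonabelian[OF prime_gt_1_nat])
    show "\<And>p. prime p \<Longrightarrow> reduce_mat p ` SpZ g = ?Y p"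
      by (rule reduce_mat_image[OF prime_gt_0_nat])
  qed (fact sp_perfect sp_csp sp_almost_simple)+
  moreover have "(\<lambda>p. \<lparr>carrier = ?Y p,
      monoid.mult = (\<lambda>A B. reduce_mat p (A * B)), one = 1\<^sub>m n\<rparr>) = Sp_mod g"
    by (simp add: Sp_mod_def fun_eq_iff)
  ultimately show ?thesis by (simp add: Sp_int_def SpZ_eq)
qed

end

theorem theorem1:
  shows "(\<forall>n\<ge>3.
      (\<forall>p. prime p \<longrightarrow>
        finite_nonabelian_simple (PSL_mod n p) \<and> is_quotient_of (PSL_mod n p) (SL_int n)) \<and>
      (\<forall>Q :: ('a, 'b) monoid_scheme.
        finite_nonabelian_simple Q \<and> is_quotient_of Q (SL_int n) \<longrightarrow>
        (\<exists>p. prime p \<and> Q \<cong> PSL_mod n p))) \<and>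
    (\<forall>g\<ge>3.
      (\<forall>p. prime p \<longrightarrow>
        finite_nonabelian_simple (PSp_mod g p) \<and> is_quotient_of (PSp_mod g p) (Sp_int g)) \<and>
      (\<forall>Q :: ('a, 'b) monoid_scheme.
        finite_nonabelian_simple Q \<and> is_quotient_of Q (Sp_int g) \<longrightarrow>
        (\<exists>p. prime p \<and> Q \<cong> PSp_mod g p)))"
proof (intro conjI allI impI)
  fix n :: nat assume "3 \<le> n"
  then interpret sl n by unfold_locales
  interpret F: congruence_family "SL_int n" CC "SL_mod n" reduce_mat by (rule congruence_family_SL)
  show "finite_nonabelian_simple (PSL_mod n p)" "is_quotient_of (PSL_mod n p) (SL_int n)" if "prime p" for p
    using F.simple_mod_center[OF that] F.quotient_mod_center[OF that] by (simp_all add: PSL_mod_def)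
  show "\<exists>p. prime p \<and> Q \<cong> PSL_mod n p"
    if "finite_nonabelian_simple Q \<and> is_quotient_of Q (SL_int n)" for Q :: "('a, 'b) monoid_scheme"
    using F.simple_quotient_iso[of Q] that unfolding PSL_mod_def by blast
next
  fix g :: nat assume "3 \<le> g"
  then interpret sp g by unfold_locales
  interpret F: congruence_family "Sp_int g" CC "Sp_mod g" reduce_mat by (rule congruence_family_Sp)
  show "finite_nonabelian_simple (PSp_mod g p)" "is_quotient_of (PSp_mod g p) (Sp_int g)" if "prime p" for p
    using F.simple_mod_center[OF that] F.quotient_mod_center[OF that] by (simp_all add: PSp_mod_def)
  show "\<exists>p. prime p \<and> Q \<cong> PSp_mod g p"
    if "finite_nonabelian_simple Q \<and> is_quotient_of Q (Sp_int g)" for Q :: "('a, 'b) monoid_scheme"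
    using F.simple_quotient_iso[of Q] that unfolding PSp_mod_def by blast
qed

end
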